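(* Let $\mathscr{A}=(\{\mathcal{A}_{s,t}\}_{0<s<t},\{\Delta_{r,s,t}\}_{0<r<s<t})$ be a unital $C^*$-subproduct system and $\{p_{s,t}\}_{0<s<t}$ be a unit of $\mathscr{A}$. For any $I,J\in\mathcal{P}$ with $I\subseteq J$, consider the $*$-monomorphism $\Delta^\times_{I,J}:\mathcal{A}_I\to\mathcal{A}_J$ given, for $x\in\mathcal{A}_I$, by $\Delta^\times_{I,J}(x)=\Delta_{I,J}(x)$ if $I,J\in\mathcal{P}_{s,t}$ for some $0<s<t$, and $\Delta^\times_{I,J}(x)=p_{\underline{I}}\otimes\Delta_{I,I^\times}(x)\otimes p_{\overline{I}}$ otherwise, where $J=\underline{I}\cup I^\times\cup\overline{I}$ is the decomposition of $J$ with respect to $I$. Then $\{(\mathcal{A}_I,\Delta^\times_{I,J})\,|\,I,J\in\mathcal{P},\ I\subseteq J\}$ is an inductive system of $C^*$-algebras over the partially ordered set $(\mathcal{P},\subseteq)$.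
   Context: All tensor products of $C^*$-algebras are injective (minimal) tensor products; $\mathrm{id}$ denotes identity maps; a $*$-monomorphism is an injective $*$-homomorphism. A $C^*$-subproduct system is a pair $\mathscr{A}=(\{\mathcal{A}_{s,t}\}_{0<s<t},\{\Delta_{r,s,t}\}_{0<r<s<t})$ of $C^*$-algebras $\mathcal{A}_{s,t}$ and $*$-monomorphisms $\Delta_{r,s,t}:\mathcal{A}_{r,t}\to\mathcal{A}_{r,s}\otimes\mathcal{A}_{s,t}$ such that $(\mathrm{id}_{\mathcal{A}_{r,s}}\otimes\Delta_{s,t,u})\Delta_{r,s,u}=(\Delta_{r,s,t}\otimes\mathrm{id}_{\mathcal{A}_{t,u}})\Delta_{r,t,u}$ for all $0<r<s<t<u$. A unit of $\mathscr{A}$ is a family of non-zero projections $p_{s,t}\in\mathcal{A}_{s,t}$, $0<s<t$, with $\Delta_{r,s,t}(p_{r,t})=p_{r,s}\otimes p_{s,t}$ for all $0<r<s<t$; $\mathscr{A}$ is unital if it admits a unit. For $0<s<t$, $\mathcal{P}_{s,t}$ is the set of finite partitions $I=\{s=\iota_0<\iota_1<\dots<\iota_m<\iota_{m+1}=t\}$ of $[s,t]$ ($m\ge 0$). Put $\mathcal{A}_I=\mathcal{A}_{\iota_0,\iota_1}\otimes\cdots\otimes\mathcal{A}_{\iota_m,\iota_{m+1}}$ and $p_I=p_{\iota_0,\iota_1}\otimes\cdots\otimes p_{\iota_m,\iota_{m+1}}$. Define $\Delta_{\{s,t\},I}:\mathcal{A}_{s,t}\to\mathcal{A}_I$ as the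 identity if $m=0$, as $\Delta_{\iota_0,\iota_1,\iota_2}$ if $m=1$, and as $(\Delta_{\{\iota_0,\iota_m\},I\setminus\{\iota_{m+1}\}}\otimes\mathrm{id}_{\mathcal{A}_{\iota_m,\iota_{m+1}}})\Delta_{\iota_0,\iota_m,\iota_{m+1}}$ if $m\ge2$. For $I\subseteq J$ in $\mathcal{P}_{s,t}$, with $I_i=J\cap[\iota_i,\iota_{i+1}]$, put $\Delta_{I,J}=\Delta_{\{\iota_0,\iota_1\},I_0}\otimes\cdots\otimes\Delta_{\{\iota_m,\iota_{m+1}\},I_m}:\mathcal{A}_I\to\mathcal{A}_J=\mathcal{A}_{I_0}\otimes\cdots\otimes\mathcal{A}_{I_m}$. $\mathcal{P}=\bigcup_{0<s<t}\mathcal{P}_{s,t}$ is the set of all finite subsets of $(0,\infty)$ with at least two elements, ordered by inclusion. For $I\subseteq J$ in $\mathcal{P}$ with $I\in\mathcal{P}_{s,t}$, the decomposition of $J$ with respect to $I$ is $J=\underline{I}\cup I^\times\cup\overline{I}$, where $\underline{I}=\{j\in J: j\le s\}$, $I^\times=J\cap[s,t]\in\mathcal{P}_{s,t}$ (a refinement of $I$), $\overline{I}=\{j\in J: j\ge t\}$; accordingly $\mathcal{A}_J=\mathcal{A}_{\underline{I}}\otimes\mathcal{A}_{I^\times}\otimes\mathcal{A}_{\overline{I}}$. If $\underline{I}$ or $\overline{I}$ consists of a single point, the corresponding tensor factor is omitted. *)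

theory Defs
  imports "HOL-Analysis.Analysis" "HOL-Algebra.Module"
begin

section \<open>C*-algebras\<close>

text \<open>Complex algebras are module records over the scalar type \<^typ>\<open>complex\<close>. C*-algebras need not be
  unital: the field \<^const>\<open>one\<close>, which the record inherits, is unconstrained and never used.\<close>

record 'a cstar = "(complex, 'a) module" +
  star :: "'a \<Rightarrow> 'a"
  nrm :: "'a \<Rightarrow> real"

locale cstar_algebra = abelian_group A for A :: "'a cstar" (structure) +
  assumes mult_closed: "\<lbrakk>x \<in> carrier A; y \<in> carrier A\<rbrakk> \<Longrightarrow> x \<otimes> y \<in> carrier A"
    and mult_assoc: "\<lbrakk>x \<in> carrier A; y \<in> carrier A; z \<in> carrier A\<rbrakk>
      \<Longrightarrow> (x \<otimes> y) \<otimes> z = x \<otimes> (y \<otimes> z)"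
    and mult_add_left: "\<lbrakk>x \<in> carrier A; y \<in> carrier A; z \<in> carrier A\<rbrakk>
      \<Longrightarrow> (x \<oplus> y) \<otimes> z = x \<otimes> z \<oplus> y \<otimes> z"
    and mult_add_right: "\<lbrakk>x \<in> carrier A; y \<in> carrier A; z \<in> carrier A\<rbrakk>
      \<Longrightarrow> x \<otimes> (y \<oplus> z) = x \<otimes> y \<oplus> x \<otimes> z"
    and smult_closed: "x \<in> carrier A \<Longrightarrow> c \<odot> x \<in> carrier A"
    and smult_add_left: "x \<in> carrier A \<Longrightarrow> (c + d) \<odot> x = c \<odot> x \<oplus> d \<odot> x"
    and smult_add_right: "\<lbrakk>x \<in> carrier A; y \<in> carrier A\<rbrakk>
      \<Longrightarrow> c \<odot> (x \<oplus> y) = c \<odot> x \<oplus> c \<odot> y"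
    and smult_smult: "x \<in> carrier A \<Longrightarrow> (c * d) \<odot> x = c \<odot> (d \<odot> x)"
    and smult_one: "x \<in> carrier A \<Longrightarrow> 1 \<odot> x = x"
    and smult_mult_left: "\<lbrakk>x \<in> carrier A; y \<in> carrier A\<rbrakk> \<Longrightarrow> (c \<odot> x) \<otimes> y = c \<odot> (x \<otimes> y)"
    and smult_mult_right: "\<lbrakk>x \<in> carrier A; y \<in> carrier A\<rbrakk> \<Longrightarrow> x \<otimes> (c \<odot> y) = c \<odot> (x \<otimes> y)"
    and star_closed: "x \<in> carrier A \<Longrightarrow> star A x \<in> carrier A"
    and star_star: "x \<in> carrier A \<Longrightarrow> star A (star A x) = x"
    and star_add: "\<lbrakk>x \<in> carrier A; y \<in> carrier A\<rbrakk> \<Longrightarrow> star A (x \<oplus> y) = star A x \<oplus> star A y"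
    and star_smult: "x \<in> carrier A \<Longrightarrow> star A (c \<odot> x) = cnj c \<odot> star A x"
    and star_mult: "\<lbrakk>x \<in> carrier A; y \<in> carrier A\<rbrakk> \<Longrightarrow> star A (x \<otimes> y) = star A y \<otimes> star A x"
    and nrm_nonneg: "x \<in> carrier A \<Longrightarrow> 0 \<le> nrm A x"
    and nrm_eq_0: "x \<in> carrier A \<Longrightarrow> nrm A x = 0 \<longleftrightarrow> x = \<zero>"
    and nrm_triangle: "\<lbrakk>x \<in> carrier A; y \<in> carrier A\<rbrakk> \<Longrightarrow> nrm A (x \<oplus> y) \<le> nrm A x + nrm A y"
    and nrm_smult: "x \<in> carrier A \<Longrightarrow> nrm A (c \<odot> x) = cmod c * nrm A x"
    and nrm_mult: "\<lbrakk>x \<in> carrier A; y \<in> carrier A\<rbrakk> \<Longrightarrow> nrm A (x \<otimes> y) \<le> nrm A x * nrm A y"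
    and cstar_identity: "x \<in> carrier A \<Longrightarrow> nrm A (star A x \<otimes> x) = (nrm A x)\<^sup>2"
    and complete: "\<lbrakk>\<forall>n. X n \<in> carrier A; \<forall>\<epsilon>>0. \<exists>N::nat. \<forall>m\<ge>N. \<forall>n\<ge>N. nrm A (X m \<ominus> X n) < \<epsilon>\<rbrakk>
      \<Longrightarrow> \<exists>x\<in>carrier A. (\<lambda>n. nrm A (X n \<ominus> x)) \<longlonglongrightarrow> 0"

definition star_hom :: "'a cstar \<Rightarrow> 'b cstar \<Rightarrow> ('a \<Rightarrow> 'b) \<Rightarrow> bool" where
  "star_hom A B f \<longleftrightarrow>
    f \<in> carrier A \<rightarrow> carrier B \<and>
    (\<forall>x\<in>carrier A. \<forall>y\<in>carrier A.
      f (x \<oplus>\<^bsub>A\<^esub> y) = f x \<oplus>\<^bsub>B\<^esub> f y \<and> f (x \<otimes>\<^bsub>A\<^esub> y) = f x \<otimes>\<^bsub>B\<^esub> f y) \<and>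
    (\<forall>x\<in>carrier A. (\<forall>c. f (c \<odot>\<^bsub>A\<^esub> x) = c \<odot>\<^bsub>B\<^esub> f x) \<and> f (star A x) = star B (f x))"

definition star_mono :: "'a cstar \<Rightarrow> 'b cstar \<Rightarrow> ('a \<Rightarrow> 'b) \<Rightarrow> bool" where
  "star_mono A B f \<longleftrightarrow> star_hom A B f \<and> inj_on f (carrier A)"

definition is_projection :: "'a cstar \<Rightarrow> 'a \<Rightarrow> bool" where
  "is_projection A q \<longleftrightarrow> q \<in> carrier A \<and> star A q = q \<and> q \<otimes>\<^bsub>A\<^esub> q = q"

section \<open>Representations on Hilbert spaces \<open>\<ell>\<^sup>2\<close>\<close>

definition ell2 :: "('h \<Rightarrow> complex) set" where
  "ell2 = {\<xi>. (\<lambda>i. (cmod (\<xi> i))\<^sup>2) summable_on UNIV}"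

definition ell2_inner :: "('h \<Rightarrow> complex) \<Rightarrow> ('h \<Rightarrow> complex) \<Rightarrow> complex" where
  "ell2_inner \<xi> \<eta> = (\<Sum>\<^sub>\<infinity>i. cnj (\<xi> i) * \<eta> i)"

definition ell2_norm :: "('h \<Rightarrow> complex) \<Rightarrow> real" where
  "ell2_norm \<xi> = sqrt (\<Sum>\<^sub>\<infinity>i. (cmod (\<xi> i))\<^sup>2)"

definition bounded_op :: "(('h \<Rightarrow> complex) \<Rightarrow> ('h \<Rightarrow> complex)) \<Rightarrow> bool" where
  "bounded_op S \<longleftrightarrow>
    S \<in> ell2 \<rightarrow> ell2 \<and>
    (\<forall>\<xi>\<in>ell2. \<forall>\<eta>\<in>ell2. S (\<lambda>i. \<xi> i + \<eta> i) = (\<lambda>i. S \<xi> i + S \<eta> i)) \<and>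
    (\<forall>\<xi>\<in>ell2. \<forall>c. S (\<lambda>i. c * \<xi> i) = (\<lambda>i. c * S \<xi> i)) \<and>
    (\<exists>K. \<forall>\<xi>\<in>ell2. ell2_norm (S \<xi>) \<le> K * ell2_norm \<xi>)"

definition op_norm :: "(('h \<Rightarrow> complex) \<Rightarrow> ('h \<Rightarrow> complex)) \<Rightarrow> real" where
  "op_norm S = (SUP \<xi>\<in>{\<xi>\<in>ell2. ell2_norm \<xi> \<le> 1}. ell2_norm (S \<xi>))"

text \<open>For bounded \<open>S\<close> and \<open>R\<close> this is \<open>S \<otimes> R = (S \<otimes> 1) (1 \<otimes> R)\<close> on \<open>\<ell>\<^sup>2(X \<times> Y) = \<ell>\<^sup>2(X) \<otimes> \<ell>\<^sup>2(Y)\<close>: \<open>R\<close> is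
  applied to the slices \<open>\<zeta>(i, \<cdot>)\<close> and then \<open>S\<close> to the slices \<open>(\<cdot>, j)\<close> of the result. It sends the
  function \<open>(i, j) \<mapsto> \<xi> i * \<eta> j\<close> to \<open>(i, j) \<mapsto> S \<xi> i * R \<eta> j\<close>.\<close>

definition op_tensor ::
    "(('h \<Rightarrow> complex) \<Rightarrow> ('h \<Rightarrow> complex)) \<Rightarrow> (('k \<Rightarrow> complex) \<Rightarrow> ('k \<Rightarrow> complex))
      \<Rightarrow> ('h \<times> 'k \<Rightarrow> complex) \<Rightarrow> ('h \<times> 'k \<Rightarrow> complex)" where
  "op_tensor S R \<zeta> = (\<lambda>(i, j). S (\<lambda>i'. R (\<lambda>j'. \<zeta> (i', j')) j) i)"

text \<open>Equality of operators is tested on \<^const>\<open>ell2\<close> only.\<close>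

definition faithful_rep :: "'a cstar \<Rightarrow> ('a \<Rightarrow> ('h \<Rightarrow> complex) \<Rightarrow> ('h \<Rightarrow> complex)) \<Rightarrow> bool" where
  "faithful_rep A \<pi> \<longleftrightarrow>
    (\<forall>a\<in>carrier A. bounded_op (\<pi> a)) \<and>
    (\<forall>\<xi>\<in>ell2. \<forall>a\<in>carrier A. \<forall>b\<in>carrier A.
      \<pi> (a \<oplus>\<^bsub>A\<^esub> b) \<xi> = (\<lambda>i. \<pi> a \<xi> i + \<pi> b \<xi> i) \<and> \<pi> (a \<otimes>\<^bsub>A\<^esub> b) \<xi> = \<pi> a (\<pi> b \<xi>)) \<and>
    (\<forall>\<xi>\<in>ell2. \<forall>a\<in>carrier A. \<forall>c. \<pi> (c \<odot>\<^bsub>A\<^esub> a) \<xi> = (\<lambda>i. c * \<pi> a \<xi> i)) \<and>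
    (\<forall>\<xi>\<in>ell2. \<forall>\<eta>\<in>ell2. \<forall>a\<in>carrier A.
      ell2_inner (\<pi> (star A a) \<xi>) \<eta> = ell2_inner \<xi> (\<pi> a \<eta>)) \<and>
    (\<forall>a\<in>carrier A. \<forall>b\<in>carrier A. (\<forall>\<xi>\<in>ell2. \<pi> a \<xi> = \<pi> b \<xi>) \<longrightarrow> a = b)"

section \<open>Minimal tensor products\<close>

text \<open>\<open>C\<close> with the elementary tensors \<open>\<tau> a b\<close> is a minimal (injective, spatial) tensor product of \<open>A\<close>
  and \<open>B\<close>: a completion of the algebraic tensor product in the spatial norm
  \<open>\<parallel>\<Sum> a\<^sub>k \<otimes> b\<^sub>k\<parallel> = \<parallel>\<Sum> \<pi>(a\<^sub>k) \<otimes> \<rho>(b\<^sub>k)\<parallel>\<close> coming from faithful representations \<open>\<pi>\<close>, \<open>\<rho>\<close>. The spatial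
  norm does not depend on the choice of \<open>\<pi>\<close> and \<open>\<rho>\<close>. As \<open>\<pi>\<close> and \<open>\<rho>\<close> are faithful, the norm formula
  also makes the map from the algebraic tensor product to \<open>C\<close> injective. The representation spaces
  \<open>\<ell>\<^sup>2('a)\<close> and \<open>\<ell>\<^sup>2('b)\<close> are no restriction: representations may be degenerate, and a non-zero
  C*-algebra with carrier in \<open>'a\<close> has a faithful representation on a Hilbert space of dimension at
  most the cardinality of \<open>'a\<close>, by the Gelfand-Naimark construction.\<close>

definition min_tensor ::
    "'a cstar \<Rightarrow> 'b cstar \<Rightarrow> 'c cstar \<Rightarrow> ('a \<Rightarrow> 'b \<Rightarrow> 'c) \<Rightarrow> bool" where
  "min_tensor A B C \<tau> \<longleftrightarrow>
    cstar_algebra A \<and> cstar_algebra B \<and> cstar_algebra C \<and>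
    (\<forall>a\<in>carrier A. \<forall>b\<in>carrier B. \<tau> a b \<in> carrier C) \<and>
    (\<forall>a\<in>carrier A. \<forall>a'\<in>carrier A. \<forall>b\<in>carrier B. \<tau> (a \<oplus>\<^bsub>A\<^esub> a') b = \<tau> a b \<oplus>\<^bsub>C\<^esub> \<tau> a' b) \<and>
    (\<forall>a\<in>carrier A. \<forall>b\<in>carrier B. \<forall>b'\<in>carrier B. \<tau> a (b \<oplus>\<^bsub>B\<^esub> b') = \<tau> a b \<oplus>\<^bsub>C\<^esub> \<tau> a b') \<and>
    (\<forall>a\<in>carrier A. \<forall>b\<in>carrier B. \<forall>c.
      \<tau> (c \<odot>\<^bsub>A\<^esub> a) b = c \<odot>\<^bsub>C\<^esub> \<tau> a b \<and> \<tau> a (c \<odot>\<^bsub>B\<^esub> b) = c \<odot>\<^bsub>C\<^esub> \<tau> a b) \<and>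
    (\<forall>a\<in>carrier A. \<forall>a'\<in>carrier A. \<forall>b\<in>carrier B. \<forall>b'\<in>carrier B.
      \<tau> a b \<otimes>\<^bsub>C\<^esub> \<tau> a' b' = \<tau> (a \<otimes>\<^bsub>A\<^esub> a') (b \<otimes>\<^bsub>B\<^esub> b')) \<and>
    (\<forall>a\<in>carrier A. \<forall>b\<in>carrier B. star C (\<tau> a b) = \<tau> (star A a) (star B b)) \<and>
    (\<exists>(\<pi> :: 'a \<Rightarrow> ('a \<Rightarrow> complex) \<Rightarrow> 'a \<Rightarrow> complex) (\<rho> :: 'b \<Rightarrow> ('b \<Rightarrow> complex) \<Rightarrow> 'b \<Rightarrow> complex).
      faithful_rep A \<pi> \<and> faithful_rep B \<rho> \<and>
      (\<forall>(n::nat) a b. (\<forall>k<n. a k \<in> carrier A \<and> b k \<in> carrier B) \<longrightarrow>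
        nrm C (\<Oplus>\<^bsub>C\<^esub>k\<in>{..<n}. \<tau> (a k) (b k))
          = op_norm (\<lambda>\<zeta> z. \<Sum>k<n. op_tensor (\<pi> (a k)) (\<rho> (b k)) \<zeta> z))) \<and>
    (\<forall>x\<in>carrier C. \<forall>\<epsilon>>0. \<exists>(n::nat) a b.
      (\<forall>k<n. a k \<in> carrier A \<and> b k \<in> carrier B) \<and>
      nrm C (x \<ominus>\<^bsub>C\<^esub> (\<Oplus>\<^bsub>C\<^esub>k\<in>{..<n}. \<tau> (a k) (b k))) < \<epsilon>)"

section \<open>Partitions and iterated tensor products\<close>

definition parts :: "real set set" where
  "parts = {I. finite I \<and> I \<subseteq> {0<..} \<and> 2 \<le> card I}"

definition parts_of :: "real \<Rightarrow> real \<Rightarrow> real set set" where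
  "parts_of s t = {I\<in>parts. Min I = s \<and> Max I = t}"

text \<open>\<open>alg T I\<close> is \<open>\<A>\<^sub>I\<close>. For \<open>Max I = Min J\<close>, \<open>tens T I J x y\<close> is the elementary tensor \<open>x \<otimes> y\<close> under the
  identification \<open>\<A>\<^sub>I \<otimes> \<A>\<^sub>J = \<A>\<^bsub>I \<union> J\<^esub>\<close>.\<close>

record 'a tensor_system =
  alg :: "real set \<Rightarrow> 'a cstar"
  tens :: "real set \<Rightarrow> real set \<Rightarrow> 'a \<Rightarrow> 'a \<Rightarrow> 'a"

text \<open>\<open>T\<close> realizes the iterated minimal tensor products
  \<open>\<A>\<^sub>I = A \<iota>\<^sub>0 \<iota>\<^sub>1 \<otimes> \<dots> \<otimes> A \<iota>\<^sub>m \<iota>\<^bsub>m+1\<^esub>\<close>, with the canonical associativity isomorphisms as identities. Since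
  \<open>\<A>\<^bsub>I \<union> J\<^esub>\<close> is a minimal tensor product of \<open>\<A>\<^sub>I\<close> and \<open>\<A>\<^sub>J\<close>, the algebras \<open>\<A>\<^sub>I\<close> and the maps \<open>tens T I J\<close> are
  determined by the \<open>A s t\<close> up to unique isomorphism. A realization always exists: transport the spatial
  tensor products of finitely many \<open>A s t\<close>, formed on \<open>\<ell>\<^sup>2\<close> spaces over sets of lists, to the type \<open>'a\<close>.\<close>

definition tensor_realization :: "(real \<Rightarrow> real \<Rightarrow> 'a cstar) \<Rightarrow> 'a tensor_system \<Rightarrow> bool" where
  "tensor_realization A T \<longleftrightarrow>
    (\<forall>s t. 0 < s \<and> s < t \<longrightarrow> alg T {s, t} = A s t) \<and>
    (\<forall>I\<in>parts. \<forall>J\<in>parts. Max I = Min J \<longrightarrow>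
      min_tensor (alg T I) (alg T J) (alg T (I \<union> J)) (tens T I J)) \<and>
    (\<forall>I\<in>parts. \<forall>J\<in>parts. \<forall>K\<in>parts. Max I = Min J \<and> Max J = Min K \<longrightarrow>
      (\<forall>x\<in>carrier (alg T I). \<forall>y\<in>carrier (alg T J). \<forall>z\<in>carrier (alg T K).
        tens T (I \<union> J) K (tens T I J x y) z = tens T I (J \<union> K) x (tens T J K y z)))"

text \<open>The *-homomorphism \<open>f \<otimes> g : \<A>\<^sub>I \<otimes> \<A>\<^sub>J \<rightarrow> \<A>\<^bsub>I'\<^esub> \<otimes> \<A>\<^bsub>J'\<^esub>\<close> for \<open>f : \<A>\<^sub>I \<rightarrow> \<A>\<^bsub>I'\<^esub>\<close> and \<open>g : \<A>\<^sub>J \<rightarrow> \<A>\<^bsub>J'\<^esub>\<close>; extensionality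
  only serves to make it unique outside the carrier.\<close>

definition tensor_map ::
    "'a tensor_system \<Rightarrow> real set \<Rightarrow> real set \<Rightarrow> real set \<Rightarrow> real set
      \<Rightarrow> ('a \<Rightarrow> 'a) \<Rightarrow> ('a \<Rightarrow> 'a) \<Rightarrow> 'a \<Rightarrow> 'a" where
  "tensor_map T I J I' J' f g = (THE \<Phi>.
    \<Phi> \<in> extensional (carrier (alg T (I \<union> J))) \<and>
    star_hom (alg T (I \<union> J)) (alg T (I' \<union> J')) \<Phi> \<and>
    (\<forall>x\<in>carrier (alg T I). \<forall>y\<in>carrier (alg T J).
      \<Phi> (tens T I J x y) = tens T I' J' (f x) (g y)))"

section \<open>C*-subproduct systems\<close>

definition cstar_subproduct_system ::
    "(real \<Rightarrow> real \<Rightarrow> 'a cstar) \<Rightarrow> 'a tensor_system \<Rightarrow> (real \<Rightarrow> real \<Rightarrow> real \<Rightarrow> 'a \<Rightarrow> 'a) \<Rightarrow> bool" where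
  "cstar_subproduct_system A T \<Delta> \<longleftrightarrow>
    (\<forall>s t. 0 < s \<and> s < t \<longrightarrow> cstar_algebra (A s t)) \<and>
    (\<forall>r s t. 0 < r \<and> r < s \<and> s < t \<longrightarrow> star_mono (A r t) (alg T {r, s, t}) (\<Delta> r s t)) \<and>
    (\<forall>r s t u. 0 < r \<and> r < s \<and> s < t \<and> t < u \<longrightarrow>
      (\<forall>x\<in>carrier (A r u).
        tensor_map T {r, s} {s, u} {r, s} {s, t, u} (\<lambda>y. y) (\<Delta> s t u) (\<Delta> r s u x)
          = tensor_map T {r, t} {t, u} {r, s, t} {t, u} (\<Delta> r s t) (\<lambda>y. y) (\<Delta> r t u x)))"

definition subproduct_unit ::
    "(real \<Rightarrow> real \<Rightarrow> 'a cstar) \<Rightarrow> 'a tensor_system \<Rightarrow> (real \<Rightarrow> real \<Rightarrow> real \<Rightarrow> 'a \<Rightarrow> 'a)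
      \<Rightarrow> (real \<Rightarrow> real \<Rightarrow> 'a) \<Rightarrow> bool" where
  "subproduct_unit A T \<Delta> p \<longleftrightarrow>
    (\<forall>s t. 0 < s \<and> s < t \<longrightarrow> is_projection (A s t) (p s t) \<and> p s t \<noteq> \<zero>\<^bsub>A s t\<^esub>) \<and>
    (\<forall>r s t. 0 < r \<and> r < s \<and> s < t \<longrightarrow> \<Delta> r s t (p r t) = tens T {r, s} {s, t} (p r s) (p s t))"

text \<open>For \<open>I = {\<iota>\<^sub>0 < \<dots> < \<iota>\<^bsub>m+1\<^esub>}\<close>, \<open>init_part I = I \<setminus> {\<iota>\<^bsub>m+1\<^esub>}\<close> and \<open>last_but_one I = \<iota>\<^sub>m\<close>.\<close>

definition init_part :: "real set \<Rightarrow> real set" where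
  "init_part I = I - {Max I}"

definition last_but_one :: "real set \<Rightarrow> real" where
  "last_but_one I = Max (init_part I)"

lemma card_init_part: "\<not> card I \<le> 2 \<Longrightarrow> card (init_part I) < card I"
  unfolding init_part_def
  by (metis Max_in card.empty card.infinite card_Diff1_less not_le zero_le)

text \<open>\<open>p\<^sub>I\<close>.\<close>

function unit_part :: "'a tensor_system \<Rightarrow> (real \<Rightarrow> real \<Rightarrow> 'a) \<Rightarrow> real set \<Rightarrow> 'a" where
  "unit_part T p I =
    (if card I \<le> 2 then p (Min I) (Max I)
     else tens T (init_part I) {last_but_one I, Max I}
       (unit_part T p (init_part I)) (p (last_but_one I) (Max I)))"
  by auto
termination
  by (relation "Wellfounded.measure (\<lambda>(T, p, I). card I)") (auto simp: card_init_part)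

text \<open>\<open>\<Delta>\<^bsub>{s,t},I\<^esub> : \<A>\<^bsub>s,t\<^esub> \<rightarrow> \<A>\<^sub>I\<close> for \<open>I\<close> in \<^term>\<open>parts_of s t\<close>; the cases are \<open>m = 0\<close>, \<open>m = 1\<close> and \<open>m \<ge> 2\<close>.\<close>

function Delta_part ::
    "'a tensor_system \<Rightarrow> (real \<Rightarrow> real \<Rightarrow> real \<Rightarrow> 'a \<Rightarrow> 'a) \<Rightarrow> real set \<Rightarrow> 'a \<Rightarrow> 'a" where
  "Delta_part T \<Delta> I =
    (if card I \<le> 2 then (\<lambda>x. x)
     else if card I = 3 then \<Delta> (Min I) (last_but_one I) (Max I)
     else tensor_map T
       {Min I, last_but_one I} {last_but_one I, Max I} (init_part I) {last_but_one I, Max I}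
       (Delta_part T \<Delta> (init_part I)) (\<lambda>x. x)
       \<circ> \<Delta> (Min I) (last_but_one I) (Max I))"
  by auto
termination
  by (relation "Wellfounded.measure (\<lambda>(T, d, I). card I)") (auto simp: card_init_part)

text \<open>\<open>\<Delta>\<^bsub>I,J\<^esub>\<close> for \<open>I \<subseteq> J\<close> in the same \<^const>\<open>parts_of\<close>: the tensor product of the maps
  \<open>\<Delta>\<^bsub>{\<iota>\<^sub>i,\<iota>\<^bsub>i+1\<^esub>},I\<^sub>i\<^esub>\<close>, bracketed to the left.\<close>

function Delta :: "'a tensor_system \<Rightarrow> (real \<Rightarrow> real \<Rightarrow> real \<Rightarrow> 'a \<Rightarrow> 'a)
    \<Rightarrow> real set \<Rightarrow> real set \<Rightarrow> 'a \<Rightarrow> 'a" where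
  "Delta T \<Delta> I J =
    (if card I \<le> 2 then Delta_part T \<Delta> J
     else tensor_map T
       (init_part I) {last_but_one I, Max I} (J \<inter> {..last_but_one I}) (J \<inter> {last_but_one I..})
       (Delta T \<Delta> (init_part I) (J \<inter> {..last_but_one I}))
       (Delta_part T \<Delta> (J \<inter> {last_but_one I..})))"
  by auto
termination
  by (relation "Wellfounded.measure (\<lambda>(T, d, I, J). card I)") (auto simp: card_init_part)

declare unit_part.simps [simp del] Delta_part.simps [simp del] Delta.simps [simp del]

definition lower_part :: "real set \<Rightarrow> real set \<Rightarrow> real set" where
  "lower_part I J = {j\<in>J. j \<le> Min I}"

definition middle_part :: "real set \<Rightarrow> real set \<Rightarrow> real set" where
  "middle_part I J = J \<inter> {Min I..Max I}"

definition upper_part :: "real set \<Rightarrow> real set \<Rightarrow> real set" where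
  "upper_part I J = {j\<in>J. Max I \<le> j}"

text \<open>\<open>p\<^sub>I \<otimes> x\<close> and \<open>x \<otimes> p\<^sub>I\<close> for \<open>x\<close> in \<open>\<A>\<^sub>M\<close>, where the factor \<open>p\<^sub>I\<close> is omitted if \<open>I\<close> is a single point.\<close>

definition tens_unit_left ::
    "'a tensor_system \<Rightarrow> (real \<Rightarrow> real \<Rightarrow> 'a) \<Rightarrow> real set \<Rightarrow> real set \<Rightarrow> 'a \<Rightarrow> 'a" where
  "tens_unit_left T p I M x = (if card I = 1 then x else tens T I M (unit_part T p I) x)"

definition tens_unit_right ::
    "'a tensor_system \<Rightarrow> (real \<Rightarrow> real \<Rightarrow> 'a) \<Rightarrow> real set \<Rightarrow> real set \<Rightarrow> 'a \<Rightarrow> 'a" where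
  "tens_unit_right T p M I x = (if card I = 1 then x else tens T M I x (unit_part T p I))"

definition Delta_times :: "'a tensor_system \<Rightarrow> (real \<Rightarrow> real \<Rightarrow> real \<Rightarrow> 'a \<Rightarrow> 'a)
    \<Rightarrow> (real \<Rightarrow> real \<Rightarrow> 'a) \<Rightarrow> real set \<Rightarrow> real set \<Rightarrow> 'a \<Rightarrow> 'a" where
  "Delta_times T \<Delta> p I J x =
    (if \<exists>s t. 0 < s \<and> s < t \<and> I \<in> parts_of s t \<and> J \<in> parts_of s t then Delta T \<Delta> I J x
     else
       tens_unit_right T p (lower_part I J \<union> middle_part I J) (upper_part I J)
         (tens_unit_left T p (lower_part I J) (middle_part I J)
           (Delta T \<Delta> I (middle_part I J) x)))"

section \<open>Inductive systems\<close>

definition inductive_system ::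
    "'i set \<Rightarrow> ('i \<times> 'i) set \<Rightarrow> ('i \<Rightarrow> 'a cstar) \<Rightarrow> ('i \<Rightarrow> 'i \<Rightarrow> 'a \<Rightarrow> 'a) \<Rightarrow> bool" where
  "inductive_system X R B \<phi> \<longleftrightarrow>
    partial_order_on X R \<and>
    X \<noteq> {} \<and> (\<forall>i\<in>X. \<forall>j\<in>X. \<exists>k\<in>X. (i, k) \<in> R \<and> (j, k) \<in> R) \<and>
    (\<forall>i\<in>X. cstar_algebra (B i)) \<and>
    (\<forall>(i, j)\<in>R. star_hom (B i) (B j) (\<phi> i j)) \<and>
    (\<forall>i\<in>X. \<forall>x\<in>carrier (B i). \<phi> i i x = x) \<and>
    (\<forall>i j k. (i, j) \<in> R \<and> (j, k) \<in> R \<longrightarrow>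
      (\<forall>x\<in>carrier (B i). \<phi> j k (\<phi> i j x) = \<phi> i k x))"

end

theory Submission
  imports Defs
begin

text \<open>The analytic point is that *-monomorphisms \<open>f\<close>, \<open>g\<close> have an isometric tensor product \<open>f \<otimes> g\<close> on
  minimal tensor products, that is, that the spatial norm does not depend on the faithful representations.
  An injective *-homomorphism is isometric because a C*-algebra carries only one C*-norm; square roots,
  obtained from a convergent iteration, replace spectral theory here. Compressing one leg of the spatial
  tensor product to finitely many coordinates leaves a matrix over the other algebra, and two equivalent
  C*-norms on such matrices agree.

  Everything else is then checked on elementary tensors. Coassociativity gives
  \<open>\<Delta>\<^bsub>I \<union> I', J \<union> J'\<^esub> = \<Delta>\<^bsub>I, J\<^esub> \<otimes> \<Delta>\<^bsub>I', J'\<^esub>\<close>, hence \<open>\<Delta>\<^bsub>J, K\<^esub> \<Delta>\<^bsub>I, J\<^esub> = \<Delta>\<^bsub>I, K\<^esub>\<close> and \<open>\<Delta>\<^bsub>I, J\<^esub> p\<^sub>I = p\<^sub>J\<close>. In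
  \<open>\<Delta>\<^sup>\<times>\<^bsub>J, K\<^esub> \<Delta>\<^sup>\<times>\<^bsub>I, J\<^esub>\<close> the units on adjacent intervals merge by \<open>p\<^bsub>I \<union> J\<^esub> = p\<^sub>I \<otimes> p\<^sub>J\<close>.\<close>

section \<open>Commuting elements and square roots in C*-algebras\<close>

text \<open>The algebras need not be unital and live on carriers in a bare type, so neither 1 - x
  nor spectra nor a topology from a type class is at hand. Relations that involve 1 - x are
  multiplied by a further element until the unit disappears, and sqrt (1 - 4 g) is reached only
  through (1 - sqrt (1 - 4 g)) / 2, which makes sense without a unit.

  \<open>tensor_map\<close> is a definite description, so each tensor product of maps calls for
  existence and uniqueness. Existence is where the isometry is spent: a value on a sum of elementary
  tensors is well defined, and extends to the completion, because norms are preserved. It is proved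
  for injective factors, hence injectivity is carried through every induction. Uniqueness is proved
  for all bounded additive maps, a class that also contains the maps with one tensor factor held
  fixed.

  The recursions for \<open>unit_part\<close>, \<open>Delta_part\<close> and \<open>Delta\<close>
  split off the last interval, while composition laws need cuts at arbitrary points; most of the
  combinatorial part moves such cuts. Outer factors of \<open>Delta_times\<close> may be absent,
  which is handled by admitting one-point sets next to partitions.\<close>

context cstar_algebra
begin

lemmas closed = mult_closed smult_closed star_closed

lemma smult_zero_left: "x \<in> carrier A \<Longrightarrow> 0 \<odot> x = \<zero>"
  using smult_add_left[of x 0 0] by (metis add.l_cancel_one' add.right_cancel add_0 smult_closed zero_closed l_zero)

lemma a_inv_eq_smult: assumes "x \<in> carrier A" shows "\<ominus> x = (-1) \<odot> x"
proof -
  have "(-1) \<odot> x \<oplus> x = \<zero>"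
    using smult_add_left[of x "-1" 1] assms by (simp add: smult_one smult_zero_left)
  then show ?thesis using assms minus_equality smult_closed by blast
qed

lemma minus_eq_smult: "\<lbrakk>x \<in> carrier A; y \<in> carrier A\<rbrakk> \<Longrightarrow> x \<ominus> y = x \<oplus> (-1) \<odot> y"
  by (simp add: a_minus_def a_inv_eq_smult)

lemma smult_zero_right: "c \<odot> \<zero> = \<zero>"
  using smult_add_right[of \<zero> \<zero> c] by (metis add.l_cancel_one' l_zero smult_closed zero_closed)

lemma mult_zero: assumes "x \<in> carrier A" shows "\<zero> \<otimes> x = \<zero>" "x \<otimes> \<zero> = \<zero>"
  using mult_add_left[of \<zero> \<zero> x] mult_add_right[of x \<zero> \<zero>] assms
  by (metis add.l_cancel_one' l_zero mult_closed zero_closed)+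

lemma star_zero: "star A \<zero> = \<zero>"
  using star_add[of \<zero> \<zero>] by (metis add.l_cancel_one' l_zero star_closed zero_closed)

lemma collect_smult:
  assumes "x \<in> carrier A"
  shows "c \<odot> x \<oplus> d \<odot> x = (c + d) \<odot> x" "x \<oplus> d \<odot> x = (1 + d) \<odot> x" "c \<odot> x \<oplus> x = (c + 1) \<odot> x"
    "x \<oplus> x = 2 \<odot> x"
  using assms smult_add_left[of x 1 1] by (simp_all add: smult_add_left smult_one)

lemma collect_smult_assoc:
  assumes "x \<in> carrier A" "y \<in> carrier A"
  shows "c \<odot> x \<oplus> (d \<odot> x \<oplus> y) = (c + d) \<odot> x \<oplus> y" "x \<oplus> (d \<odot> x \<oplus> y) = (1 + d) \<odot> x \<oplus> y"
    "c \<odot> x \<oplus> (x \<oplus> y) = (c + 1) \<odot> x \<oplus> y" "x \<oplus> (x \<oplus> y) = 2 \<odot> x \<oplus> y"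
  using assms by (simp_all add: a_assoc[symmetric] closed collect_smult)

lemmas expand = closed minus_eq_smult mult_add_left mult_add_right smult_add_right
  smult_mult_left smult_mult_right smult_smult[symmetric] mult_assoc smult_one
  smult_zero_left smult_zero_right mult_zero star_add star_smult star_mult star_zero

text \<open>Differences become sums with coefficient -1; a noncommutative polynomial is then
  multiplied out and neighbouring multiples of one monomial are merged. Commutativity of addition is
  left out, so \<open>a_ac\<close> is supplied where summands have to move.\<close>

lemmas collect = expand a_assoc collect_smult collect_smult_assoc

lemma diff_add_diff: 
  assumes "x \<in> carrier A" "y \<in> carrier A" "z \<in> carrier A"
  shows "(x \<ominus> y) \<oplus> (y \<ominus> z) = x \<ominus> z"
  using assms by (simp add: collect)

lemma diff_eq_zero: "\<lbrakk>x \<in> carrier A; y \<in> carrier A\<rbrakk> \<Longrightarrow> x \<ominus> y = \<zero> \<longleftrightarrow> x = y"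
  by (metis a_minus_def add.inv_solve_right' a_inv_closed l_zero r_neg zero_closed)

lemma nrm_zero: "nrm A \<zero> = 0"
  using nrm_eq_0 by simp

lemma nrm_diff_eq_0: "\<lbrakk>x \<in> carrier A; y \<in> carrier A\<rbrakk> \<Longrightarrow> nrm A (x \<ominus> y) = 0 \<longleftrightarrow> x = y"
  by (simp add: nrm_eq_0 diff_eq_zero)

lemma nrm_diff_comm: assumes "x \<in> carrier A" "y \<in> carrier A" shows "nrm A (x \<ominus> y) = nrm A (y \<ominus> x)"
proof -
  have "y \<ominus> x = (-1) \<odot> (x \<ominus> y)" using assms by (simp add: expand a_comm)
  then show ?thesis using assms nrm_smult[of "x \<ominus> y" "-1"] by simp
qed

lemma nrm_diff_triangle:
  assumes "x \<in> carrier A" "y \<in> carrier A" "z \<in> carrier A"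
  shows "nrm A (x \<ominus> z) \<le> nrm A (x \<ominus> y) + nrm A (y \<ominus> z)"
  using nrm_triangle[of "x \<ominus> y" "y \<ominus> z"] diff_add_diff[of x y z] assms by simp

lemma nrm_abs_diff:
  assumes "x \<in> carrier A" "y \<in> carrier A" shows "\<bar>nrm A x - nrm A y\<bar> \<le> nrm A (x \<ominus> y)"
  using nrm_diff_triangle[of x y \<zero>] nrm_diff_triangle[of y x \<zero>] nrm_diff_comm[of x y] assms
  by (simp add: minus_eq_smult smult_zero_right)

end

text \<open>The function \<open>Q\<close> will be the norm itself, the norm of the target of a
  *-homomorphism pulled back to the source, and the operator norm of a representation. The lower
  half of the C*-identity is assumed; the upper half follows from \<open>Q_mult\<close> and
  \<open>Q_star\<close>.\<close>

locale cstar_seminorm = cstar_algebra A for A :: "'a cstar" (structure) +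
  fixes Q :: "'a \<Rightarrow> real"
  assumes Q_nonneg: "x \<in> carrier A \<Longrightarrow> 0 \<le> Q x"
    and Q_triangle: "\<lbrakk>x \<in> carrier A; y \<in> carrier A\<rbrakk> \<Longrightarrow> Q (x \<oplus> y) \<le> Q x + Q y"
    and Q_smult: "x \<in> carrier A \<Longrightarrow> Q (c \<odot> x) = cmod c * Q x"
    and Q_mult: "\<lbrakk>x \<in> carrier A; y \<in> carrier A\<rbrakk> \<Longrightarrow> Q (x \<otimes> y) \<le> Q x * Q y"
    and Q_star_mult_ge: "x \<in> carrier A \<Longrightarrow> (Q x)\<^sup>2 \<le> Q (star A x \<otimes> x)"
begin

lemma Q_star: assumes "x \<in> carrier A" shows "Q (star A x) = Q x"
proof -
  have le: "Q y \<le> Q (star A y)" if y: "y \<in> carrier A" for y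
  proof (cases "Q y = 0")
    case False
    have "(Q y)\<^sup>2 \<le> Q (star A y) * Q y"
      using Q_star_mult_ge[of y] Q_mult[of "star A y" y] y by (simp add: closed)
    then show ?thesis using False Q_nonneg[OF y] by (simp add: power2_eq_square)
  qed (use Q_nonneg[of "star A y"] y in \<open>simp add: closed\<close>)
  show ?thesis using le[of x] le[of "star A x"] assms by (simp add: star_star closed)
qed

end

sublocale cstar_algebra \<subseteq> nrm: cstar_seminorm A "nrm A"
  by unfold_locales (simp_all add: nrm_nonneg nrm_triangle nrm_smult nrm_mult cstar_identity)

section \<open>Norm convergence and square roots\<close>

context cstar_algebra
begin

definition tends :: "(nat \<Rightarrow> 'a) \<Rightarrow> 'a \<Rightarrow> bool" where
  "tends X x \<longleftrightarrow> (\<forall>n. X n \<in> carrier A) \<and> x \<in> carrier A \<and> (\<lambda>n. nrm A (X n \<ominus> x)) \<longlonglongrightarrow> 0"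

lemma tendsI:
  assumes "\<And>n. X n \<in> carrier A" "x \<in> carrier A" "\<And>n. nrm A (X n \<ominus> x) \<le> f n" "f \<longlonglongrightarrow> 0"
  shows "tends X x"
  unfolding tends_def
  using assms by (auto intro!: Lim_null_comparison[where g = f] always_eventually simp: nrm_nonneg)

lemma tendsD: assumes "tends X x"
  shows "X n \<in> carrier A" "x \<in> carrier A" "(\<lambda>n. nrm A (X n \<ominus> x)) \<longlonglongrightarrow> 0"
  using assms by (auto simp: tends_def)

lemma tends_const: "x \<in> carrier A \<Longrightarrow> tends (\<lambda>n. x) x"
  using nrm_diff_eq_0[of x x] by (simp add: tends_def)

lemma tends_unique: assumes "tends X x" "tends X y" shows "x = y"
proof -
  have c: "\<And>n. X n \<in> carrier A" "x \<in> carrier A" "y \<in> carrier A" using assms by (auto simp: tends_def)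
  have "(\<lambda>n. nrm A (X n \<ominus> x) + nrm A (X n \<ominus> y)) \<longlonglongrightarrow> 0 + 0"
    using assms by (intro tendsto_add) (auto simp: tends_def)
  moreover have "nrm A (x \<ominus> y) \<le> nrm A (X n \<ominus> x) + nrm A (X n \<ominus> y)" for n
    using nrm_diff_triangle[of x "X n" y] nrm_diff_comm[of x "X n"] c by simp
  ultimately have "nrm A (x \<ominus> y) \<le> 0" by (intro LIMSEQ_le_const[of _ 0]) auto
  then show ?thesis using nrm_nonneg[of "x \<ominus> y"] nrm_diff_eq_0[of x y] c by simp
qed

lemma tends_add: assumes "tends X x" "tends Y y" shows "tends (\<lambda>n. X n \<oplus> Y n) (x \<oplus> y)"
proof (rule tendsI)
  note c = tendsD(1,2)[OF assms(1)] tendsD(1,2)[OF assms(2)]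
  show "X n \<oplus> Y n \<in> carrier A" "x \<oplus> y \<in> carrier A" for n using c by (simp_all add: closed)
  show "nrm A ((X n \<oplus> Y n) \<ominus> (x \<oplus> y)) \<le> nrm A (X n \<ominus> x) + nrm A (Y n \<ominus> y)" for n
  proof -
    have "(X n \<oplus> Y n) \<ominus> (x \<oplus> y) = (X n \<ominus> x) \<oplus> (Y n \<ominus> y)"
      using c by (simp add: expand a_ac)
    then show ?thesis using nrm_triangle[of "X n \<ominus> x" "Y n \<ominus> y"] c by simp
  qed
  show "(\<lambda>n. nrm A (X n \<ominus> x) + nrm A (Y n \<ominus> y)) \<longlonglongrightarrow> 0"
    using tendsto_add[OF tendsD(3)[OF assms(1)] tendsD(3)[OF assms(2)]] by simp
qed

lemma tends_nrm: assumes "tends X x" shows "(\<lambda>n. nrm A (X n)) \<longlonglongrightarrow> nrm A x"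
proof -
  have "norm (nrm A (X n) - nrm A x) \<le> nrm A (X n \<ominus> x)" for n
    using tendsD[OF assms] nrm_abs_diff by simp
  then have "(\<lambda>n. nrm A (X n) - nrm A x) \<longlonglongrightarrow> 0"
    by (intro Lim_null_comparison[OF _ tendsD(3)[OF assms]]) simp
  then show ?thesis by (simp add: LIM_zero_iff)
qed

lemma tends_mult: assumes "tends X x" "tends Y y" shows "tends (\<lambda>n. X n \<otimes> Y n) (x \<otimes> y)"
proof (rule tendsI)
  note c = tendsD(1,2)[OF assms(1)] tendsD(1,2)[OF assms(2)]
  show "X n \<otimes> Y n \<in> carrier A" "x \<otimes> y \<in> carrier A" for n using c by (simp_all add: closed)
  show "nrm A ((X n \<otimes> Y n) \<ominus> (x \<otimes> y)) \<le> nrm A (X n) * nrm A (Y n \<ominus> y) + nrm A (X n \<ominus> x) * nrm A y" for n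
  proof -
    have "(X n \<otimes> Y n) \<ominus> (x \<otimes> y) = X n \<otimes> (Y n \<ominus> y) \<oplus> (X n \<ominus> x) \<otimes> y"
      using c by (simp add: collect)
    then show ?thesis
      using nrm_triangle[of "X n \<otimes> (Y n \<ominus> y)" "(X n \<ominus> x) \<otimes> y"] nrm_mult[of "X n" "Y n \<ominus> y"]
        nrm_mult[of "X n \<ominus> x" y] c by (simp add: closed)
  qed
  show "(\<lambda>n. nrm A (X n) * nrm A (Y n \<ominus> y) + nrm A (X n \<ominus> x) * nrm A y) \<longlonglongrightarrow> 0"
    using tendsto_add[OF tendsto_mult[OF tends_nrm[OF assms(1)] tendsD(3)[OF assms(2)]]
        tendsto_mult[OF tendsD(3)[OF assms(1)] tendsto_const[of "nrm A y"]]] by simp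
qed

lemma tends_star: assumes "tends X x" shows "tends (\<lambda>n. star A (X n)) (star A x)"
proof (rule tendsI)
  note c = tendsD(1,2)[OF assms(1)]
  show "star A (X n) \<in> carrier A" "star A x \<in> carrier A" for n using c by (simp_all add: closed)
  have "star A (X n) \<ominus> star A x = star A (X n \<ominus> x)" for n using c by (simp add: expand)
  then show "nrm A (star A (X n) \<ominus> star A x) \<le> nrm A (X n \<ominus> x)" for n
    using c by (simp add: nrm.Q_star closed)
qed (fact tendsD(3)[OF assms])

lemma tends_smult: assumes "tends X x" shows "tends (\<lambda>n. c \<odot> X n) (c \<odot> x)"
proof (rule tendsI)
  note c = tendsD(1,2)[OF assms(1)]
  show "c \<odot> X n \<in> carrier A" "c \<odot> x \<in> carrier A" for n using c by (simp_all add: closed)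
  have "c \<odot> X n \<ominus> c \<odot> x = c \<odot> (X n \<ominus> x)" for n using c by (simp add: expand mult.commute)
  then show "nrm A (c \<odot> X n \<ominus> c \<odot> x) \<le> cmod c * nrm A (X n \<ominus> x)" for n
    using c by (simp add: nrm_smult closed)
qed (use tendsto_mult_right_zero[OF tendsD(3)[OF assms]] in simp)

lemma tends_Suc: "tends X x \<Longrightarrow> tends (\<lambda>n. X (Suc n)) x"
  unfolding tends_def using LIMSEQ_Suc[of "\<lambda>n. nrm A (X n \<ominus> x)" 0] by simp

text \<open>The iteration \<open>w \<mapsto> g + w\<^sup>2\<close> started at 0 is dominated by the scalar iteration \<open>t \<mapsto> 1/4 + t\<^sup>2\<close>, which
  increases to \<open>1/2\<close>. The limit is \<open>w = (1 - sqrt (1 - 4 g)) / 2\<close>.\<close>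

lemma ex_sqrt:
  assumes g: "g \<in> carrier A" "star A g = g" "nrm A g \<le> 1/4"
  obtains w where "w \<in> carrier A" "star A w = w" "nrm A w \<le> 1/2" "w = g \<oplus> w \<otimes> w"
    "\<And>z. \<lbrakk>z \<in> carrier A; z \<otimes> g = g \<otimes> z\<rbrakk> \<Longrightarrow> z \<otimes> w = w \<otimes> z"
proof -
  define W where "W n = rec_nat \<zero> (\<lambda>_ w. g \<oplus> w \<otimes> w) n" for n :: nat
  define t :: "nat \<Rightarrow> real" where "t n = rec_nat 0 (\<lambda>_ t. 1/4 + t * t) n" for n
  have W0: "W 0 = \<zero>" and WS: "\<And>n. W (Suc n) = g \<oplus> W n \<otimes> W n" by (simp_all add: W_def)
  have t0: "t 0 = 0" and tS: "\<And>n. t (Suc n) = 1/4 + t n * t n" by (simp_all add: t_def)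
  have Wc: "W n \<in> carrier A" for n by (induction n) (simp_all add: W0 WS closed g)
  have t_pos: "0 \<le> t n" for n by (induction n) (simp_all add: t0 tS)
  have t_half: "t n \<le> 1/2" for n
  proof (induction n)
    case (Suc n)
    have "t n * t n \<le> 1/2 * (1/2)" using Suc t_pos[of n] by (intro mult_mono) auto
    then show ?case by (simp add: tS)
  qed (simp add: t0)
  have Wt: "nrm A (W n) \<le> t n" for n
  proof (induction n)
    case (Suc n)
    have "nrm A (W n \<otimes> W n) \<le> t n * t n"
      using nrm_mult[of "W n" "W n"] Wc mult_mono[OF Suc Suc t_pos nrm_nonneg[OF Wc]] by fastforce
    then show ?case using nrm_triangle[of g "W n \<otimes> W n"] g Wc by (simp add: WS tS closed)
  qed (simp add: W0 t0 nrm_zero)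
  \<comment> \<open>The identity x^2 - y^2 = x (x - y) + (x - y) y holds without commutation, so the
    increments of \<open>W\<close> are bounded by those of \<open>t\<close>. As \<open>t\<close> is
    bounded and increasing, \<open>W\<close> is Cauchy.\<close>
  have diff1: "nrm A (W (Suc n) \<ominus> W n) \<le> t (Suc n) - t n" for n
  proof (induction n)
    case 0
    show ?case using g by (simp add: W0 WS t0 tS expand)
  next
    case (Suc n)
    let ?d = "W (Suc n) \<ominus> W n"
    have d0: "0 \<le> nrm A ?d" using nrm_nonneg Wc by simp
    have eq: "W (Suc (Suc n)) \<ominus> W (Suc n) = W (Suc n) \<otimes> ?d \<oplus> ?d \<otimes> W n"
    proof -
      have "(g \<oplus> x \<otimes> x) \<ominus> (g \<oplus> y \<otimes> y) = x \<otimes> (x \<ominus> y) \<oplus> (x \<ominus> y) \<otimes> y"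
        if "x \<in> carrier A" "y \<in> carrier A" for x y
        using that g a_ac(3)[of "x \<otimes> x" "(-1) \<odot> g" "(-1) \<odot> (y \<otimes> y)"]  by (simp add: collect)
      from this[OF Wc[of "Suc n"] Wc[of n]] show ?thesis by (metis WS)
    qed
    have "nrm A (W (Suc n) \<otimes> ?d \<oplus> ?d \<otimes> W n) \<le> nrm A (W (Suc n)) * nrm A ?d + nrm A ?d * nrm A (W n)"
      using nrm_triangle[of "W (Suc n) \<otimes> ?d" "?d \<otimes> W n"] nrm_mult[of "W (Suc n)" ?d] nrm_mult[of ?d "W n"] Wc
      by (simp add: closed)
    also have "\<dots> \<le> t (Suc n) * (t (Suc n) - t n) + (t (Suc n) - t n) * t n"
      using Suc d0 order_trans[OF d0 Suc] by (intro add_mono mult_mono) (simp_all only: Wt t_pos nrm_nonneg[OF Wc])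
    also have "\<dots> = t (Suc (Suc n)) - t (Suc n)" by (simp add: tS[of "Suc n"] tS[of n] algebra_simps)
    finally show ?case by (simp only: eq)
  qed
  have diff: "nrm A (W (n + k) \<ominus> W n) \<le> t (n + k) - t n" for n k
  proof (induction k)
    case 0
    show ?case using nrm_diff_eq_0[of "W n" "W n"] Wc by simp
  next
    case (Suc k)
    then show ?case using diff1[of "n + k"] nrm_diff_triangle[of "W (n + Suc k)" "W (n + k)" "W n"] Wc
      by simp
  qed
  have "t n \<le> t (Suc n)" for n
    using diff1[of n] nrm_nonneg[of "W (Suc n) \<ominus> W n"] Wc by simp
  then have "convergent t"
    using t_half by (intro Bseq_mono_convergent BseqI'[of _ "1/2"]) (auto simp: t_pos lift_Suc_mono_le)
  then have "Cauchy t" by (rule convergent_Cauchy)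
  have "\<exists>w\<in>carrier A. (\<lambda>n. nrm A (W n \<ominus> w)) \<longlonglongrightarrow> 0"
  proof (rule complete)
    show "\<forall>n. W n \<in> carrier A" using Wc by blast
    have d: "nrm A (W m \<ominus> W n) \<le> \<bar>t m - t n\<bar>" for m n
      using diff[of n "m - n"] diff[of m "n - m"] nrm_diff_comm[OF Wc Wc, of m n] by (cases "n \<le> m") auto
    show "\<forall>\<epsilon>>0. \<exists>N. \<forall>m\<ge>N. \<forall>n\<ge>N. nrm A (W m \<ominus> W n) < \<epsilon>"
    proof (intro allI impI)
      fix \<epsilon> :: real assume "0 < \<epsilon>"
      then obtain N where "\<And>m n. m \<ge> N \<Longrightarrow> n \<ge> N \<Longrightarrow> \<bar>t m - t n\<bar> < \<epsilon>"
        using \<open>Cauchy t\<close> by (metis CauchyD real_norm_def)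
      then show "\<exists>N. \<forall>m\<ge>N. \<forall>n\<ge>N. nrm A (W m \<ominus> W n) < \<epsilon>" using d by (meson le_less_trans)
    qed
  qed
  then obtain w where w: "tends W w" using Wc by (auto simp: tends_def)
  show ?thesis
  proof
    show wc: "w \<in> carrier A" using w by (simp add: tends_def)
    have "star A (W n) = W n" for n
    proof (induction n)
      case (Suc n)
      have "star A (W n \<otimes> W n) = W n \<otimes> W n" using star_mult[OF Wc[of n] Wc[of n]] Suc by simp
      then show ?case using star_add[of g "W n \<otimes> W n"] g(1,2) Wc[of n] by (simp add: WS closed)
    qed (simp add: W0 star_zero)
    then have "tends W (star A w)" using tends_star[OF w] by simp
    then show "star A w = w" using w by (rule tends_unique)
    have "nrm A (W n) \<le> 1/2" for n using Wt[of n] t_half[of n] by linarith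
    then show "nrm A w \<le> 1/2"
      by (intro LIMSEQ_le_const2[OF tends_nrm[OF w]]) blast
    show "w = g \<oplus> w \<otimes> w"
      by (rule tends_unique[OF tends_Suc[OF w], unfolded WS, OF tends_add[OF tends_const[OF g(1)] tends_mult[OF w w]]])
    \<comment> \<open>Each iterate is a polynomial in \<open>g\<close> without constant term, so it
      commutes with \<open>z\<close>, and the relation survives the limit.\<close>
    show "z \<otimes> w = w \<otimes> z" if z: "z \<in> carrier A" "z \<otimes> g = g \<otimes> z" for z
    proof -
      have "z \<otimes> W n = W n \<otimes> z" for n
      proof (induction n)
        case (Suc n)
        have "z \<otimes> (W n \<otimes> W n) = (W n \<otimes> W n) \<otimes> z"
          using mult_assoc[of z "W n" "W n"] mult_assoc[of "W n" z "W n"] mult_assoc[of "W n" "W n" z] Suc z(1) Wc[of n]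
          by simp
        then have "z \<otimes> (g \<oplus> W n \<otimes> W n) = (g \<oplus> W n \<otimes> W n) \<otimes> z"
          using z g(1) Wc[of n] by (simp only: mult_add_left mult_add_right mult_closed)
        then show ?case by (simp only: WS)
      qed (simp add: W0 mult_zero z)
      then have "tends (\<lambda>n. W n \<otimes> z) (z \<otimes> w)" using tends_mult[OF tends_const[OF z(1)] w] by simp
      then show ?thesis using tends_mult[OF w tends_const[OF z(1)]] by (rule tends_unique)
    qed
  qed
qed

end

section \<open>Comparison of a C*-seminorm with the norm\<close>

context cstar_seminorm
begin

lemma Q_square: assumes "x \<in> carrier A" "star A x = x" shows "Q (x \<otimes> x) = (Q x)\<^sup>2"
  using Q_star_mult_ge[of x] Q_mult[of x x] assms by (simp add: power2_eq_square)

text \<open>The element u = p + i q has real part \<open>p\<close>, whence Q p <= Q u, and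
  commutation turns \<open>star A u\<close> times \<open>u\<close> into p^2 + q^2. This takes the
  place of the order argument p^2 <= p^2 + q^2.\<close>

lemma Q_le_Q_sum_squares:
  assumes p: "p \<in> carrier A" "star A p = p" and q: "q \<in> carrier A" "star A q = q"
    and pq: "p \<otimes> q = q \<otimes> p"
  shows "(Q p)\<^sup>2 \<le> Q (p \<otimes> p \<oplus> q \<otimes> q)"
proof -
  define u where "u = p \<oplus> \<i> \<odot> q"
  have u: "u \<in> carrier A" using p q by (simp add: u_def closed)
  have su: "star A u = p \<oplus> (-\<i>) \<odot> q" using p q by (simp add: u_def star_add star_smult closed)
  have uu: "star A u \<otimes> u = p \<otimes> p \<oplus> q \<otimes> q"
    unfolding su using p q pq by (simp add: u_def collect)
  have "2 \<odot> p = u \<oplus> star A u"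
    unfolding su using p q a_ac(3)[of p "\<i> \<odot> q" "(- \<i>) \<odot> q"] by (simp add: u_def collect a_ac)
  then have "2 * Q p \<le> 2 * Q u"
    using Q_triangle[of u "star A u"] Q_smult[of p 2] p u by (simp add: Q_star closed)
  then have "(Q p)\<^sup>2 \<le> (Q u)\<^sup>2" using Q_nonneg[OF p(1)] by (intro power_mono) simp_all
  also have "\<dots> \<le> Q (p \<otimes> p \<oplus> q \<otimes> q)" using Q_star_mult_ge[OF u] uu by simp
  finally show ?thesis .
qed

text \<open>\<open>v\<^sup>2 = w - w\<^sup>2\<close> says that \<open>2 v\<close> and \<open>1 - 2 w\<close> have squares summing to 1.\<close>

lemma Q_le_half:
  assumes v: "v \<in> carrier A" "star A v = v" and w: "w \<in> carrier A" "star A w = w"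
    and vw: "v \<otimes> w = w \<otimes> v" and eq: "w = v \<otimes> v \<oplus> w \<otimes> w"
  shows "Q v \<le> 1/2"
proof -
  \<comment> \<open>Multiplying v^2 + ((1 - 2 w) / 2)^2 = 1/4 by v^2 removes the unit: with p = v^2
    and q = v (1 - 2 w) / 2 it reads p^2 + q^2 = v^2 / 4. The preceding lemma then gives (Q v)^4 <=
    (Q v)^2 / 4.\<close>
  define p where "p = v \<otimes> v"
  define q where "q = (1/2) \<odot> v \<ominus> w \<otimes> v"
  have c: "p \<in> carrier A" "q \<in> carrier A" using v w by (simp_all add: p_def q_def closed)
  have sp: "star A p = p" using v by (simp add: p_def star_mult)
  have sq: "star A q = q" using v w vw by (simp add: q_def expand)
  have vwl: "v \<otimes> (w \<otimes> x) = w \<otimes> (v \<otimes> x)" if "x \<in> carrier A" for x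
    using v w vw that by (simp add: mult_assoc[symmetric])
  have pq: "p \<otimes> q = q \<otimes> p" using v w vw vwl by (simp add: p_def q_def expand)
  have vv: "v \<otimes> v = w \<ominus> w \<otimes> w"
  proof -
    have "w \<ominus> w \<otimes> w = (v \<otimes> v \<oplus> w \<otimes> w) \<ominus> w \<otimes> w" using eq by simp
    also have "\<dots> = v \<otimes> v" using v w by (simp add: collect)
    finally show ?thesis by simp
  qed
  define s where "s = v \<otimes> v"
  have s: "s \<in> carrier A" using v by (simp add: s_def closed)
  have "p \<otimes> p \<oplus> q \<otimes> q = (1/4) \<odot> s"
  proof -
    have ws: "w \<otimes> s = s \<otimes> w" using v w vw vwl by (simp add: s_def mult_assoc)
    have "q \<otimes> q = (1/4) \<odot> s \<oplus> (-1) \<odot> (s \<otimes> w) \<oplus> s \<otimes> (w \<otimes> w)"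
      using v w vw vwl by (simp add: s_def q_def collect)
    also have "\<dots> = (1/4) \<odot> s \<oplus> (-1) \<odot> (s \<otimes> (w \<ominus> w \<otimes> w))"
      using s w by (simp add: collect)
    finally show ?thesis using s by (simp add: p_def s_def[symmetric] vv[symmetric] collect a_ac)
  qed
  then have "(Q p)\<^sup>2 \<le> Q ((1/4) \<odot> s)"
    using Q_le_Q_sum_squares[OF c(1) sp c(2) sq pq] by simp
  then have "((Q v)\<^sup>2)\<^sup>2 \<le> 1/4 * (Q v)\<^sup>2"
    using Q_smult[OF s] Q_square[OF v] by (simp add: p_def s_def)
  then have "(Q v)\<^sup>2 * (Q v)\<^sup>2 \<le> (1/2)\<^sup>2 * (Q v)\<^sup>2" by (simp add: power2_eq_square)
  then have "(Q v)\<^sup>2 \<le> (1/2)\<^sup>2 \<or> Q v = 0" using mult_right_le_imp_le[of "(Q v)\<^sup>2" "(Q v)\<^sup>2" "(1/2)\<^sup>2"] by fastforce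
  then show ?thesis using power2_le_imp_le[of "Q v" "1/2"] by auto
qed

text \<open>For self-adjoint \<open>h\<close> of norm at most 1/2, the norm of h^2 is at most 1/4,
  so w = h^2 + w^2 has a solution and \<open>Q_le_half\<close> applies with v = h. Scaling covers
  all self-adjoint elements, and the product of \<open>star A x\<close> with \<open>x\<close> covers
  the rest. For a pulled-back norm this is contractivity of *-homomorphisms.\<close>

lemma Q_le_nrm: assumes x: "x \<in> carrier A" shows "Q x \<le> nrm A x"
proof -
  have half: "Q h \<le> 1/2" if h: "h \<in> carrier A" "star A h = h" "nrm A h \<le> 1/2" for h
  proof -
    have "nrm A (h \<otimes> h) \<le> 1/2 * (1/2)"
      using nrm_mult[OF h(1) h(1)] mult_mono[OF h(3) h(3) _ nrm_nonneg[OF h(1)]] by simp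
    then have "nrm A (h \<otimes> h) \<le> 1/4" by simp
    moreover have "h \<otimes> h \<in> carrier A" "star A (h \<otimes> h) = h \<otimes> h" "h \<otimes> (h \<otimes> h) = (h \<otimes> h) \<otimes> h"
      using h by (simp_all add: closed star_mult mult_assoc)
    ultimately obtain w where "w \<in> carrier A" "star A w = w" "w = h \<otimes> h \<oplus> w \<otimes> w" "h \<otimes> w = w \<otimes> h"
      using ex_sqrt h(1) by metis
    then show ?thesis using Q_le_half[of h w] h by blast
  qed
  have sa: "Q h \<le> nrm A h" if h: "h \<in> carrier A" "star A h = h" for h
  proof (cases "nrm A h = 0")
    case True
    then have "h = 0 \<odot> h" using h nrm_eq_0 by (simp add: smult_zero_right)
    then have "Q h = 0" using Q_smult[of h 0] h by simp
    then show ?thesis using nrm_nonneg h by simp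
  next
    case False
    then have pos: "0 < nrm A h" using nrm_nonneg[OF h(1)] by simp
    define c :: complex where "c = of_real (1 / (2 * nrm A h))"
    have cm: "cmod c = 1 / (2 * nrm A h)" using pos by (simp add: c_def norm_divide norm_mult)
    have "Q (c \<odot> h) \<le> 1/2"
      by (rule half) (use h pos in \<open>simp_all add: closed star_smult nrm_smult cm\<close>, simp_all add: c_def)
    then show ?thesis using pos h by (simp add: Q_smult cm field_simps)
  qed
  have "(Q x)\<^sup>2 \<le> Q (star A x \<otimes> x)" using Q_star_mult_ge x .
  also have "\<dots> \<le> (nrm A x)\<^sup>2"
    using sa[of "star A x \<otimes> x"] x by (simp add: closed star_mult star_star cstar_identity)
  finally show ?thesis by (rule power2_le_imp_le) (rule nrm_nonneg[OF x])
qed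

end

context cstar_seminorm
begin

text \<open>With \<open>h = c\<^sup>2\<close>, the \<open>w\<^sub>2\<close> below is \<open>min h (1 - h)\<close>. If \<open>Q h < 1/2\<close> it cannot be distinguished from \<open>h\<close>
  by \<open>Q\<close>, so it equals \<open>h\<close>, although its norm is at most \<open>1/2\<close>.\<close>

lemma nrm_square_le_half:
  assumes definite: "\<And>x. \<lbrakk>x \<in> carrier A; Q x = 0\<rbrakk> \<Longrightarrow> x = \<zero>"
    and c: "c \<in> carrier A" "star A c = c" "nrm A c \<le> 1" and Qc: "Q (c \<otimes> c) < 1/2"
  shows "nrm A (c \<otimes> c) \<le> 1/2"
proof -
  define h where "h = c \<otimes> c"
  have h: "h \<in> carrier A" using c by (simp add: h_def closed)
  have "nrm A h \<le> 1 * 1"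
    unfolding h_def using nrm_mult[OF c(1) c(1)] mult_mono[OF c(3) c(3) _ nrm_nonneg[OF c(1)]] by simp
  then have "nrm A ((1/4) \<odot> h) \<le> 1/4" using h by (simp add: nrm_smult norm_divide)
  moreover have "star A ((1/4) \<odot> h) = (1/4) \<odot> h" using c by (simp add: h_def star_smult star_mult closed)
  ultimately obtain w where w: "w \<in> carrier A" "star A w = w" "w = (1/4) \<odot> h \<oplus> w \<otimes> w"
    and comm: "\<And>z. \<lbrakk>z \<in> carrier A; z \<otimes> ((1/4) \<odot> h) = ((1/4) \<odot> h) \<otimes> z\<rbrakk> \<Longrightarrow> z \<otimes> w = w \<otimes> z"
    using ex_sqrt[of "(1/4) \<odot> h"] h by (metis smult_closed)
  have cw: "c \<otimes> w = w \<otimes> c" using comm[of c] c by (simp add: h_def expand)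
  have cwl: "c \<otimes> (w \<otimes> x) = w \<otimes> (c \<otimes> x)" if "x \<in> carrier A" for x
    using c w(1) cw that by (simp add: mult_assoc[symmetric])
  have hw: "w \<otimes> h = h \<otimes> w" using c w(1) cw cwl by (simp add: h_def mult_assoc)
  \<comment> \<open>Here w = (1 - sqrt (1 - h)) / 2, so \<open>v\<close> is c (1 - 2 w) = c sqrt (1
    - h), with square h - h^2.\<close>
  define v where "v = c \<ominus> 2 \<odot> (w \<otimes> c)"
  have v: "v \<in> carrier A" "star A v = v" using c w(1,2) cw by (simp_all add: v_def expand)
  have vv: "v \<otimes> v = h \<ominus> h \<otimes> h"
  proof -
    have "v \<otimes> v = h \<oplus> (-4) \<odot> (h \<otimes> w) \<oplus> 4 \<odot> (h \<otimes> (w \<otimes> w))"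
      using c w(1) cw cwl by (simp add: v_def h_def collect)
    also have "\<dots> = h \<ominus> 4 \<odot> (h \<otimes> (w \<ominus> w \<otimes> w))"
      using h w(1) by (simp add: expand a_ac)
    also have "w \<ominus> w \<otimes> w = (1/4) \<odot> h"
    proof -
      have "w \<ominus> w \<otimes> w = ((1/4) \<odot> h \<oplus> w \<otimes> w) \<ominus> w \<otimes> w" using w(3) by simp
      also have "\<dots> = (1/4) \<odot> h" using h w(1) by (simp add: collect)
      finally show ?thesis .
    qed
    finally show ?thesis using h by (simp add: expand)
  qed
  have hv: "v \<otimes> h = h \<otimes> v" using c w(1) cw cwl by (simp add: v_def h_def expand)
  \<comment> \<open>The relation h = v^2 + h^2 lets \<open>h\<close> itself play the part of
    \<open>w\<close> in \<open>Q_le_half\<close>, used here for the norm as seminorm.\<close>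
  have "nrm A v \<le> 1/2"
    by (rule nrm.Q_le_half[of v h]) (use v h hv c in \<open>simp_all add: vv, simp_all add: h_def star_mult collect\<close>)
  then have "nrm A (v \<otimes> v) \<le> 1/2 * (1/2)"
    using nrm_mult[OF v(1) v(1)] mult_mono[OF _ _ _ nrm_nonneg[OF v(1)], of "nrm A v" "1/2" "1/2"] by simp
  then have "nrm A (v \<otimes> v) \<le> 1/4" by simp
  moreover have "v \<otimes> v \<in> carrier A" "star A (v \<otimes> v) = v \<otimes> v" using v by (simp_all add: closed star_mult)
  ultimately obtain w2 where w2: "w2 \<in> carrier A" "nrm A w2 \<le> 1/2" "w2 = v \<otimes> v \<oplus> w2 \<otimes> w2"
    using ex_sqrt by metis
  \<comment> \<open>Both \<open>h\<close> and \<open>w2\<close> solve x = v^2 + x^2, hence d = h d +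
    d w2. Contractivity gives Q w2 <= 1/2, so the factor \<open>Q h + Q w2\<close> is below 1 and
    forces Q d = 0.\<close>
  define d where "d = h \<ominus> w2"
  have d: "d \<in> carrier A" using h w2 by (simp add: d_def)
  have "d = h \<ominus> (v \<otimes> v \<oplus> w2 \<otimes> w2)" using d_def w2(3) by simp
  also have "\<dots> = h \<otimes> h \<ominus> w2 \<otimes> w2" using h w2(1) by (simp add: vv collect)
  also have "\<dots> = h \<otimes> d \<oplus> d \<otimes> w2" using h w2(1) by (simp add: d_def collect)
  finally have "Q d \<le> Q h * Q d + Q d * Q w2"
    using Q_triangle[of "h \<otimes> d" "d \<otimes> w2"] Q_mult[of h d] Q_mult[of d w2] h d w2 by (simp add: closed)
  also have "\<dots> = (Q h + Q w2) * Q d" by (simp add: algebra_simps)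
  finally have le: "Q d \<le> (Q h + Q w2) * Q d" .
  have "Q h + Q w2 < 1" using Q_le_nrm[OF w2(1)] w2(2) Qc by (simp add: h_def)
  then have "Q d = 0" using le Q_nonneg[OF d] mult_strict_right_mono[of "Q h + Q w2" 1 "Q d"] by fastforce
  then have "h = w2" using definite[OF d] diff_eq_zero h w2(1) by (simp add: d_def)
  then show ?thesis using w2(2) by (simp add: h_def)
qed

text \<open>If Q h < nrm h for a self-adjoint \<open>h\<close>, some multiple \<open>c\<close> of
  \<open>h\<close> has c^2 of norm above 1/2 and of \<open>Q\<close>-value below 1/2, which
  contradicts \<open>nrm_square_le_half\<close>. General elements follow through the
  C*-identity.\<close>

theorem Q_eq_nrm:
  assumes definite: "\<And>x. \<lbrakk>x \<in> carrier A; Q x = 0\<rbrakk> \<Longrightarrow> x = \<zero>" and x: "x \<in> carrier A"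
  shows "Q x = nrm A x"
proof -
  have sa: "nrm A h \<le> Q h" if h: "h \<in> carrier A" "star A h = h" for h
  proof (rule ccontr)
    assume "\<not> nrm A h \<le> Q h"
    then have lt: "Q h < nrm A h" by simp
    then have pos: "0 < nrm A h" using Q_nonneg[OF h(1)] by simp
    define r where "r = Q h / nrm A h"
    have r: "0 \<le> r" "r < 1" using lt pos Q_nonneg[OF h(1)] by (auto simp: r_def)
    define q where "q = r * r"
    have "0 \<le> q" "q < 1" unfolding q_def using r mult_strict_mono[of r 1 r 1] by auto
    \<comment> \<open>The scale t = 1 / (1 + q) exceeds 1/2 because q < 1, while t q stays below
      1/2. It becomes the norm of c^2, and t q its value under \<open>Q\<close>.\<close>
    then have "0 < 1 / (1 + q)" "1 / (1 + q) \<le> 1" "1/2 < 1 / (1 + q)" "1 / (1 + q) * q < 1/2"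
      by (simp_all add: field_simps)
    then obtain t where t: "0 < t" "t \<le> 1" "1/2 < t" "t * q < 1/2" by blast
    define s where "s = sqrt t"
    have s0: "0 < s" "s \<le> 1" and s2: "s\<^sup>2 = t" using t by (simp_all add: s_def)
    define c where "c = complex_of_real (s / nrm A h) \<odot> h"
    have c: "c \<in> carrier A" "star A c = c" using h by (simp_all add: c_def closed star_smult)
    have nc: "nrm A c = s" using h pos s0 by (simp add: c_def nrm_smult norm_divide)
    have "Q c = s * r" using h pos s0 by (simp add: c_def Q_smult norm_divide r_def)
    then have "Q (c \<otimes> c) < 1/2"
      using Q_square[OF c] s2 t(4) by (simp add: power_mult_distrib q_def power2_eq_square[of r])
    moreover have "nrm A c \<le> 1" using nc s0 by simp
    ultimately have "nrm A (c \<otimes> c) \<le> 1/2"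
      using nrm_square_le_half[OF definite c] by blast
    then show False using nrm.Q_square[OF c] nc s2 t(3) by simp
  qed
  have "(nrm A x)\<^sup>2 \<le> Q (star A x \<otimes> x)"
    using sa[of "star A x \<otimes> x"] x by (simp add: closed star_mult star_star cstar_identity)
  also have "\<dots> \<le> (Q x)\<^sup>2" using Q_mult[of "star A x" x] x by (simp add: closed Q_star power2_eq_square)
  finally have "nrm A x \<le> Q x" by (rule power2_le_imp_le) (rule Q_nonneg[OF x])
  then show ?thesis using Q_le_nrm[OF x] by simp
qed

end

section \<open>The Hilbert spaces \<open>\<ell>\<^sup>2\<close> and bounded operators\<close>

text \<open>Uniform control of finite partial sums gives membership and norm at once, so the
  inequalities available for \<open>L2_set\<close> carry over to infinite sums.\<close>

lemma ell2I:
  assumes "\<And>F. finite F \<Longrightarrow> L2_set (\<lambda>i. cmod (\<xi> i)) F \<le> K"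
  shows "\<xi> \<in> ell2" "ell2_norm \<xi> \<le> K"
proof -
  have K: "0 \<le> K" using assms[of "{}"] by simp
  have fin: "(\<Sum>i\<in>F. (cmod (\<xi> i))\<^sup>2) \<le> K\<^sup>2" if "finite F" for F
    using power_mono[OF assms[OF that], of 2] by (simp add: L2_set_def sum_nonneg)
  show "\<xi> \<in> ell2" unfolding ell2_def
    by (simp, rule nonneg_bdd_above_summable_on) (use fin in \<open>auto intro!: bdd_aboveI[of _ "K\<^sup>2"]\<close>)
  then have "(\<Sum>\<^sub>\<infinity>i. (cmod (\<xi> i))\<^sup>2) \<le> K\<^sup>2"
    unfolding ell2_def by (intro infsum_le_finite_sums) (use fin in auto)
  then show "ell2_norm \<xi> \<le> K" unfolding ell2_norm_def using K by (simp add: real_le_lsqrt infsum_nonneg)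
qed

lemma L2_set_le_ell2_norm:
  assumes "\<xi> \<in> ell2" "finite F" shows "L2_set (\<lambda>i. cmod (\<xi> i)) F \<le> ell2_norm \<xi>"
  unfolding L2_set_def ell2_norm_def
  using assms by (intro real_sqrt_le_mono finite_sum_le_infsum) (auto simp: ell2_def)

lemma ell2_norm_nonneg: "0 \<le> ell2_norm \<xi>"
  by (simp add: ell2_norm_def infsum_nonneg)

lemma cmod_le_ell2_norm: "\<xi> \<in> ell2 \<Longrightarrow> cmod (\<xi> i) \<le> ell2_norm \<xi>"
  using L2_set_le_ell2_norm[of \<xi> "{i}"] by simp

lemma ell2_norm_eq_0: assumes "\<xi> \<in> ell2" "ell2_norm \<xi> = 0" shows "\<xi> = (\<lambda>i. 0)"
  using cmod_le_ell2_norm[OF assms(1)] assms(2) by fastforce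

lemma ell2_zero [simp]: "(\<lambda>i. 0) \<in> ell2" "ell2_norm (\<lambda>i. 0) = 0"
  by (simp_all add: ell2_def ell2_norm_def)

lemma ell2_add:
  assumes "\<xi> \<in> ell2" "\<eta> \<in> ell2"
  shows "(\<lambda>i. \<xi> i + \<eta> i) \<in> ell2" "ell2_norm (\<lambda>i. \<xi> i + \<eta> i) \<le> ell2_norm \<xi> + ell2_norm \<eta>"
proof -
  have "L2_set (\<lambda>i. cmod (\<xi> i + \<eta> i)) F \<le> ell2_norm \<xi> + ell2_norm \<eta>" if "finite F" for F
  proof -
    have "L2_set (\<lambda>i. cmod (\<xi> i + \<eta> i)) F \<le> L2_set (\<lambda>i. cmod (\<xi> i) + cmod (\<eta> i)) F"
      by (intro L2_set_mono) (auto intro: norm_triangle_ineq)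
    also have "\<dots> \<le> L2_set (\<lambda>i. cmod (\<xi> i)) F + L2_set (\<lambda>i. cmod (\<eta> i)) F" by (rule L2_set_triangle_ineq)
    finally show ?thesis using L2_set_le_ell2_norm[OF assms(1) that] L2_set_le_ell2_norm[OF assms(2) that] by simp
  qed
  then show "(\<lambda>i. \<xi> i + \<eta> i) \<in> ell2" "ell2_norm (\<lambda>i. \<xi> i + \<eta> i) \<le> ell2_norm \<xi> + ell2_norm \<eta>"
    using ell2I[of "\<lambda>i. \<xi> i + \<eta> i"] by blast+
qed

lemma ell2_scale: assumes "\<xi> \<in> ell2"
  shows "(\<lambda>i. c * \<xi> i) \<in> ell2" "ell2_norm (\<lambda>i. c * \<xi> i) = cmod c * ell2_norm \<xi>"
proof -
  show "(\<lambda>i. c * \<xi> i) \<in> ell2"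
    using assms summable_on_cmult_right[of "\<lambda>i. (cmod (\<xi> i))\<^sup>2" UNIV "(cmod c)\<^sup>2"]
    by (simp add: ell2_def norm_mult power_mult_distrib)
  show "ell2_norm (\<lambda>i. c * \<xi> i) = cmod c * ell2_norm \<xi>"
    unfolding ell2_norm_def norm_mult power_mult_distrib infsum_cmult_right' by (simp add: real_sqrt_mult)
qed

lemma ell2_sum: assumes "finite F" "\<And>j. j \<in> F \<Longrightarrow> \<zeta> j \<in> ell2"
  shows "(\<lambda>x. \<Sum>j\<in>F. \<zeta> j x) \<in> ell2 \<and> ell2_norm (\<lambda>x. \<Sum>j\<in>F. \<zeta> j x) \<le> (\<Sum>j\<in>F. ell2_norm (\<zeta> j))"
  using assms
proof (induction F rule: finite_induct)
  case (insert j F)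
  then show ?case using ell2_add[of "\<zeta> j" "\<lambda>x. \<Sum>j\<in>F. \<zeta> j x"] by force
qed simp

lemma ell2_sum_mem: "\<lbrakk>finite F; \<And>j. j \<in> F \<Longrightarrow> \<zeta> j \<in> ell2\<rbrakk> \<Longrightarrow> (\<lambda>x. \<Sum>j\<in>F. \<zeta> j x) \<in> ell2"
  using ell2_sum by blast

lemma ell2_inner_bound:
  assumes "\<xi> \<in> ell2" "\<eta> \<in> ell2"
  shows "(\<lambda>i. cnj (\<xi> i) * \<eta> i) summable_on UNIV" "cmod (ell2_inner \<xi> \<eta>) \<le> ell2_norm \<xi> * ell2_norm \<eta>"
proof -
  have fin: "(\<Sum>i\<in>F. cmod (cnj (\<xi> i) * \<eta> i)) \<le> ell2_norm \<xi> * ell2_norm \<eta>" if "finite F" for F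
  proof -
    have "(\<Sum>i\<in>F. cmod (cnj (\<xi> i) * \<eta> i)) \<le> L2_set (\<lambda>i. cmod (\<xi> i)) F * L2_set (\<lambda>i. cmod (\<eta> i)) F"
      using L2_set_mult_ineq[of "\<lambda>i. cmod (\<xi> i)" "\<lambda>i. cmod (\<eta> i)" F] by (simp add: norm_mult)
    also have "\<dots> \<le> ell2_norm \<xi> * ell2_norm \<eta>"
      using assms that by (intro mult_mono L2_set_le_ell2_norm ell2_norm_nonneg L2_set_nonneg)
    finally show ?thesis .
  qed
  have abs: "(\<lambda>i. cmod (cnj (\<xi> i) * \<eta> i)) summable_on UNIV"
    by (rule nonneg_bdd_above_summable_on) (use fin in \<open>auto intro!: bdd_aboveI[of _ "ell2_norm \<xi> * ell2_norm \<eta>"]\<close>)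
  then show "(\<lambda>i. cnj (\<xi> i) * \<eta> i) summable_on UNIV" by (rule abs_summable_summable)
  have "cmod (ell2_inner \<xi> \<eta>) \<le> (\<Sum>\<^sub>\<infinity>i. cmod (cnj (\<xi> i) * \<eta> i))"
    unfolding ell2_inner_def by (rule norm_infsum_bound[OF abs])
  also have "\<dots> \<le> ell2_norm \<xi> * ell2_norm \<eta>"
    by (rule infsum_le_finite_sums[OF abs]) (use fin in auto)
  finally show "cmod (ell2_inner \<xi> \<eta>) \<le> ell2_norm \<xi> * ell2_norm \<eta>" .
qed

lemma ell2_inner_self: assumes "\<xi> \<in> ell2" shows "ell2_inner \<xi> \<xi> = of_real ((ell2_norm \<xi>)\<^sup>2)"
proof -
  have "cnj z * z = of_real ((cmod z)\<^sup>2)" for z by (metis complex_norm_square mult.commute)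
  then have "ell2_inner \<xi> \<xi> = (\<Sum>\<^sub>\<infinity>i. of_real ((cmod (\<xi> i))\<^sup>2))" by (simp add: ell2_inner_def)
  also have "\<dots> = of_real (\<Sum>\<^sub>\<infinity>i. (cmod (\<xi> i))\<^sup>2)"
    using assms unfolding ell2_def
    by (intro infsumI has_sum_bounded_linear[OF bounded_linear_of_real] has_sum_infsum) simp
  finally show ?thesis by (simp add: ell2_norm_def infsum_nonneg)
qed

lemma ell2_inner_sum_right:
  assumes "finite F" "\<eta> \<in> ell2" "\<And>j. j \<in> F \<Longrightarrow> \<zeta> j \<in> ell2"
  shows "ell2_inner \<eta> (\<lambda>x. \<Sum>j\<in>F. \<zeta> j x) = (\<Sum>j\<in>F. ell2_inner \<eta> (\<zeta> j))"
  using assms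
proof (induction F rule: finite_induct)
  case (insert j F)
  then show ?case
    using infsum_add[OF ell2_inner_bound(1)[of \<eta> "\<zeta> j"] ell2_inner_bound(1)[of \<eta> "\<lambda>x. \<Sum>j\<in>F. \<zeta> j x"]]
      ell2_sum_mem[of F \<zeta>]
    by (simp add: ell2_inner_def distrib_left)
qed (simp add: ell2_inner_def)

lemma ell2_inner_sum_left:
  assumes "finite F" "\<eta> \<in> ell2" "\<And>j. j \<in> F \<Longrightarrow> \<zeta> j \<in> ell2"
  shows "ell2_inner (\<lambda>x. \<Sum>j\<in>F. \<zeta> j x) \<eta> = (\<Sum>j\<in>F. ell2_inner (\<zeta> j) \<eta>)"
  using assms
proof (induction F rule: finite_induct)
  case (insert j F)
  then show ?case
    using infsum_add[OF ell2_inner_bound(1)[of "\<zeta> j" \<eta>] ell2_inner_bound(1)[of "\<lambda>x. \<Sum>j\<in>F. \<zeta> j x" \<eta>]]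
      ell2_sum_mem[of F \<zeta>]
    by (simp add: ell2_inner_def distrib_right)
qed (simp add: ell2_inner_def)

section \<open>Bounded operators and their norms\<close>

context
  fixes S :: "('h \<Rightarrow> complex) \<Rightarrow> 'h \<Rightarrow> complex"
  assumes S: "bounded_op S"
begin

lemma bounded_op_mem: "\<xi> \<in> ell2 \<Longrightarrow> S \<xi> \<in> ell2"
  using S by (auto simp: bounded_op_def)

lemma bounded_op_add: "\<lbrakk>\<xi> \<in> ell2; \<eta> \<in> ell2\<rbrakk> \<Longrightarrow> S (\<lambda>i. \<xi> i + \<eta> i) = (\<lambda>i. S \<xi> i + S \<eta> i)"
  using S by (auto simp: bounded_op_def)

lemma bounded_op_scale: "\<xi> \<in> ell2 \<Longrightarrow> S (\<lambda>i. c * \<xi> i) = (\<lambda>i. c * S \<xi> i)"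
  using S by (auto simp: bounded_op_def)

lemma bounded_op_zero: "S (\<lambda>i. 0) = (\<lambda>i. 0)"
  using bounded_op_scale[of "\<lambda>i. 0" 0] by simp

lemma bounded_op_sum:
  assumes "finite F" "\<And>j. j \<in> F \<Longrightarrow> \<zeta> j \<in> ell2"
  shows "S (\<lambda>x. \<Sum>j\<in>F. \<zeta> j x) = (\<lambda>x. \<Sum>j\<in>F. S (\<zeta> j) x)"
  using assms
proof (induction F rule: finite_induct)
  case (insert j F)
  then show ?case using bounded_op_add[of "\<zeta> j" "\<lambda>x. \<Sum>j\<in>F. \<zeta> j x"] ell2_sum_mem[of F \<zeta>] by simp
qed (simp add: bounded_op_zero)

lemma op_norm_bdd: "bdd_above ((\<lambda>\<xi>. ell2_norm (S \<xi>)) ` {\<xi>\<in>ell2. ell2_norm \<xi> \<le> 1})"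
proof -
  obtain K where K: "\<And>\<xi>. \<xi> \<in> ell2 \<Longrightarrow> ell2_norm (S \<xi>) \<le> K * ell2_norm \<xi>"
    using S unfolding bounded_op_def by blast
  have "ell2_norm (S \<xi>) \<le> \<bar>K\<bar>" if "\<xi> \<in> ell2" "ell2_norm \<xi> \<le> 1" for \<xi>
  proof -
    have "K * ell2_norm \<xi> \<le> \<bar>K\<bar> * 1" using that(2) ell2_norm_nonneg[of \<xi>] by (intro mult_mono) auto
    then show ?thesis using K[OF that(1)] by simp
  qed
  then show ?thesis by (auto intro!: bdd_aboveI[of _ "\<bar>K\<bar>"])
qed

lemma op_norm_nonneg: "0 \<le> op_norm S"
  unfolding op_norm_def using cSUP_upper2[OF op_norm_bdd, of "\<lambda>i. 0" 0] by (simp add: ell2_norm_nonneg)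

lemma op_norm_bound: assumes "\<xi> \<in> ell2" shows "ell2_norm (S \<xi>) \<le> op_norm S * ell2_norm \<xi>"
proof (cases "ell2_norm \<xi> = 0")
  case True
  then show ?thesis using ell2_norm_eq_0[OF assms] by (simp add: bounded_op_zero)
next
  case False
  then have pos: "0 < ell2_norm \<xi>" using ell2_norm_nonneg[of \<xi>] by simp
  define c :: complex where "c = of_real (1 / ell2_norm \<xi>)"
  have c: "cmod c = 1 / ell2_norm \<xi>" using pos by (simp add: c_def norm_divide)
  have "ell2_norm (S (\<lambda>i. c * \<xi> i)) \<le> op_norm S" unfolding op_norm_def
    by (rule cSUP_upper[OF _ op_norm_bdd]) (use assms pos in \<open>simp add: ell2_scale c\<close>)
  then show ?thesis using pos assms
    by (simp add: bounded_op_scale ell2_scale bounded_op_mem c field_simps)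
qed

end

lemma op_norm_le:
  assumes "0 \<le> K" "\<And>\<xi>. \<xi> \<in> ell2 \<Longrightarrow> ell2_norm (S \<xi>) \<le> K * ell2_norm \<xi>"
  shows "op_norm S \<le> K"
  unfolding op_norm_def
proof (rule cSUP_least)
  show "{\<xi> \<in> ell2. ell2_norm \<xi> \<le> 1} \<noteq> {}" by (auto intro!: exI[of _ "\<lambda>i. 0"])
  show "ell2_norm (S \<xi>) \<le> K" if "\<xi> \<in> {\<xi> \<in> ell2. ell2_norm \<xi> \<le> 1}" for \<xi>
    using assms(2)[of \<xi>] mult_left_mono[of "ell2_norm \<xi>" 1 K] assms(1) that by simp
qed

section \<open>Faithful representations are isometric\<close>

locale cstar_rep = cstar_algebra A for A :: "'a cstar" (structure) +
  fixes \<pi> :: "'a \<Rightarrow> ('h \<Rightarrow> complex) \<Rightarrow> 'h \<Rightarrow> complex"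
  assumes faithful: "faithful_rep A \<pi>"
begin

lemma rep_bounded: "a \<in> carrier A \<Longrightarrow> bounded_op (\<pi> a)"
  using faithful by (simp add: faithful_rep_def)

lemma rep_mem: "\<lbrakk>a \<in> carrier A; \<xi> \<in> ell2\<rbrakk> \<Longrightarrow> \<pi> a \<xi> \<in> ell2"
  using rep_bounded bounded_op_mem by blast

lemma rep_add: "\<lbrakk>a \<in> carrier A; b \<in> carrier A; \<xi> \<in> ell2\<rbrakk> \<Longrightarrow> \<pi> (a \<oplus> b) \<xi> = (\<lambda>i. \<pi> a \<xi> i + \<pi> b \<xi> i)"
  using faithful by (simp add: faithful_rep_def)

lemma rep_mult: "\<lbrakk>a \<in> carrier A; b \<in> carrier A; \<xi> \<in> ell2\<rbrakk> \<Longrightarrow> \<pi> (a \<otimes> b) \<xi> = \<pi> a (\<pi> b \<xi>)"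
  using faithful by (simp add: faithful_rep_def)

lemma rep_smult: "\<lbrakk>a \<in> carrier A; \<xi> \<in> ell2\<rbrakk> \<Longrightarrow> \<pi> (c \<odot> a) \<xi> = (\<lambda>i. c * \<pi> a \<xi> i)"
  using faithful by (simp add: faithful_rep_def)

lemma rep_star: "\<lbrakk>a \<in> carrier A; \<xi> \<in> ell2; \<eta> \<in> ell2\<rbrakk> \<Longrightarrow> ell2_inner (\<pi> (star A a) \<xi>) \<eta> = ell2_inner \<xi> (\<pi> a \<eta>)"
  using faithful by (simp add: faithful_rep_def)

lemma rep_inj: "\<lbrakk>a \<in> carrier A; b \<in> carrier A; \<And>\<xi>. \<xi> \<in> ell2 \<Longrightarrow> \<pi> a \<xi> = \<pi> b \<xi>\<rbrakk> \<Longrightarrow> a = b"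
  using faithful by (simp add: faithful_rep_def)

lemma rep_zero: "\<xi> \<in> ell2 \<Longrightarrow> \<pi> \<zero> \<xi> = (\<lambda>i. 0)"
  using rep_smult[of \<zero> \<xi> 0] by (simp add: smult_zero_right)

lemma rep_finsum:
  assumes "finite F" "\<And>k. k \<in> F \<Longrightarrow> f k \<in> carrier A" "\<xi> \<in> ell2"
  shows "\<pi> (finsum A f F) \<xi> = (\<lambda>i. \<Sum>k\<in>F. \<pi> (f k) \<xi> i)"
  using assms
proof (induction F rule: finite_induct)
  case (insert k F)
  then have "finsum A f (insert k F) = f k \<oplus> finsum A f F" "finsum A f F \<in> carrier A"
    by (auto intro!: finsum_insert finsum_closed)
  then show ?case using insert by (simp add: rep_add)
qed (simp add: rep_zero)

text \<open>Moving the adjoint across the inner product writes the squared norm of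
  \<open>\<pi> x \<xi>\<close> as the inner product of
  \<open>\<pi> (star A x \<otimes> x) \<xi>\<close> with \<open>\<xi>\<close>; Cauchy-Schwarz then
  yields the required half of the C*-identity.\<close>

lemma rep_cstar_seminorm: "cstar_seminorm A (\<lambda>a. op_norm (\<pi> a))"
proof (unfold_locales)
  note bound = op_norm_bound[OF rep_bounded] and nonneg = op_norm_nonneg[OF rep_bounded]
  fix x y assume x: "x \<in> carrier A"
  show "0 \<le> op_norm (\<pi> x)" using nonneg x .
  show "op_norm (\<pi> (c \<odot> x)) = cmod c * op_norm (\<pi> x)" for c
  proof (rule antisym)
    have le: "op_norm (\<pi> (c \<odot> x)) \<le> cmod c * op_norm (\<pi> x)" if "x \<in> carrier A" for c x
      by (rule op_norm_le)
        (use that in \<open>simp_all add: nonneg rep_smult ell2_scale rep_mem bound mult.assoc mult_left_mono\<close>)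
    show "op_norm (\<pi> (c \<odot> x)) \<le> cmod c * op_norm (\<pi> x)" using le x .
    show "cmod c * op_norm (\<pi> x) \<le> op_norm (\<pi> (c \<odot> x))"
    proof (cases "c = 0")
      case False
      have "op_norm (\<pi> x) \<le> cmod (1 / c) * op_norm (\<pi> (c \<odot> x))"
        using le[of "c \<odot> x" "1 / c"] x False by (simp add: closed smult_smult[symmetric] smult_one)
      then show ?thesis using False by (simp add: norm_divide field_simps)
    qed (use nonneg x in \<open>simp add: closed\<close>)
  qed
  show "(op_norm (\<pi> x))\<^sup>2 \<le> op_norm (\<pi> (star A x \<otimes> x))"
  proof -
    let ?n = "op_norm (\<pi> (star A x \<otimes> x))"
    have n: "0 \<le> ?n" using nonneg x by (simp add: closed)
    have "op_norm (\<pi> x) \<le> sqrt ?n"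
    proof (rule op_norm_le)
      fix \<xi> :: "'h \<Rightarrow> complex" assume xi: "\<xi> \<in> ell2"
      have "of_real ((ell2_norm (\<pi> x \<xi>))\<^sup>2) = ell2_inner (\<pi> x \<xi>) (\<pi> x \<xi>)" using x xi by (simp add: ell2_inner_self rep_mem)
      also have "\<dots> = ell2_inner (\<pi> (star A x \<otimes> x) \<xi>) \<xi>" using x xi by (simp add: rep_star rep_mem rep_mult closed)
      finally have "(ell2_norm (\<pi> x \<xi>))\<^sup>2 = cmod (ell2_inner (\<pi> (star A x \<otimes> x) \<xi>) \<xi>)"
        by (metis norm_of_real abs_power2)
      also have "\<dots> \<le> ell2_norm (\<pi> (star A x \<otimes> x) \<xi>) * ell2_norm \<xi>"
        using x xi by (intro ell2_inner_bound rep_mem) (simp_all add: closed)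
      also have "\<dots> \<le> ?n * ell2_norm \<xi> * ell2_norm \<xi>"
        using x xi by (intro mult_right_mono bound ell2_norm_nonneg) (simp_all add: closed)
      also have "\<dots> = (sqrt ?n * ell2_norm \<xi>)\<^sup>2" using n by (simp add: power_mult_distrib power2_eq_square)
      finally show "ell2_norm (\<pi> x \<xi>) \<le> sqrt ?n * ell2_norm \<xi>"
        by (rule power2_le_imp_le) (simp add: n ell2_norm_nonneg)
    qed (use n in simp)
    then have "(op_norm (\<pi> x))\<^sup>2 \<le> (sqrt ?n)\<^sup>2" using nonneg[OF x] by (intro power_mono)
    then show ?thesis using n by simp
  qed
  assume y: "y \<in> carrier A"
  show "op_norm (\<pi> (x \<oplus> y)) \<le> op_norm (\<pi> x) + op_norm (\<pi> y)"
  proof (rule op_norm_le)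
    fix \<xi> :: "'h \<Rightarrow> complex" assume xi: "\<xi> \<in> ell2"
    have "ell2_norm (\<pi> (x \<oplus> y) \<xi>) \<le> ell2_norm (\<pi> x \<xi>) + ell2_norm (\<pi> y \<xi>)"
      using x y xi by (simp add: rep_add ell2_add rep_mem)
    then show "ell2_norm (\<pi> (x \<oplus> y) \<xi>) \<le> (op_norm (\<pi> x) + op_norm (\<pi> y)) * ell2_norm \<xi>"
      using bound[OF x xi] bound[OF y xi] by (simp add: algebra_simps)
  qed (use nonneg x y in simp)
  show "op_norm (\<pi> (x \<otimes> y)) \<le> op_norm (\<pi> x) * op_norm (\<pi> y)"
  proof (rule op_norm_le)
    fix \<xi> :: "'h \<Rightarrow> complex" assume xi: "\<xi> \<in> ell2"
    have "ell2_norm (\<pi> x (\<pi> y \<xi>)) \<le> op_norm (\<pi> x) * ell2_norm (\<pi> y \<xi>)"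
      using x y xi by (simp add: bound rep_mem)
    also have "\<dots> \<le> op_norm (\<pi> x) * (op_norm (\<pi> y) * ell2_norm \<xi>)"
      using nonneg[OF x] bound[OF y xi] by (rule mult_left_mono[rotated])
    finally show "ell2_norm (\<pi> (x \<otimes> y) \<xi>) \<le> op_norm (\<pi> x) * op_norm (\<pi> y) * ell2_norm \<xi>"
      using x y xi by (simp add: rep_mult mult.assoc)
  qed (use nonneg x y in simp)
qed

text \<open>Faithfulness makes the operator seminorm definite, so uniqueness of the C*-norm
  applies.\<close>

lemma op_norm_rep: assumes "a \<in> carrier A" shows "op_norm (\<pi> a) = nrm A a"
proof (rule cstar_seminorm.Q_eq_nrm[OF rep_cstar_seminorm])
  show "x = \<zero>" if x: "x \<in> carrier A" "op_norm (\<pi> x) = 0" for x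
  proof (rule rep_inj)
    fix \<xi> :: "'h \<Rightarrow> complex" assume xi: "\<xi> \<in> ell2"
    have "ell2_norm (\<pi> x \<xi>) = 0"
      using op_norm_bound[OF rep_bounded[OF x(1)] xi] x(2) ell2_norm_nonneg[of "\<pi> x \<xi>"] by simp
    then show "\<pi> x \<xi> = \<pi> \<zero> \<xi>" using ell2_norm_eq_0[OF rep_mem[OF x(1) xi]] rep_zero xi by simp
  qed (use x in simp_all)
qed fact

lemma rep_bound: "\<lbrakk>a \<in> carrier A; \<xi> \<in> ell2\<rbrakk> \<Longrightarrow> ell2_norm (\<pi> a \<xi>) \<le> nrm A a * ell2_norm \<xi>"
  using op_norm_bound[OF rep_bounded, of a \<xi>] op_norm_rep[of a] by simp

end

section \<open>Matrices over a C*-algebra\<close>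

definition vec_norm :: "'y set \<Rightarrow> ('y \<Rightarrow> 'h \<Rightarrow> complex) \<Rightarrow> real" where
  "vec_norm F \<zeta> = L2_set (\<lambda>j. ell2_norm (\<zeta> j)) F"

definition mat_op ::
    "('a \<Rightarrow> ('h \<Rightarrow> complex) \<Rightarrow> 'h \<Rightarrow> complex) \<Rightarrow> 'y set \<Rightarrow> ('y \<Rightarrow> 'y \<Rightarrow> 'a) \<Rightarrow> ('y \<Rightarrow> 'h \<Rightarrow> complex)
      \<Rightarrow> 'y \<Rightarrow> 'h \<Rightarrow> complex" where
  "mat_op \<pi> F M \<zeta> i = (\<lambda>x. \<Sum>j\<in>F. \<pi> (M i j) (\<zeta> j) x)"

text \<open>Matrices over \<open>A\<close> are not made into a C*-algebra of their own. Upper bounds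
  for their action on the direct sum of copies of the Hilbert space indexed by \<open>F\<close> are
  tracked instead, one representation at a time.\<close>

definition mat_bound ::
    "('a \<Rightarrow> ('h \<Rightarrow> complex) \<Rightarrow> 'h \<Rightarrow> complex) \<Rightarrow> 'y set \<Rightarrow> ('y \<Rightarrow> 'y \<Rightarrow> 'a) \<Rightarrow> real \<Rightarrow> bool" where
  "mat_bound \<pi> F M K \<longleftrightarrow> 0 \<le> K \<and> (\<forall>\<zeta>. (\<forall>j. \<zeta> j \<in> ell2) \<longrightarrow> vec_norm F (mat_op \<pi> F M \<zeta>) \<le> K * vec_norm F \<zeta>)"

definition mat_star :: "'a cstar \<Rightarrow> ('y \<Rightarrow> 'y \<Rightarrow> 'a) \<Rightarrow> 'y \<Rightarrow> 'y \<Rightarrow> 'a" where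
  "mat_star A M i j = star A (M j i)"

definition mat_mult :: "'a cstar \<Rightarrow> 'y set \<Rightarrow> ('y \<Rightarrow> 'y \<Rightarrow> 'a) \<Rightarrow> ('y \<Rightarrow> 'y \<Rightarrow> 'a) \<Rightarrow> 'y \<Rightarrow> 'y \<Rightarrow> 'a" where
  "mat_mult A F M M' i j = (\<Oplus>\<^bsub>A\<^esub>k\<in>F. M i k \<otimes>\<^bsub>A\<^esub> M' k j)"

context cstar_algebra
begin

lemma star_finsum:
  assumes "finite F" "\<And>k. k \<in> F \<Longrightarrow> f k \<in> carrier A"
  shows "star A (finsum A f F) = (\<Oplus>k\<in>F. star A (f k))"
  using assms
proof (induction F rule: finite_induct)
  case (insert k F)
  then have "finsum A f (insert k F) = f k \<oplus> finsum A f F" "finsum A f F \<in> carrier A"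
    "(\<Oplus>k\<in>insert k F. star A (f k)) = star A (f k) \<oplus> (\<Oplus>k\<in>F. star A (f k))"
    by (auto intro!: finsum_insert finsum_closed closed)
  then show ?case using insert by (simp add: star_add)
qed (simp add: star_zero)

lemma mat_closed:
  assumes "\<And>i j. M i j \<in> carrier A"
  shows "mat_star A M i j \<in> carrier A" "(\<And>i j. M' i j \<in> carrier A) \<Longrightarrow> mat_mult A F M M' i j \<in> carrier A"
  using assms by (auto simp: mat_star_def mat_mult_def intro!: finsum_closed closed)

lemma mat_star_mult:
  assumes F: "finite F" and M: "\<And>i j. M i j \<in> carrier A" and M': "\<And>i j. M' i j \<in> carrier A"
  shows "mat_star A (mat_mult A F M M') = mat_mult A F (mat_star A M') (mat_star A M)"
  using M M' by (auto simp: mat_star_def mat_mult_def fun_eq_iff star_finsum[OF F] star_mult closed intro!: finsum_cong)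

lemma mat_star_star: "(\<And>i j. M i j \<in> carrier A) \<Longrightarrow> mat_star A (mat_star A M) = M"
  by (auto simp: mat_star_def fun_eq_iff star_star)

end

lemma sum_mult_le_vec_norm:
  "(\<Sum>j\<in>F. ell2_norm (\<eta> j) * ell2_norm (\<zeta> j)) \<le> vec_norm F \<eta> * vec_norm F \<zeta>"
  using L2_set_mult_ineq[of "\<lambda>j. ell2_norm (\<eta> j)" "\<lambda>j. ell2_norm (\<zeta> j)" F]
  by (simp add: vec_norm_def abs_of_nonneg[OF ell2_norm_nonneg])

lemma vec_norm_nonneg: "0 \<le> vec_norm F \<zeta>"
  by (simp add: vec_norm_def L2_set_nonneg)

lemma vec_norm_square: "(vec_norm F \<zeta>)\<^sup>2 = (\<Sum>j\<in>F. (ell2_norm (\<zeta> j))\<^sup>2)"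
  by (simp add: vec_norm_def L2_set_def sum_nonneg)

context cstar_rep
begin

lemma mat_op_mem:
  assumes "finite F" "\<And>i j. M i j \<in> carrier A" "\<And>j. \<zeta> j \<in> ell2"
  shows "mat_op \<pi> F M \<zeta> i \<in> ell2"
  unfolding mat_op_def using assms by (intro ell2_sum_mem rep_mem)

lemma mat_op_mult:
  assumes F: "finite F" and M: "\<And>i j. M i j \<in> carrier A" and M': "\<And>i j. M' i j \<in> carrier A"
    and \<zeta>: "\<And>j. \<zeta> j \<in> ell2"
  shows "mat_op \<pi> F (mat_mult A F M M') \<zeta> = mat_op \<pi> F M (mat_op \<pi> F M' \<zeta>)"
proof (rule ext, rule ext)
  fix i x
  have "mat_op \<pi> F (mat_mult A F M M') \<zeta> i x = (\<Sum>j\<in>F. \<Sum>k\<in>F. \<pi> (M i k) (\<pi> (M' k j) (\<zeta> j)) x)"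
    unfolding mat_op_def mat_mult_def using F M M' \<zeta> by (simp add: rep_finsum rep_mult closed)
  also have "\<dots> = (\<Sum>k\<in>F. \<Sum>j\<in>F. \<pi> (M i k) (\<pi> (M' k j) (\<zeta> j)) x)" by (rule sum.swap)
  also have "\<dots> = mat_op \<pi> F M (mat_op \<pi> F M' \<zeta>) i x"
    unfolding mat_op_def using F M M' \<zeta> by (simp add: bounded_op_sum[OF rep_bounded] rep_mem)
  finally show "mat_op \<pi> F (mat_mult A F M M') \<zeta> i x = mat_op \<pi> F M (mat_op \<pi> F M' \<zeta>) i x" .
qed

lemma mat_op_star:
  assumes F: "finite F" and M: "\<And>i j. M i j \<in> carrier A"
    and \<zeta>: "\<And>j. \<zeta> j \<in> ell2" and \<eta>: "\<And>j. \<eta> j \<in> ell2"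
  shows "(\<Sum>i\<in>F. ell2_inner (\<eta> i) (mat_op \<pi> F M \<zeta> i)) = (\<Sum>j\<in>F. ell2_inner (mat_op \<pi> F (mat_star A M) \<eta> j) (\<zeta> j))"
proof -
  have "(\<Sum>i\<in>F. ell2_inner (\<eta> i) (mat_op \<pi> F M \<zeta> i)) = (\<Sum>i\<in>F. \<Sum>j\<in>F. ell2_inner (\<eta> i) (\<pi> (M i j) (\<zeta> j)))"
    unfolding mat_op_def using F M \<zeta> \<eta> by (simp add: ell2_inner_sum_right rep_mem)
  also have "\<dots> = (\<Sum>j\<in>F. \<Sum>i\<in>F. ell2_inner (\<pi> (star A (M i j)) (\<eta> i)) (\<zeta> j))"
    using M \<zeta> \<eta> by (subst sum.swap) (simp add: rep_star)
  also have "\<dots> = (\<Sum>j\<in>F. ell2_inner (mat_op \<pi> F (mat_star A M) \<eta> j) (\<zeta> j))"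
    unfolding mat_op_def mat_star_def using F M \<zeta> \<eta> by (simp add: ell2_inner_sum_left rep_mem closed)
  finally show ?thesis .
qed

text \<open>The C*-identity at the level of a single vector: the left side is the inner product of
  the image under the adjoint times \<open>M\<close> with the vector itself, and Cauchy-Schwarz
  finishes.\<close>

lemma vec_norm_mat_op_square:
  assumes F: "finite F" and M: "\<And>i j. M i j \<in> carrier A" and \<zeta>: "\<And>j. \<zeta> j \<in> ell2"
  shows "(vec_norm F (mat_op \<pi> F M \<zeta>))\<^sup>2
    \<le> vec_norm F (mat_op \<pi> F (mat_mult A F (mat_star A M) M) \<zeta>) * vec_norm F \<zeta>"
proof -
  note mem = mat_op_mem[OF F M \<zeta>]
  have "complex_of_real ((vec_norm F (mat_op \<pi> F M \<zeta>))\<^sup>2) = (\<Sum>i\<in>F. ell2_inner (mat_op \<pi> F M \<zeta> i) (mat_op \<pi> F M \<zeta> i))"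
    using mem by (simp add: vec_norm_square ell2_inner_self)
  also have "\<dots> = (\<Sum>j\<in>F. ell2_inner (mat_op \<pi> F (mat_star A M) (mat_op \<pi> F M \<zeta>) j) (\<zeta> j))"
    by (rule mat_op_star[OF F M \<zeta> mem])
  also have "mat_op \<pi> F (mat_star A M) (mat_op \<pi> F M \<zeta>) = mat_op \<pi> F (mat_mult A F (mat_star A M) M) \<zeta>"
    by (rule mat_op_mult[symmetric, OF F mat_closed(1)[OF M] M \<zeta>])
  finally have "(vec_norm F (mat_op \<pi> F M \<zeta>))\<^sup>2
      = cmod (\<Sum>j\<in>F. ell2_inner (mat_op \<pi> F (mat_mult A F (mat_star A M) M) \<zeta> j) (\<zeta> j))"
    by (metis abs_power2 norm_of_real)
  also have "\<dots> \<le> (\<Sum>j\<in>F. ell2_norm (mat_op \<pi> F (mat_mult A F (mat_star A M) M) \<zeta> j) * ell2_norm (\<zeta> j))"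
    using F M \<zeta> by (intro sum_norm_le ell2_inner_bound mat_op_mem mat_closed)
  also have "\<dots> \<le> vec_norm F (mat_op \<pi> F (mat_mult A F (mat_star A M) M) \<zeta>) * vec_norm F \<zeta>"
    by (rule sum_mult_le_vec_norm)
  finally show ?thesis .
qed

lemma mat_bound_mult:
  assumes "finite F" "\<And>i j. M i j \<in> carrier A" "\<And>i j. M' i j \<in> carrier A"
    and K: "mat_bound \<pi> F M K" and K': "mat_bound \<pi> F M' K'"
  shows "mat_bound \<pi> F (mat_mult A F M M') (K * K')"
  unfolding mat_bound_def
proof (intro conjI allI impI)
  show "0 \<le> K * K'" using K K' by (simp add: mat_bound_def)
  fix \<zeta> :: "'b \<Rightarrow> 'h \<Rightarrow> complex" assume \<zeta>: "\<forall>j. \<zeta> j \<in> ell2"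
  then have "vec_norm F (mat_op \<pi> F (mat_mult A F M M') \<zeta>) \<le> K * vec_norm F (mat_op \<pi> F M' \<zeta>)"
    using assms mat_op_mem[of F M' \<zeta>] by (simp add: mat_op_mult mat_bound_def)
  also have "\<dots> \<le> K * (K' * vec_norm F \<zeta>)"
    using K K' \<zeta> by (intro mult_left_mono) (simp_all add: mat_bound_def)
  finally show "vec_norm F (mat_op \<pi> F (mat_mult A F M M') \<zeta>) \<le> K * K' * vec_norm F \<zeta>" by (simp add: mult.assoc)
qed

lemma mat_bound_sqrt:
  assumes "finite F" "\<And>i j. M i j \<in> carrier A" and K: "mat_bound \<pi> F (mat_mult A F (mat_star A M) M) K"
  shows "mat_bound \<pi> F M (sqrt K)"
  unfolding mat_bound_def
proof (intro conjI allI impI)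
  show K0: "0 \<le> sqrt K" using K by (simp add: mat_bound_def)
  fix \<zeta> :: "'b \<Rightarrow> 'h \<Rightarrow> complex" assume \<zeta>: "\<forall>j. \<zeta> j \<in> ell2"
  then have "vec_norm F (mat_op \<pi> F (mat_mult A F (mat_star A M) M) \<zeta>) \<le> K * vec_norm F \<zeta>"
    using K by (simp add: mat_bound_def)
  then have "vec_norm F (mat_op \<pi> F (mat_mult A F (mat_star A M) M) \<zeta>) * vec_norm F \<zeta> \<le> K * vec_norm F \<zeta> * vec_norm F \<zeta>"
    by (rule mult_right_mono) (rule vec_norm_nonneg)
  moreover have "(vec_norm F (mat_op \<pi> F M \<zeta>))\<^sup>2
      \<le> vec_norm F (mat_op \<pi> F (mat_mult A F (mat_star A M) M) \<zeta>) * vec_norm F \<zeta>"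
    using \<zeta> by (intro vec_norm_mat_op_square[OF assms(1,2)]) simp
  ultimately have "(vec_norm F (mat_op \<pi> F M \<zeta>))\<^sup>2 \<le> K * vec_norm F \<zeta> * vec_norm F \<zeta>" by simp
  also have "\<dots> = (sqrt K * vec_norm F \<zeta>)\<^sup>2" using K0 by (simp add: power_mult_distrib power2_eq_square[of "vec_norm F \<zeta>"])
  finally show "vec_norm F (mat_op \<pi> F M \<zeta>) \<le> sqrt K * vec_norm F \<zeta>"
    by (rule power2_le_imp_le) (intro mult_nonneg_nonneg K0 vec_norm_nonneg)
qed

text \<open>The vector form of the C*-identity, applied to the adjoint, bounds the squared norm n^2
  of the image by K n times the norm of the vector; one factor n cancels.\<close>

lemma mat_bound_star:
  assumes F: "finite F" and M: "\<And>i j. M i j \<in> carrier A" and K: "mat_bound \<pi> F M K"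
  shows "mat_bound \<pi> F (mat_star A M) K"
  unfolding mat_bound_def
proof (intro conjI allI impI)
  show K0: "0 \<le> K" using K by (simp add: mat_bound_def)
  fix \<zeta> :: "'b \<Rightarrow> 'h \<Rightarrow> complex" assume \<zeta>: "\<forall>j. \<zeta> j \<in> ell2"
  let ?n = "vec_norm F (mat_op \<pi> F (mat_star A M) \<zeta>)"
  have mem: "\<forall>j. mat_op \<pi> F (mat_star A M) \<zeta> j \<in> ell2" using \<zeta> M F by (intro allI mat_op_mem mat_closed) auto
  have "?n\<^sup>2 \<le> vec_norm F (mat_op \<pi> F (mat_mult A F (mat_star A (mat_star A M)) (mat_star A M)) \<zeta>) * vec_norm F \<zeta>"
    using \<zeta> by (intro vec_norm_mat_op_square[OF F mat_closed(1)[OF M]]) simp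
  also have "mat_op \<pi> F (mat_mult A F (mat_star A (mat_star A M)) (mat_star A M)) \<zeta> = mat_op \<pi> F M (mat_op \<pi> F (mat_star A M) \<zeta>)"
    using \<zeta> M by (simp add: mat_star_star mat_op_mult F mat_closed)
  also have "vec_norm F (mat_op \<pi> F M (mat_op \<pi> F (mat_star A M) \<zeta>)) \<le> K * ?n"
    using K mem by (simp add: mat_bound_def)
  finally have le: "?n\<^sup>2 \<le> K * ?n * vec_norm F \<zeta>" by (simp add: mult_right_mono vec_norm_nonneg)
  show "?n \<le> K * vec_norm F \<zeta>"
  proof (cases "?n = 0")
    case True
    then show ?thesis using K0 vec_norm_nonneg[of F \<zeta>] by simp
  next
    case False
    then have "0 < ?n" using vec_norm_nonneg[of F] by (metis less_eq_real_def)
    moreover have "?n * ?n \<le> ?n * (K * vec_norm F \<zeta>)" using le by (simp add: power2_eq_square algebra_simps)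
    ultimately show ?thesis by (simp add: mult_le_cancel_left_pos)
  qed
qed

text \<open>A vector concentrated at \<open>j\<close> isolates the entry, and isometry of the
  representation turns the operator bound into a bound on \<open>nrm A\<close>. Entry norms thus
  form a bridge between two representations.\<close>

lemma mat_bound_entry:
  assumes F: "finite F" and M: "\<And>i j. M i j \<in> carrier A" and K: "mat_bound \<pi> F M K"
    and ij: "i \<in> F" "j \<in> F"
  shows "nrm A (M i j) \<le> K"
  unfolding op_norm_rep[OF M, symmetric]
proof (rule op_norm_le)
  show "0 \<le> K" using K by (simp add: mat_bound_def)
  fix \<xi> :: "'h \<Rightarrow> complex" assume \<xi>: "\<xi> \<in> ell2"
  define \<zeta> where "\<zeta> k = (if k = j then \<xi> else (\<lambda>x. 0))" for k
  have mem: "\<forall>k. \<zeta> k \<in> ell2" using \<xi> by (simp add: \<zeta>_def)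
  have "(\<lambda>x. \<pi> (M i k) (\<zeta> k) x) = (\<lambda>x. if k = j then \<pi> (M i j) \<xi> x else 0)" for k
    using bounded_op_zero[OF rep_bounded[OF M]] by (auto simp: \<zeta>_def)
  then have "mat_op \<pi> F M \<zeta> i = \<pi> (M i j) \<xi>" using F ij by (simp add: mat_op_def fun_eq_iff)
  then have "ell2_norm (\<pi> (M i j) \<xi>) \<le> vec_norm F (mat_op \<pi> F M \<zeta>)"
    unfolding vec_norm_def using member_le_L2_set[OF F ij(1), of "\<lambda>j. ell2_norm (mat_op \<pi> F M \<zeta> j)"] by simp
  also have "\<dots> \<le> K * vec_norm F \<zeta>" using K mem by (simp add: mat_bound_def)
  also have "(vec_norm F \<zeta>)\<^sup>2 = (\<Sum>k\<in>F. if k = j then (ell2_norm \<xi>)\<^sup>2 else 0)"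
    unfolding vec_norm_square by (intro sum.cong) (auto simp: \<zeta>_def)
  then have "vec_norm F \<zeta> = ell2_norm \<xi>"
    using F ij vec_norm_nonneg[of F \<zeta>] ell2_norm_nonneg[of \<xi>] by (simp add: power2_eq_iff_nonneg)
  finally show "ell2_norm (\<pi> (M i j) \<xi>) \<le> K * ell2_norm \<xi>" .
qed

text \<open>The factor is crude, but it depends only on the size of \<open>F\<close>, and taking
  roots removes it in \<open>mat_bound_indep\<close>.\<close>

lemma mat_bound_of_entries:
  assumes F: "finite F" and M: "\<And>i j. M i j \<in> carrier A" and K: "0 \<le> K"
    and le: "\<And>i j. \<lbrakk>i \<in> F; j \<in> F\<rbrakk> \<Longrightarrow> nrm A (M i j) \<le> K"
  shows "mat_bound \<pi> F M (real (card F) * real (card F) * K)"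
  unfolding mat_bound_def
proof (intro conjI allI impI)
  show "0 \<le> real (card F) * real (card F) * K" using K by simp
  fix \<zeta> :: "'b \<Rightarrow> 'h \<Rightarrow> complex" assume \<zeta>: "\<forall>j. \<zeta> j \<in> ell2"
  have "ell2_norm (mat_op \<pi> F M \<zeta> i) \<le> real (card F) * (K * vec_norm F \<zeta>)" if i: "i \<in> F" for i
  proof -
    have "ell2_norm (mat_op \<pi> F M \<zeta> i) \<le> (\<Sum>j\<in>F. ell2_norm (\<pi> (M i j) (\<zeta> j)))"
      unfolding mat_op_def using ell2_sum[OF F, of "\<lambda>j. \<pi> (M i j) (\<zeta> j)"] \<zeta> M by (simp add: rep_mem)
    also have "\<dots> \<le> (\<Sum>j\<in>F. K * vec_norm F \<zeta>)"
    proof (rule sum_mono)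
      fix j assume j: "j \<in> F"
      have "ell2_norm (\<zeta> j) \<le> vec_norm F \<zeta>"
        unfolding vec_norm_def using member_le_L2_set[OF F j, of "\<lambda>j. ell2_norm (\<zeta> j)"] by simp
      then show "ell2_norm (\<pi> (M i j) (\<zeta> j)) \<le> K * vec_norm F \<zeta>"
        using rep_bound[OF M, of "\<zeta> j" i j] \<zeta> le[OF i j] K
        by (meson mult_mono ell2_norm_nonneg order_trans)
    qed
    finally show ?thesis by simp
  qed
  then have "(\<Sum>i\<in>F. ell2_norm (mat_op \<pi> F M \<zeta> i)) \<le> (\<Sum>i\<in>F. real (card F) * (K * vec_norm F \<zeta>))"
    by (rule sum_mono)
  moreover have "vec_norm F (mat_op \<pi> F M \<zeta>) \<le> (\<Sum>i\<in>F. ell2_norm (mat_op \<pi> F M \<zeta> i))"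
    unfolding vec_norm_def by (rule L2_set_le_sum) (rule ell2_norm_nonneg)
  ultimately show "vec_norm F (mat_op \<pi> F M \<zeta>) \<le> real (card F) * real (card F) * K * vec_norm F \<zeta>"
    by (simp add: mult.assoc)
qed

end

text \<open>Both matrix norms satisfy the C*-identity and are equivalent to the maximum of the norms of the
  entries, so they agree up to a constant, which disappears in the roots of the powers \<open>(M\<^sup>* M)\<^bsup>2^n\<^esup>\<close>.\<close>

lemma mat_bound_indep:
  fixes M :: "'y \<Rightarrow> 'y \<Rightarrow> 'a" and \<pi>\<^sub>1 :: "'a \<Rightarrow> ('h \<Rightarrow> complex) \<Rightarrow> 'h \<Rightarrow> complex"
  assumes rep1: "cstar_rep A \<pi>\<^sub>1" and rep2: "cstar_rep A \<pi>\<^sub>2"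
    and F: "finite F" and M: "\<And>i j. M i j \<in> carrier A" and K: "mat_bound \<pi>\<^sub>2 F M K"
  shows "mat_bound \<pi>\<^sub>1 F M K"
proof -
  interpret r1: cstar_rep A \<pi>\<^sub>1 by fact
  interpret r2: cstar_rep A \<pi>\<^sub>2 by fact
  define c where "c = real (card F) * real (card F)"
  have c: "0 \<le> c" by (simp add: c_def)
  have K0: "0 \<le> K" using K by (simp add: mat_bound_def)
  \<comment> \<open>The way from \<open>\<pi>\<^sub>2\<close> over entry norms to
    \<open>\<pi>\<^sub>1\<close> costs the factor \<open>c\<close>, the same for every matrix
    indexed by \<open>F\<close>.\<close>
  have equiv: "mat_bound \<pi>\<^sub>1 F N (c * L)" if "\<And>i j. N i j \<in> carrier A" "mat_bound \<pi>\<^sub>2 F N L" for N L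
    unfolding c_def
    by (rule r1.mat_bound_of_entries[OF F that(1)])
      (use that r2.mat_bound_entry[OF F that] in \<open>auto simp: mat_bound_def\<close>)
  \<comment> \<open>\<open>P n\<close> is the power with exponent 2^n of the adjoint of
    \<open>M\<close> times \<open>M\<close>. Since it is self-adjoint, \<open>mat_bound_sqrt\<close>
    undoes one squaring at a time in \<open>descend\<close>.\<close>
  define P where "P n = rec_nat (mat_mult A F (mat_star A M) M) (\<lambda>_ N. mat_mult A F N N) n" for n :: nat
  have P0: "P 0 = mat_mult A F (mat_star A M) M" and PS: "\<And>n. P (Suc n) = mat_mult A F (P n) (P n)"
    by (simp_all add: P_def)
  have Pc: "P n i j \<in> carrier A" for n i j
    by (induction n arbitrary: i j) (simp_all add: P0 PS r1.mat_closed M)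
  have Pstar: "mat_star A (P n) = P n" for n
    by (induction n) (simp_all add: P0 PS r1.mat_star_mult[OF F] r1.mat_star_star r1.mat_closed M Pc)
  have bound2: "mat_bound \<pi>\<^sub>2 F (P n) ((K * K) ^ (2 ^ n))" for n
  proof (induction n)
    case 0
    show ?case using r2.mat_bound_mult[OF F _ _ r2.mat_bound_star[OF F M K] K] M by (simp add: P0 r1.mat_closed)
  next
    case (Suc n)
    then show ?case using r2.mat_bound_mult[OF F _ _ Suc Suc] Pc by (simp add: PS power_add[symmetric] mult_2[symmetric])
  qed
  have descend: "mat_bound \<pi>\<^sub>1 F (P 0) (root (2 ^ n) L)" if "mat_bound \<pi>\<^sub>1 F (P n) L" for n L
    using that
  proof (induction n arbitrary: L)
    case (Suc n)
    then have "mat_bound \<pi>\<^sub>1 F (mat_mult A F (mat_star A (P n)) (P n)) L" by (simp add: Pstar PS)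
    then have "mat_bound \<pi>\<^sub>1 F (P n) (sqrt L)" by (rule r1.mat_bound_sqrt[OF F Pc])
    then have "mat_bound \<pi>\<^sub>1 F (P 0) (root (2 ^ n) (root 2 L))" using Suc.IH by (simp add: sqrt_def)
    moreover have "root (2 ^ Suc n) L = root (2 ^ n) (root 2 L)"
      using real_root_mult_exp[of "2 ^ n" 2 L] by (simp add: mult.commute)
    ultimately show ?case by (simp only:)
  qed (simp add: real_root_one)
  \<comment> \<open>The root of order 2^n restores K^2 from its power exactly and leaves of the loss
    only a root of \<open>c\<close>, which tends to 1.\<close>
  have "mat_bound \<pi>\<^sub>1 F (P 0) (root (2 ^ n) c * (K * K))" for n
    using descend[OF equiv[OF Pc bound2], of n] K0 by (simp add: real_root_mult real_root_power_cancel)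
  have "mat_bound \<pi>\<^sub>1 F (P 0) (K * K)"
    unfolding mat_bound_def
  proof (intro conjI allI impI)
    fix \<zeta> :: "'y \<Rightarrow> 'h \<Rightarrow> complex" assume \<zeta>: "\<forall>j. \<zeta> j \<in> ell2"
    let ?l = "vec_norm F (mat_op \<pi>\<^sub>1 F (P 0) \<zeta>)"
    show "?l \<le> K * K * vec_norm F \<zeta>"
    \<comment> \<open>The roots of \<open>c\<close> tend to 1 only for positive \<open>c\<close>; c
      = 0 means that \<open>F\<close> is empty, and then both sides vanish.\<close>
    proof (cases "c = 0")
      case True
      then have "F = {}" using F by (simp add: c_def)
      then show ?thesis by (simp add: vec_norm_def)
    next
      case False
      then have "(\<lambda>n. root (2 ^ n) c) \<longlonglongrightarrow> 1"
        using c by (intro filterlim_compose[OF LIMSEQ_root_const filterlim_subseq]) (simp_all add: strict_mono_def)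
      then have "(\<lambda>n. root (2 ^ n) c * (K * K) * vec_norm F \<zeta>) \<longlonglongrightarrow> 1 * (K * K) * vec_norm F \<zeta>"
        by (intro tendsto_intros)
      moreover have "?l \<le> root (2 ^ n) c * (K * K) * vec_norm F \<zeta>" for n
        using \<open>\<And>n. mat_bound \<pi>\<^sub>1 F (P 0) (root (2 ^ n) c * (K * K))\<close> \<zeta> by (simp add: mat_bound_def)
      ultimately show ?thesis by (intro LIMSEQ_le_const) auto
    qed
  qed (simp add: K0)
  then have "mat_bound \<pi>\<^sub>1 F M (sqrt (K * K))" unfolding P0 by (rule r1.mat_bound_sqrt[OF F M])
  then show ?thesis using K0 by (simp add: real_sqrt_mult_self)
qed

section \<open>Independence of the spatial norm from the representations\<close>

lemma ell2_swap:
  fixes \<zeta> :: "'h \<times> 'k \<Rightarrow> complex"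
  shows "\<zeta> \<circ> prod.swap \<in> ell2 \<longleftrightarrow> \<zeta> \<in> ell2" "ell2_norm (\<zeta> \<circ> prod.swap) = ell2_norm \<zeta>"
  using summable_on_reindex_bij_betw[of prod.swap UNIV UNIV "\<lambda>z. (cmod (\<zeta> z))\<^sup>2"]
    infsum_reindex_bij_betw[of prod.swap UNIV UNIV "\<lambda>z. (cmod (\<zeta> z))\<^sup>2"]
  by (simp_all add: ell2_def ell2_norm_def o_def)

lemma ell2_rows:
  assumes "\<zeta> \<in> ell2"
  shows "(\<lambda>j. \<zeta> (i, j)) \<in> ell2"
    "((\<lambda>i. (ell2_norm (\<lambda>j. \<zeta> (i, j)))\<^sup>2) has_sum (ell2_norm \<zeta>)\<^sup>2) UNIV"
proof -
  have sm: "(\<lambda>z. (cmod (\<zeta> z))\<^sup>2) summable_on Sigma UNIV (\<lambda>_. UNIV)" using assms by (simp add: ell2_def)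
  have row: "(\<lambda>j. (cmod (\<zeta> (i, j)))\<^sup>2) summable_on UNIV" for i
    using summable_on_SigmaD1[of "\<lambda>x y. (cmod (\<zeta> (x, y)))\<^sup>2" UNIV "\<lambda>_. UNIV" i] sm by (simp add: case_prod_unfold)
  then show "(\<lambda>j. \<zeta> (i, j)) \<in> ell2" by (simp add: ell2_def)
  show "((\<lambda>i. (ell2_norm (\<lambda>j. \<zeta> (i, j)))\<^sup>2) has_sum (ell2_norm \<zeta>)\<^sup>2) UNIV"
    using has_sum_SigmaD[OF has_sum_infsum[OF sm] has_sum_infsum[OF row]]
    by (simp add: ell2_norm_def infsum_nonneg)
qed

lemma ell2_of_rows:
  assumes row: "\<And>i. (\<lambda>j. \<zeta> (i, j)) \<in> ell2"
    and sum: "(\<lambda>i. (ell2_norm (\<lambda>j. \<zeta> (i, j)))\<^sup>2) summable_on UNIV"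
  shows "\<zeta> \<in> ell2"
proof -
  have "((\<lambda>j. (cmod (\<zeta> (i, j)))\<^sup>2) has_sum (ell2_norm (\<lambda>j. \<zeta> (i, j)))\<^sup>2) UNIV" for i
    using has_sum_infsum[of "\<lambda>j. (cmod (\<zeta> (i, j)))\<^sup>2" UNIV] row[of i] by (simp add: ell2_def ell2_norm_def infsum_nonneg)
  from summable_on_SigmaI[of UNIV "\<lambda>z. (cmod (\<zeta> z))\<^sup>2", OF this sum] show ?thesis by (simp add: ell2_def)
qed

lemma ell2_columns:
  assumes "\<zeta> \<in> ell2"
  shows "(\<lambda>i. \<zeta> (i, j)) \<in> ell2"
    "((\<lambda>j. (ell2_norm (\<lambda>i. \<zeta> (i, j)))\<^sup>2) has_sum (ell2_norm \<zeta>)\<^sup>2) UNIV"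
  using ell2_rows[of "\<zeta> \<circ> prod.swap"] assms by (simp_all add: ell2_swap)

lemma ell2_of_columns:
  assumes "\<And>j. (\<lambda>i. \<zeta> (i, j)) \<in> ell2" "(\<lambda>j. (ell2_norm (\<lambda>i. \<zeta> (i, j)))\<^sup>2) summable_on UNIV"
  shows "\<zeta> \<in> ell2"
  using ell2_of_rows[of "\<zeta> \<circ> prod.swap"] assms by (simp add: ell2_swap)

lemma bounded_opI:
  assumes "\<And>\<xi>. \<xi> \<in> ell2 \<Longrightarrow> S \<xi> \<in> ell2"
    and "\<And>\<xi> \<eta>. \<lbrakk>\<xi> \<in> ell2; \<eta> \<in> ell2\<rbrakk> \<Longrightarrow> S (\<lambda>i. \<xi> i + \<eta> i) = (\<lambda>i. S \<xi> i + S \<eta> i)"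
    and "\<And>\<xi> c. \<xi> \<in> ell2 \<Longrightarrow> S (\<lambda>i. c * \<xi> i) = (\<lambda>i. c * S \<xi> i)"
    and "\<And>\<xi>. \<xi> \<in> ell2 \<Longrightarrow> ell2_norm (S \<xi>) \<le> K * ell2_norm \<xi>"
  shows "bounded_op S"
  unfolding bounded_op_def using assms by (intro conjI ballI allI Pi_I exI[of _ K]) simp_all

text \<open>This is the operator 1 tensor R. Conjugation by the flip turns it into an operator on
  the other leg, so one estimate serves both factors of \<open>op_tensor\<close>.\<close>

definition op_right :: "(('k \<Rightarrow> complex) \<Rightarrow> 'k \<Rightarrow> complex) \<Rightarrow> ('h \<times> 'k \<Rightarrow> complex) \<Rightarrow> 'h \<times> 'k \<Rightarrow> complex" where
  "op_right R \<zeta> = (\<lambda>(i, j). R (\<lambda>j'. \<zeta> (i, j')) j)"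

lemma op_tensor_eq: "op_tensor S R \<zeta> = op_right S (op_right R \<zeta> \<circ> prod.swap) \<circ> prod.swap"
  by (auto simp: op_tensor_def op_right_def fun_eq_iff)

lemma op_right_bound:
  assumes R: "bounded_op R" and \<zeta>: "\<zeta> \<in> ell2"
  shows "op_right R \<zeta> \<in> ell2" "ell2_norm (op_right R \<zeta>) \<le> op_norm R * ell2_norm \<zeta>"
proof -
  let ?N = "op_norm R"
  have eq: "(\<lambda>j. op_right R \<zeta> (i, j)) = R (\<lambda>j. \<zeta> (i, j))" for i by (simp add: op_right_def)
  have le: "(ell2_norm (\<lambda>j. op_right R \<zeta> (i, j)))\<^sup>2 \<le> ?N\<^sup>2 * (ell2_norm (\<lambda>j. \<zeta> (i, j)))\<^sup>2" for i
    unfolding eq power_mult_distrib[symmetric]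
    by (intro power_mono op_norm_bound[OF R] ell2_rows \<zeta> ell2_norm_nonneg)
  have sum: "((\<lambda>i. ?N\<^sup>2 * (ell2_norm (\<lambda>j. \<zeta> (i, j)))\<^sup>2) has_sum ?N\<^sup>2 * (ell2_norm \<zeta>)\<^sup>2) UNIV"
    by (rule has_sum_cmult_right[OF ell2_rows(2)[OF \<zeta>]])
  have sm: "(\<lambda>i. (ell2_norm (\<lambda>j. op_right R \<zeta> (i, j)))\<^sup>2) summable_on UNIV"
    by (rule summable_on_comparison_test[OF has_sum_imp_summable[OF sum]]) (use le in auto)
  show mem: "op_right R \<zeta> \<in> ell2"
    by (rule ell2_of_rows[OF _ sm]) (simp add: eq bounded_op_mem[OF R] ell2_rows \<zeta>)
  have "(ell2_norm (op_right R \<zeta>))\<^sup>2 \<le> ?N\<^sup>2 * (ell2_norm \<zeta>)\<^sup>2"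
    by (rule has_sum_mono[OF ell2_rows(2)[OF mem] sum]) (rule le)
  then show "ell2_norm (op_right R \<zeta>) \<le> ?N * ell2_norm \<zeta>"
    unfolding power_mult_distrib[symmetric]
    by (rule power2_le_imp_le) (intro mult_nonneg_nonneg op_norm_nonneg[OF R] ell2_norm_nonneg)
qed

lemma op_tensor_bound:
  assumes S: "bounded_op S" and R: "bounded_op R" and \<zeta>: "\<zeta> \<in> ell2"
  shows "op_tensor S R \<zeta> \<in> ell2" "ell2_norm (op_tensor S R \<zeta>) \<le> op_norm S * op_norm R * ell2_norm \<zeta>"
proof -
  have m: "op_right R \<zeta> \<circ> prod.swap \<in> ell2" by (simp add: ell2_swap op_right_bound R \<zeta>)
  show "op_tensor S R \<zeta> \<in> ell2" unfolding op_tensor_eq by (simp add: ell2_swap op_right_bound(1)[OF S m])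
  have "ell2_norm (op_tensor S R \<zeta>) \<le> op_norm S * ell2_norm (op_right R \<zeta>)"
    unfolding op_tensor_eq using op_right_bound(2)[OF S m] by (simp add: ell2_swap)
  also have "\<dots> \<le> op_norm S * (op_norm R * ell2_norm \<zeta>)"
    by (intro mult_left_mono op_right_bound(2) R \<zeta> op_norm_nonneg S)
  finally show "ell2_norm (op_tensor S R \<zeta>) \<le> op_norm S * op_norm R * ell2_norm \<zeta>" by (simp add: mult.assoc)
qed

lemma bounded_op_tensor:
  assumes S: "bounded_op S" and R: "bounded_op R"
  shows "bounded_op (op_tensor S R)"
proof (rule bounded_opI[where K = "op_norm S * op_norm R"])
  have row: "R (\<lambda>j'. \<zeta> (i, j')) \<in> ell2" if "\<zeta> \<in> ell2" for \<zeta> :: "'a \<times> 'b \<Rightarrow> complex" and i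
    using that by (intro bounded_op_mem[OF R] ell2_rows)
  have col: "(\<lambda>i. R (\<lambda>j'. \<zeta> (i, j')) j) \<in> ell2" if "\<zeta> \<in> ell2" for \<zeta> :: "'a \<times> 'b \<Rightarrow> complex" and j
    using ell2_columns(1)[OF op_right_bound(1)[OF R that]] by (simp add: op_right_def)
  show "op_tensor S R (\<lambda>i. \<xi> i + \<eta> i) = (\<lambda>i. op_tensor S R \<xi> i + op_tensor S R \<eta> i)"
    if "\<xi> \<in> ell2" "\<eta> \<in> ell2" for \<xi> \<eta> :: "'a \<times> 'b \<Rightarrow> complex"
    using that by (simp add: op_tensor_def bounded_op_add[OF R] ell2_rows bounded_op_add[OF S] col fun_eq_iff)
  show "op_tensor S R (\<lambda>i. c * \<xi> i) = (\<lambda>i. c * op_tensor S R \<xi> i)"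
    if "\<xi> \<in> ell2" for \<xi> :: "'a \<times> 'b \<Rightarrow> complex" and c
    using that by (simp add: op_tensor_def bounded_op_scale[OF R] ell2_rows bounded_op_scale[OF S] col fun_eq_iff)
qed (use op_tensor_bound[OF S R] in auto)

lemma bounded_op_setsum:
  fixes S :: "'i \<Rightarrow> ('a \<Rightarrow> complex) \<Rightarrow> 'a \<Rightarrow> complex"
  assumes F: "finite F" and S: "\<And>k. k \<in> F \<Longrightarrow> bounded_op (S k)"
  shows "bounded_op (\<lambda>\<zeta> z. \<Sum>k\<in>F. S k \<zeta> z)"
proof (rule bounded_opI[where K = "\<Sum>k\<in>F. op_norm (S k)"])
  fix \<xi> :: "'a \<Rightarrow> complex" assume \<xi>: "\<xi> \<in> ell2"
  note sum = ell2_sum[OF F, of "\<lambda>k. S k \<xi>"]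
  show "(\<lambda>z. \<Sum>k\<in>F. S k \<xi> z) \<in> ell2" using sum \<xi> bounded_op_mem[OF S] by blast
  have "ell2_norm (\<lambda>z. \<Sum>k\<in>F. S k \<xi> z) \<le> (\<Sum>k\<in>F. ell2_norm (S k \<xi>))" using sum \<xi> bounded_op_mem[OF S] by blast
  also have "\<dots> \<le> (\<Sum>k\<in>F. op_norm (S k) * ell2_norm \<xi>)" by (intro sum_mono op_norm_bound S \<xi>)
  finally show "ell2_norm (\<lambda>z. \<Sum>k\<in>F. S k \<xi> z) \<le> (\<Sum>k\<in>F. op_norm (S k)) * ell2_norm \<xi>" by (simp add: sum_distrib_right)
qed (simp_all add: bounded_op_add[OF S] bounded_op_scale[OF S] sum.distrib sum_distrib_left)

lemma ell2_finite_support: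
  assumes "finite F" "\<And>z. z \<notin> F \<Longrightarrow> \<zeta> z = 0"
  shows "\<zeta> \<in> ell2"
proof -
  have "(\<lambda>z. (cmod (\<zeta> z))\<^sup>2) summable_on F" using assms(1) by simp
  then show ?thesis unfolding ell2_def using assms(2) by (subst (asm) summable_on_cong_neutral[where T = UNIV]) auto
qed

lemma ell2_approx:
  assumes \<zeta>: "\<zeta> \<in> ell2" and e: "0 < e"
  obtains \<eta> \<theta> F where "finite F" "\<And>z. z \<notin> F \<Longrightarrow> \<eta> z = 0" "\<theta> \<in> ell2" "\<zeta> = (\<lambda>z. \<eta> z + \<theta> z)"
    "ell2_norm \<eta> \<le> ell2_norm \<zeta>" "ell2_norm \<theta> \<le> e"
proof -
  let ?f = "\<lambda>z. (cmod (\<zeta> z))\<^sup>2"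
  have sm: "?f summable_on UNIV" using \<zeta> by (simp add: ell2_def)
  obtain F where F: "finite F" "dist (sum ?f F) (infsum ?f UNIV) \<le> e\<^sup>2"
    using infsum_finite_approximation[OF sm, of "e\<^sup>2"] e by auto
  define \<eta> where "\<eta> z = (if z \<in> F then \<zeta> z else 0)" for z
  define \<theta> where "\<theta> z = (if z \<in> F then 0 else \<zeta> z)" for z
  have "L2_set (\<lambda>z. cmod (\<theta> z)) G \<le> e" if G: "finite G" for G
  proof -
    have "(\<Sum>z\<in>G. (cmod (\<theta> z))\<^sup>2) = sum ?f (G - F)"
      using G by (intro sum.mono_neutral_cong_right) (auto simp: \<theta>_def)
    also have "\<dots> = sum ?f (G \<union> F) - sum ?f F"
      using G F(1) sum.union_disjoint[of "G - F" F ?f] by (simp add: Diff_disjoint Int_commute)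
    also have "\<dots> \<le> infsum ?f UNIV - sum ?f F"
      using G F(1) by (simp add: finite_sum_le_infsum[OF sm])
    also have "\<dots> \<le> e\<^sup>2" using F(2) by (simp add: dist_real_def)
    finally show ?thesis using e by (simp add: L2_set_def real_le_lsqrt)
  qed
  then have \<theta>: "\<theta> \<in> ell2" "ell2_norm \<theta> \<le> e" using ell2I[of \<theta> e] by blast+
  have "L2_set (\<lambda>z. cmod (\<eta> z)) G \<le> ell2_norm \<zeta>" if G: "finite G" for G
  proof -
    have "L2_set (\<lambda>z. cmod (\<eta> z)) G \<le> L2_set (\<lambda>z. cmod (\<zeta> z)) G" by (intro L2_set_mono) (auto simp: \<eta>_def)
    then show ?thesis using L2_set_le_ell2_norm[OF \<zeta> G] by simp
  qed
  then have \<eta>: "ell2_norm \<eta> \<le> ell2_norm \<zeta>" by (rule ell2I)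
  have "\<zeta> = (\<lambda>z. \<eta> z + \<theta> z)" by (auto simp: \<eta>_def \<theta>_def)
  then show thesis using that[OF F(1) _ \<theta>(1) _ \<eta> \<theta>(2)] by (simp add: \<eta>_def)
qed

text \<open>Finitely supported vectors are dense and \<open>T\<close> is continuous. On such vectors
  all sums over coordinates are finite and may be interchanged freely.\<close>

lemma op_norm_le_finite_support:
  assumes T: "bounded_op T" and K: "0 \<le> K"
    and le: "\<And>F \<zeta>. \<lbrakk>finite F; \<And>z. z \<notin> F \<Longrightarrow> \<zeta> z = 0\<rbrakk> \<Longrightarrow> ell2_norm (T \<zeta>) \<le> K * ell2_norm \<zeta>"
  shows "op_norm T \<le> K"
proof (rule op_norm_le[OF K])
  fix \<zeta> :: "'a \<Rightarrow> complex" assume \<zeta>: "\<zeta> \<in> ell2"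
  have "ell2_norm (T \<zeta>) \<le> K * ell2_norm \<zeta> + e" if e: "0 < e" for e
  proof -
    \<comment> \<open>The added 1 keeps the denominator positive when the operator norm is
      0.\<close>
    define d where "d = e / (op_norm T + 1)"
    have n: "0 \<le> op_norm T" by (rule op_norm_nonneg[OF T])
    have d: "0 < d" "op_norm T * d \<le> e" using e n by (simp_all add: d_def field_simps)
    obtain \<eta> \<theta> F where F: "finite F" "\<And>z. z \<notin> F \<Longrightarrow> \<eta> z = 0" and \<theta>: "\<theta> \<in> ell2" "ell2_norm \<theta> \<le> d"
      and eq: "\<zeta> = (\<lambda>z. \<eta> z + \<theta> z)" and \<eta>: "ell2_norm \<eta> \<le> ell2_norm \<zeta>"
      using ell2_approx[OF \<zeta> d(1)] by metis
    have m: "\<eta> \<in> ell2" by (rule ell2_finite_support[OF F])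
    have "ell2_norm (T \<zeta>) \<le> ell2_norm (T \<eta>) + ell2_norm (T \<theta>)"
      unfolding eq bounded_op_add[OF T m \<theta>(1)] by (intro ell2_add bounded_op_mem[OF T] m \<theta>)
    also have "\<dots> \<le> K * ell2_norm \<eta> + op_norm T * ell2_norm \<theta>"
      by (intro add_mono le[OF F] op_norm_bound[OF T \<theta>(1)])
    also have "\<dots> \<le> K * ell2_norm \<zeta> + op_norm T * d"
      using \<eta> \<theta>(2) K n by (intro add_mono mult_left_mono)
    finally show ?thesis using d(2) by simp
  qed
  then show "ell2_norm (T \<zeta>) \<le> K * ell2_norm \<zeta>" by (rule field_le_epsilon)
qed

definition unit_vec :: "'k \<Rightarrow> 'k \<Rightarrow> complex" where
  "unit_vec j = (\<lambda>j'. if j' = j then 1 else 0)"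

lemma unit_vec_mem: "unit_vec j \<in> ell2"
  by (rule ell2_finite_support[of "{j}"]) (auto simp: unit_vec_def)

lemma bounded_op_finite_support:
  assumes R: "bounded_op R" and F: "finite F" "\<And>j. j \<notin> F \<Longrightarrow> \<xi> j = 0"
  shows "R \<xi> i = (\<Sum>j\<in>F. \<xi> j * R (unit_vec j) i)"
proof -
  have "\<xi> = (\<lambda>j'. \<Sum>j\<in>F. \<xi> j * unit_vec j j')"
  proof
    fix j'
    have "(\<Sum>j\<in>F. \<xi> j * unit_vec j j') = (\<Sum>j\<in>F. if j = j' then \<xi> j' else 0)"
      by (intro sum.cong) (auto simp: unit_vec_def)
    then show "\<xi> j' = (\<Sum>j\<in>F. \<xi> j * unit_vec j j')" using F by simp
  qed
  then have "R \<xi> = R (\<lambda>j'. \<Sum>j\<in>F. \<xi> j * unit_vec j j')" by simp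
  then show ?thesis
    using bounded_op_sum[OF R F(1), of "\<lambda>j j'. \<xi> j * unit_vec j j'"]
    by (simp add: ell2_scale unit_vec_mem bounded_op_scale[OF R])
qed

text \<open>\<open>op_tensor\<close> applies the second operator first, so its symmetry is not built
  in. On a finitely supported vector both orders expand into the same finite double sum over unit
  vectors.\<close>

lemma op_tensor_swap:
  assumes S: "bounded_op S" and R: "bounded_op R" and F: "finite F" "\<And>z. z \<notin> F \<Longrightarrow> \<zeta> z = 0"
  shows "op_tensor S R \<zeta> (x, y) = op_tensor R S (\<zeta> \<circ> prod.swap) (y, x)"
proof -
  let ?X = "fst ` F" and ?Y = "snd ` F"
  have 0: "\<zeta> (i, j) = 0" if "i \<notin> ?X \<or> j \<notin> ?Y" for i j using F(2) that by force
  have "op_tensor S R \<zeta> (x, y) = S (\<lambda>i. \<Sum>j\<in>?Y. \<zeta> (i, j) * R (unit_vec j) y) x"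
    using bounded_op_finite_support[OF R, of ?Y] F(1) 0 by (simp add: op_tensor_def)
  also have "\<dots> = (\<Sum>i\<in>?X. (\<Sum>j\<in>?Y. \<zeta> (i, j) * R (unit_vec j) y) * S (unit_vec i) x)"
    by (rule bounded_op_finite_support[OF S]) (use F(1) 0 in auto)
  also have "\<dots> = (\<Sum>j\<in>?Y. (\<Sum>i\<in>?X. \<zeta> (i, j) * S (unit_vec i) x) * R (unit_vec j) y)"
    unfolding sum_distrib_right by (subst sum.swap) (simp add: ac_simps)
  also have "\<dots> = R (\<lambda>j. \<Sum>i\<in>?X. \<zeta> (i, j) * S (unit_vec i) x) y"
    by (rule bounded_op_finite_support[OF R, symmetric]) (use F(1) 0 in auto)
  also have "\<dots> = op_tensor R S (\<zeta> \<circ> prod.swap) (y, x)"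
    using bounded_op_finite_support[OF S, of ?X] F(1) 0 by (simp add: op_tensor_def)
  finally show ?thesis .
qed

section \<open>Spatial operators as matrices over the first algebra\<close>

abbreviation spatial_op ::
    "nat \<Rightarrow> (nat \<Rightarrow> ('h \<Rightarrow> complex) \<Rightarrow> 'h \<Rightarrow> complex) \<Rightarrow> (nat \<Rightarrow> ('k \<Rightarrow> complex) \<Rightarrow> 'k \<Rightarrow> complex)
      \<Rightarrow> ('h \<times> 'k \<Rightarrow> complex) \<Rightarrow> 'h \<times> 'k \<Rightarrow> complex" where
  "spatial_op n S R \<equiv> (\<lambda>\<zeta> z. \<Sum>k<n. op_tensor (S k) (R k) \<zeta> z)"

lemma bounded_spatial_op:
  assumes "\<And>k. k < n \<Longrightarrow> bounded_op (S k)" "\<And>k. k < n \<Longrightarrow> bounded_op (R k)"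
  shows "bounded_op (spatial_op n S R)"
  by (rule bounded_op_setsum) (use assms in \<open>auto intro: bounded_op_tensor\<close>)

lemma op_norm_spatial_op_swap_le:
  fixes S :: "nat \<Rightarrow> ('a \<Rightarrow> complex) \<Rightarrow> 'a \<Rightarrow> complex" and R :: "nat \<Rightarrow> ('b \<Rightarrow> complex) \<Rightarrow> 'b \<Rightarrow> complex"
  assumes S: "\<And>k. k < n \<Longrightarrow> bounded_op (S k)" and R: "\<And>k. k < n \<Longrightarrow> bounded_op (R k)"
  shows "op_norm (spatial_op n S R) \<le> op_norm (spatial_op n R S)"
proof (rule op_norm_le_finite_support)
  note T = bounded_spatial_op[of n R S, OF R S]
  show "bounded_op (spatial_op n S R)" by (rule bounded_spatial_op[OF S R])
  show "0 \<le> op_norm (spatial_op n R S)" by (rule op_norm_nonneg[OF T])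
  fix F and \<zeta> :: "'a \<times> 'b \<Rightarrow> complex" assume F: "finite F" "\<And>z. z \<notin> F \<Longrightarrow> \<zeta> z = 0"
  have "spatial_op n S R \<zeta> = spatial_op n R S (\<zeta> \<circ> prod.swap) \<circ> prod.swap"
    by (auto simp: fun_eq_iff intro!: sum.cong op_tensor_swap[OF _ _ F] S R)
  then have "ell2_norm (spatial_op n S R \<zeta>) = ell2_norm (spatial_op n R S (\<zeta> \<circ> prod.swap))"
    by (simp only: ell2_swap)
  also have "\<dots> \<le> op_norm (spatial_op n R S) * ell2_norm (\<zeta> \<circ> prod.swap)"
    by (rule op_norm_bound[OF T iffD2[OF ell2_swap(1) ell2_finite_support[OF F]]])
  finally show "ell2_norm (spatial_op n S R \<zeta>) \<le> op_norm (spatial_op n R S) * ell2_norm \<zeta>"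
    by (simp only: ell2_swap)
qed

lemma op_norm_spatial_op_swap:
  assumes "\<And>k. k < n \<Longrightarrow> bounded_op (S k)" "\<And>k. k < n \<Longrightarrow> bounded_op (R k)"
  shows "op_norm (spatial_op n S R) = op_norm (spatial_op n R S)"
  using op_norm_spatial_op_swap_le[of n S R] op_norm_spatial_op_swap_le[of n R S] assms by (simp add: antisym)

text \<open>The scalar is the matrix coefficient of \<open>R k\<close> at row \<open>i\<close> and
  column \<open>j\<close>, so the entry is a slice map applied to the sum of the tensors of
  \<open>a k\<close> with \<open>R k\<close>. It lies in \<open>A\<close> and refers to no
  representation of \<open>A\<close>; therefore two representations can be compared on one
  matrix.\<close>

definition slice_matrix ::
    "'a cstar \<Rightarrow> nat \<Rightarrow> (nat \<Rightarrow> 'a) \<Rightarrow> (nat \<Rightarrow> ('k \<Rightarrow> complex) \<Rightarrow> 'k \<Rightarrow> complex) \<Rightarrow> 'k \<Rightarrow> 'k \<Rightarrow> 'a" where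
  "slice_matrix A n a R i j = (\<Oplus>\<^bsub>A\<^esub>k\<in>{..<n}. R k (unit_vec j) i \<odot>\<^bsub>A\<^esub> a k)"

lemma (in cstar_algebra) slice_matrix_closed:
  "(\<And>k. k < n \<Longrightarrow> a k \<in> carrier A) \<Longrightarrow> slice_matrix A n a R i j \<in> carrier A"
  by (auto simp: slice_matrix_def intro!: finsum_closed closed)

lemma (in cstar_rep) spatial_op_eq_mat_op:
  assumes a: "\<And>k. k < n \<Longrightarrow> a k \<in> carrier A" and R: "\<And>k. k < n \<Longrightarrow> bounded_op (R k)"
    and F: "finite F" "\<And>x j. j \<notin> F \<Longrightarrow> \<zeta> (x, j) = 0" and \<zeta>: "\<And>j. (\<lambda>x. \<zeta> (x, j)) \<in> ell2"
  shows "spatial_op n (\<lambda>k. \<pi> (a k)) R \<zeta> (x, i) = mat_op \<pi> F (slice_matrix A n a R) (\<lambda>j x. \<zeta> (x, j)) i x"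
proof -
  have "op_tensor (\<pi> (a k)) (R k) \<zeta> (x, i) = (\<Sum>j\<in>F. R k (unit_vec j) i * \<pi> (a k) (\<lambda>x. \<zeta> (x, j)) x)" if k: "k < n" for k
  proof -
    have "R k (\<lambda>j. \<zeta> (x', j)) i = (\<Sum>j\<in>F. R k (unit_vec j) i * \<zeta> (x', j))" for x'
      using bounded_op_finite_support[OF R[OF k] F(1), of "\<lambda>j. \<zeta> (x', j)"] F by (simp add: mult.commute)
    then have "op_tensor (\<pi> (a k)) (R k) \<zeta> (x, i) = \<pi> (a k) (\<lambda>x. \<Sum>j\<in>F. R k (unit_vec j) i * \<zeta> (x, j)) x"
      by (simp add: op_tensor_def)
    then show ?thesis using bounded_op_sum[OF rep_bounded[OF a[OF k]] F(1), of "\<lambda>j x. R k (unit_vec j) i * \<zeta> (x, j)"] \<zeta>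
      by (simp add: ell2_scale bounded_op_scale[OF rep_bounded[OF a[OF k]]])
  qed
  then have "spatial_op n (\<lambda>k. \<pi> (a k)) R \<zeta> (x, i) = (\<Sum>k<n. \<Sum>j\<in>F. R k (unit_vec j) i * \<pi> (a k) (\<lambda>x. \<zeta> (x, j)) x)"
    by simp
  also have "\<dots> = (\<Sum>j\<in>F. \<Sum>k<n. R k (unit_vec j) i * \<pi> (a k) (\<lambda>x. \<zeta> (x, j)) x)" by (rule sum.swap)
  also have "\<dots> = mat_op \<pi> F (slice_matrix A n a R) (\<lambda>j x. \<zeta> (x, j)) i x"
  proof -
    have "\<pi> (slice_matrix A n a R i j) (\<lambda>x. \<zeta> (x, j)) = (\<lambda>x. \<Sum>k<n. R k (unit_vec j) i * \<pi> (a k) (\<lambda>x. \<zeta> (x, j)) x)" for j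
      unfolding slice_matrix_def using a \<zeta>[of j] by (subst rep_finsum) (auto simp: rep_smult intro: closed)
    then show ?thesis by (simp add: mat_op_def)
  qed
  finally show ?thesis .
qed

lemma ell2_norm_columns:
  assumes F: "finite F" "\<And>x j. j \<notin> F \<Longrightarrow> \<zeta> (x, j) = 0" and \<zeta>: "\<And>j. (\<lambda>x. \<zeta> (x, j)) \<in> ell2"
  shows "\<zeta> \<in> ell2" "ell2_norm \<zeta> = vec_norm F (\<lambda>j x. \<zeta> (x, j))"
proof -
  let ?f = "\<lambda>j. (ell2_norm (\<lambda>x. \<zeta> (x, j)))\<^sup>2"
  have 0: "?f j = 0" if "j \<notin> F" for j using F(2)[OF that] by simp
  have hs: "(?f has_sum sum ?f F) UNIV"
    by (rule has_sum_cong_neutral[THEN iffD1, OF _ _ _ has_sum_finite[OF F(1)]]) (use 0 in auto)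
  show m: "\<zeta> \<in> ell2" by (rule ell2_of_columns[OF \<zeta> has_sum_imp_summable[OF hs]])
  have "(ell2_norm \<zeta>)\<^sup>2 = (vec_norm F (\<lambda>j x. \<zeta> (x, j)))\<^sup>2"
    using has_sum_unique[OF ell2_columns(2)[OF m] hs] by (simp add: vec_norm_square)
  then show "ell2_norm \<zeta> = vec_norm F (\<lambda>j x. \<zeta> (x, j))"
    using power2_eq_imp_eq ell2_norm_nonneg vec_norm_nonneg by blast
qed

lemma vec_norm_columns_le:
  assumes "finite F" "\<zeta> \<in> ell2"
  shows "vec_norm F (\<lambda>j x. \<zeta> (x, j)) \<le> ell2_norm \<zeta>"
proof (rule power2_le_imp_le)
  show "(vec_norm F (\<lambda>j x. \<zeta> (x, j)))\<^sup>2 \<le> (ell2_norm \<zeta>)\<^sup>2"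
    unfolding vec_norm_square
    using finite_sum_le_has_sum[OF ell2_columns(2)[OF assms(2)] assms(1)] by simp
qed (rule ell2_norm_nonneg)

text \<open>Compressing the second leg to finitely many coordinates turns a spatial operator into a matrix over
  the first algebra, where \<open>mat_bound_indep\<close> applies.\<close>

lemma op_norm_spatial_op_le:
  fixes \<pi>\<^sub>1 :: "'a \<Rightarrow> ('h \<Rightarrow> complex) \<Rightarrow> 'h \<Rightarrow> complex" and \<pi>\<^sub>2 :: "'a \<Rightarrow> ('g \<Rightarrow> complex) \<Rightarrow> 'g \<Rightarrow> complex"
    and R :: "nat \<Rightarrow> ('k \<Rightarrow> complex) \<Rightarrow> 'k \<Rightarrow> complex"
  assumes rep1: "cstar_rep A \<pi>\<^sub>1" and rep2: "cstar_rep A \<pi>\<^sub>2"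
    and a: "\<And>k. k < n \<Longrightarrow> a k \<in> carrier A" and R: "\<And>k. k < n \<Longrightarrow> bounded_op (R k)"
  shows "op_norm (spatial_op n (\<lambda>k. \<pi>\<^sub>1 (a k)) R) \<le> op_norm (spatial_op n (\<lambda>k. \<pi>\<^sub>2 (a k)) R)"
proof -
  interpret r1: cstar_rep A \<pi>\<^sub>1 by fact
  interpret r2: cstar_rep A \<pi>\<^sub>2 by fact
  let ?T1 = "spatial_op n (\<lambda>k. \<pi>\<^sub>1 (a k)) R" and ?T2 = "spatial_op n (\<lambda>k. \<pi>\<^sub>2 (a k)) R"
  let ?M = "slice_matrix A n a R"
  have M: "?M i j \<in> carrier A" for i j by (rule r1.slice_matrix_closed[OF a])
  have T1: "bounded_op ?T1" by (rule bounded_spatial_op) (use a R r1.rep_bounded in auto)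
  have T2: "bounded_op ?T2" by (rule bounded_spatial_op) (use a R r2.rep_bounded in auto)
  define K where "K = op_norm ?T2"
  have K: "0 \<le> K" unfolding K_def by (rule op_norm_nonneg[OF T2])
  have bound2: "mat_bound \<pi>\<^sub>2 F ?M K" if F: "finite F" for F
    unfolding mat_bound_def
  proof (intro conjI allI impI K)
    fix \<eta> :: "'k \<Rightarrow> 'g \<Rightarrow> complex" assume \<eta>: "\<forall>j. \<eta> j \<in> ell2"
    \<comment> \<open>Extending by zero outside \<open>F\<close> turns the family of columns into
      one vector of the same norm; discarding the output columns outside \<open>F\<close> can only
      decrease the norm.\<close>
    define \<zeta> :: "'g \<times> 'k \<Rightarrow> complex" where "\<zeta> = (\<lambda>(x, j). if j \<in> F then \<eta> j x else 0)"
    have 0: "\<zeta> (x, j) = 0" if "j \<notin> F" for x j using that by (simp add: \<zeta>_def)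
    have col: "(\<lambda>x. \<zeta> (x, j)) \<in> ell2" for j using \<eta> by (cases "j \<in> F") (simp_all add: \<zeta>_def)
    have mop: "mat_op \<pi>\<^sub>2 F ?M \<eta> = mat_op \<pi>\<^sub>2 F ?M (\<lambda>j x. \<zeta> (x, j))"
      by (simp add: mat_op_def \<zeta>_def fun_eq_iff)
    also have "\<dots> = (\<lambda>i x. ?T2 \<zeta> (x, i))"
      using r2.spatial_op_eq_mat_op[OF a R F 0 col] by (simp add: fun_eq_iff)
    finally have "vec_norm F (mat_op \<pi>\<^sub>2 F ?M \<eta>) = vec_norm F (\<lambda>i x. ?T2 \<zeta> (x, i))" by simp
    also have "\<dots> \<le> ell2_norm (?T2 \<zeta>)"
      by (intro vec_norm_columns_le F bounded_op_mem[OF T2] ell2_norm_columns[OF F 0 col])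
    also have "\<dots> \<le> K * ell2_norm \<zeta>"
      unfolding K_def by (intro op_norm_bound[OF T2] ell2_norm_columns[OF F 0 col])
    also have "ell2_norm \<zeta> = vec_norm F (\<lambda>j x. \<zeta> (x, j))" by (rule ell2_norm_columns[OF F 0 col])
    also have "\<dots> = vec_norm F \<eta>" by (simp add: vec_norm_def L2_set_def \<zeta>_def)
    finally show "vec_norm F (mat_op \<pi>\<^sub>2 F ?M \<eta>) \<le> K * vec_norm F \<eta>" .
  qed
  have bound1: "mat_bound \<pi>\<^sub>1 F ?M K" if F: "finite F" for F
    by (rule mat_bound_indep[OF rep1 rep2 F M bound2[OF F]])
  have "op_norm ?T1 \<le> K"
  proof (rule op_norm_le_finite_support[OF T1 K])
    fix G and \<zeta> :: "'h \<times> 'k \<Rightarrow> complex" assume G: "finite G" "\<And>z. z \<notin> G \<Longrightarrow> \<zeta> z = 0"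
    have m: "\<zeta> \<in> ell2" by (rule ell2_finite_support[OF G])
    note col = ell2_columns(1)[OF m]
    have T1m: "?T1 \<zeta> \<in> ell2" by (rule bounded_op_mem[OF T1 m])
    have le: "(\<Sum>j\<in>F. (ell2_norm (\<lambda>x. ?T1 \<zeta> (x, j)))\<^sup>2) \<le> (K * ell2_norm \<zeta>)\<^sup>2" if "finite F" for F
    proof -
      \<comment> \<open>A square matrix needs one index set for input and output, so the second
        coordinates of the support of \<open>\<zeta>\<close> are added to \<open>F\<close>. The
        extra output columns only increase the sum.\<close>
      define H where "H = F \<union> snd ` G"
      have H: "finite H" using that G(1) by (simp add: H_def)
      have 0: "\<zeta> (x, j) = 0" if "j \<notin> H" for x j using that G(2)[of "(x, j)"] by (force simp: H_def)
      have "(\<Sum>j\<in>F. (ell2_norm (\<lambda>x. ?T1 \<zeta> (x, j)))\<^sup>2) \<le> (\<Sum>j\<in>H. (ell2_norm (\<lambda>x. ?T1 \<zeta> (x, j)))\<^sup>2)"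
        by (rule sum_mono2[OF H]) (auto simp: H_def)
      also have "\<dots> = (vec_norm H (mat_op \<pi>\<^sub>1 H ?M (\<lambda>j x. \<zeta> (x, j))))\<^sup>2"
        unfolding vec_norm_square using r1.spatial_op_eq_mat_op[OF a R H 0 col] by simp
      also have "\<dots> \<le> (K * ell2_norm \<zeta>)\<^sup>2"
        using bound1[OF H] col ell2_norm_columns(2)[of H \<zeta>, OF H 0 col]
        by (intro power_mono vec_norm_nonneg) (simp add: mat_bound_def)
      finally show ?thesis .
    qed
    have "(ell2_norm (?T1 \<zeta>))\<^sup>2 \<le> (K * ell2_norm \<zeta>)\<^sup>2"
      by (rule has_sum_le_finite_sums[OF ell2_columns(2)[OF T1m]]) (use le in auto)
    then show "ell2_norm (?T1 \<zeta>) \<le> K * ell2_norm \<zeta>"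
      by (rule power2_le_imp_le) (intro mult_nonneg_nonneg K ell2_norm_nonneg)
  qed
  then show ?thesis by (simp add: K_def)
qed

text \<open>The preceding comparison changes the representation on the first leg only; the flip
  exchanges the legs, so that the second one is changed in the same way.\<close>

theorem op_norm_spatial_op_indep:
  assumes \<pi>: "cstar_rep A \<pi>\<^sub>1" "cstar_rep A \<pi>\<^sub>2" and \<rho>: "cstar_rep B \<rho>\<^sub>1" "cstar_rep B \<rho>\<^sub>2"
    and a: "\<And>k. k < n \<Longrightarrow> a k \<in> carrier A" and b: "\<And>k. k < n \<Longrightarrow> b k \<in> carrier B"
  shows "op_norm (spatial_op n (\<lambda>k. \<pi>\<^sub>1 (a k)) (\<lambda>k. \<rho>\<^sub>1 (b k))) = op_norm (spatial_op n (\<lambda>k. \<pi>\<^sub>2 (a k)) (\<lambda>k. \<rho>\<^sub>2 (b k)))"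
proof -
  note bd = cstar_rep.rep_bounded
  have "op_norm (spatial_op n (\<lambda>k. \<pi>\<^sub>1 (a k)) (\<lambda>k. \<rho>\<^sub>1 (b k))) = op_norm (spatial_op n (\<lambda>k. \<pi>\<^sub>2 (a k)) (\<lambda>k. \<rho>\<^sub>1 (b k)))"
    by (intro antisym op_norm_spatial_op_le[OF \<pi> a bd[OF \<rho>(1) b]] op_norm_spatial_op_le[OF \<pi>(2,1) a bd[OF \<rho>(1) b]])
  also have "\<dots> = op_norm (spatial_op n (\<lambda>k. \<rho>\<^sub>1 (b k)) (\<lambda>k. \<pi>\<^sub>2 (a k)))"
    by (intro op_norm_spatial_op_swap bd[OF \<pi>(2)] bd[OF \<rho>(1)] a b)
  also have "\<dots> = op_norm (spatial_op n (\<lambda>k. \<rho>\<^sub>2 (b k)) (\<lambda>k. \<pi>\<^sub>2 (a k)))"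
    by (intro antisym op_norm_spatial_op_le[OF \<rho> b bd[OF \<pi>(2) a]] op_norm_spatial_op_le[OF \<rho>(2,1) b bd[OF \<pi>(2) a]])
  also have "\<dots> = op_norm (spatial_op n (\<lambda>k. \<pi>\<^sub>2 (a k)) (\<lambda>k. \<rho>\<^sub>2 (b k)))"
    by (intro op_norm_spatial_op_swap bd[OF \<pi>(2)] bd[OF \<rho>(2)] a b)
  finally show ?thesis .
qed

section \<open>Tensor products of *-monomorphisms\<close>

lemma star_homD:
  assumes "star_hom A B f"
  shows "x \<in> carrier A \<Longrightarrow> f x \<in> carrier B"
    and "\<lbrakk>x \<in> carrier A; y \<in> carrier A\<rbrakk> \<Longrightarrow> f (x \<oplus>\<^bsub>A\<^esub> y) = f x \<oplus>\<^bsub>B\<^esub> f y"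
    and "\<lbrakk>x \<in> carrier A; y \<in> carrier A\<rbrakk> \<Longrightarrow> f (x \<otimes>\<^bsub>A\<^esub> y) = f x \<otimes>\<^bsub>B\<^esub> f y"
    and "x \<in> carrier A \<Longrightarrow> f (c \<odot>\<^bsub>A\<^esub> x) = c \<odot>\<^bsub>B\<^esub> f x"
    and "x \<in> carrier A \<Longrightarrow> f (star A x) = star B (f x)"
  using assms by (auto simp: star_hom_def)

lemma star_homI:
  assumes "\<And>x. x \<in> carrier A \<Longrightarrow> f x \<in> carrier B"
    and "\<And>x y. \<lbrakk>x \<in> carrier A; y \<in> carrier A\<rbrakk> \<Longrightarrow> f (x \<oplus>\<^bsub>A\<^esub> y) = f x \<oplus>\<^bsub>B\<^esub> f y"
    and "\<And>x y. \<lbrakk>x \<in> carrier A; y \<in> carrier A\<rbrakk> \<Longrightarrow> f (x \<otimes>\<^bsub>A\<^esub> y) = f x \<otimes>\<^bsub>B\<^esub> f y"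
    and "\<And>x c. x \<in> carrier A \<Longrightarrow> f (c \<odot>\<^bsub>A\<^esub> x) = c \<odot>\<^bsub>B\<^esub> f x"
    and "\<And>x. x \<in> carrier A \<Longrightarrow> f (star A x) = star B (f x)"
  shows "star_hom A B f"
  using assms by (auto simp: star_hom_def)

lemma star_monoD:
  assumes "star_mono A B f"
  shows "star_hom A B f" "\<lbrakk>x \<in> carrier A; y \<in> carrier A; f x = f y\<rbrakk> \<Longrightarrow> x = y" "x \<in> carrier A \<Longrightarrow> f x \<in> carrier B"
  using assms by (auto simp: star_mono_def star_hom_def dest: inj_onD)

lemma star_mono_id: "star_mono A A (\<lambda>x. x)"
  by (simp add: star_mono_def star_hom_def inj_on_def)

lemma star_hom_comp: "\<lbrakk>star_hom A B f; star_hom B C g\<rbrakk> \<Longrightarrow> star_hom A C (\<lambda>x. g (f x))"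
  by (auto simp: star_hom_def Pi_iff)

lemma star_mono_comp: "\<lbrakk>star_mono A B f; star_mono B C g\<rbrakk> \<Longrightarrow> star_mono A C (\<lambda>x. g (f x))"
  unfolding star_mono_def using star_hom_comp by (auto simp: inj_on_def star_hom_def Pi_iff)

lemma star_hom_cong:
  assumes "star_hom A B f" "\<And>x. x \<in> carrier A \<Longrightarrow> g x = f x" "cstar_algebra A"
  shows "star_hom A B g"
proof -
  interpret cstar_algebra A by fact
  show ?thesis using assms(1) by (intro star_homI) (simp_all add: assms(2) closed star_homD)
qed

lemma star_mono_cong:
  assumes "star_mono A B f" "\<And>x. x \<in> carrier A \<Longrightarrow> g x = f x" "cstar_algebra A"
  shows "star_mono A B g"
  using assms star_hom_cong[of A B f g] by (auto simp: star_mono_def inj_on_def)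

text \<open>The pulled-back norm \<open>\<lambda>x. nrm B (f x)\<close> is a C*-seminorm on
  \<open>A\<close>.\<close>

lemma star_hom_contractive:
  assumes A: "cstar_algebra A" and B: "cstar_algebra B" and f: "star_hom A B f" and x: "x \<in> carrier A"
  shows "nrm B (f x) \<le> nrm A x"
proof -
  interpret A: cstar_algebra A by fact
  interpret B: cstar_algebra B by fact
  note f' = star_homD[OF f]
  have cs: "nrm B (star B (f x)  \<otimes>\<^bsub>B\<^esub> f x) = (nrm B (f x))\<^sup>2" if "x \<in> carrier A" for x
    using B.cstar_identity f'(1)[OF that] by simp
  interpret cstar_seminorm A "\<lambda>x. nrm B (f x)"
    by unfold_locales
      (use cs in \<open>simp_all add: f' A.closed B.nrm_nonneg B.nrm_triangle B.nrm_smult B.nrm_mult\<close>)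
  show ?thesis by (rule Q_le_nrm[OF x])
qed

text \<open>Representations pulled back along injective maps let the norms in the source and in the
  target of a tensor product of maps be computed on the same Hilbert spaces.\<close>

lemma faithful_rep_comp:
  assumes \<pi>: "faithful_rep B \<pi>" and f: "star_mono A B f"
  shows "faithful_rep A (\<lambda>a. \<pi> (f a))"
proof -
  note f' = star_homD[OF star_monoD(1)[OF f]] and inj = star_monoD(2)[OF f]
  note \<pi>' = \<pi>[unfolded faithful_rep_def]
  have "a = b" if "a \<in> carrier A" "b \<in> carrier A" "\<forall>\<xi>\<in>ell2. \<pi> (f a) \<xi> = \<pi> (f b) \<xi>" for a b
    using inj[OF that(1,2)] f'(1)[OF that(1)] f'(1)[OF that(2)] that(3) \<pi>' by blast
  then show ?thesis
    unfolding faithful_rep_def by (intro conjI ballI allI impI) (simp_all add: f' \<pi>')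
qed

abbreviation tsum :: "'c cstar \<Rightarrow> ('a \<Rightarrow> 'b \<Rightarrow> 'c) \<Rightarrow> nat \<Rightarrow> (nat \<Rightarrow> 'a) \<Rightarrow> (nat \<Rightarrow> 'b) \<Rightarrow> 'c" where
  "tsum C \<tau> n a b \<equiv> (\<Oplus>\<^bsub>C\<^esub>k\<in>{..<n}. \<tau> (a k) (b k))"

text \<open>The algebraic clauses of \<open>min_tensor\<close> alone. They also hold for
  \<open>\<lambda>a b. \<tau>' (f a) (g b)\<close>, whose sums need not be dense in the
  target.\<close>

definition tensor_like :: "'a cstar \<Rightarrow> 'b cstar \<Rightarrow> 'c cstar \<Rightarrow> ('a \<Rightarrow> 'b \<Rightarrow> 'c) \<Rightarrow> bool" where
  "tensor_like A B C \<tau> \<longleftrightarrow>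
    (\<forall>a\<in>carrier A. \<forall>b\<in>carrier B. \<tau> a b \<in> carrier C) \<and>
    (\<forall>a\<in>carrier A. \<forall>a'\<in>carrier A. \<forall>b\<in>carrier B. \<tau> (a \<oplus>\<^bsub>A\<^esub> a') b = \<tau> a b \<oplus>\<^bsub>C\<^esub> \<tau> a' b) \<and>
    (\<forall>a\<in>carrier A. \<forall>b\<in>carrier B. \<forall>b'\<in>carrier B. \<tau> a (b \<oplus>\<^bsub>B\<^esub> b') = \<tau> a b \<oplus>\<^bsub>C\<^esub> \<tau> a b') \<and>
    (\<forall>a\<in>carrier A. \<forall>b\<in>carrier B. \<forall>c.
      \<tau> (c \<odot>\<^bsub>A\<^esub> a) b = c \<odot>\<^bsub>C\<^esub> \<tau> a b \<and> \<tau> a (c \<odot>\<^bsub>B\<^esub> b) = c \<odot>\<^bsub>C\<^esub> \<tau> a b) \<and>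
    (\<forall>a\<in>carrier A. \<forall>a'\<in>carrier A. \<forall>b\<in>carrier B. \<forall>b'\<in>carrier B.
      \<tau> a b \<otimes>\<^bsub>C\<^esub> \<tau> a' b' = \<tau> (a \<otimes>\<^bsub>A\<^esub> a') (b \<otimes>\<^bsub>B\<^esub> b')) \<and>
    (\<forall>a\<in>carrier A. \<forall>b\<in>carrier B. star C (\<tau> a b) = \<tau> (star A a) (star B b))"

lemma tensor_likeD:
  assumes "tensor_like A B C \<tau>"
  shows "\<lbrakk>a \<in> carrier A; b \<in> carrier B\<rbrakk> \<Longrightarrow> \<tau> a b \<in> carrier C"
    "\<lbrakk>a \<in> carrier A; a' \<in> carrier A; b \<in> carrier B\<rbrakk> \<Longrightarrow> \<tau> (a \<oplus>\<^bsub>A\<^esub> a') b = \<tau> a b \<oplus>\<^bsub>C\<^esub> \<tau> a' b"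
    "\<lbrakk>a \<in> carrier A; b \<in> carrier B; b' \<in> carrier B\<rbrakk> \<Longrightarrow> \<tau> a (b \<oplus>\<^bsub>B\<^esub> b') = \<tau> a b \<oplus>\<^bsub>C\<^esub> \<tau> a b'"
    "\<lbrakk>a \<in> carrier A; b \<in> carrier B\<rbrakk> \<Longrightarrow> \<tau> (c \<odot>\<^bsub>A\<^esub> a) b = c \<odot>\<^bsub>C\<^esub> \<tau> a b"
    "\<lbrakk>a \<in> carrier A; b \<in> carrier B\<rbrakk> \<Longrightarrow> \<tau> a (c \<odot>\<^bsub>B\<^esub> b) = c \<odot>\<^bsub>C\<^esub> \<tau> a b"
    "\<lbrakk>a \<in> carrier A; a' \<in> carrier A; b \<in> carrier B; b' \<in> carrier B\<rbrakk>
      \<Longrightarrow> \<tau> a b \<otimes>\<^bsub>C\<^esub> \<tau> a' b' = \<tau> (a \<otimes>\<^bsub>A\<^esub> a') (b \<otimes>\<^bsub>B\<^esub> b')"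
    "\<lbrakk>a \<in> carrier A; b \<in> carrier B\<rbrakk> \<Longrightarrow> star C (\<tau> a b) = \<tau> (star A a) (star B b)"
  using assms unfolding tensor_like_def by simp_all

lemma tensor_like_comp:
  assumes "tensor_like A' B' C' \<tau>'" "star_hom A A' f" "star_hom B B' g"
  shows "tensor_like A B C' (\<lambda>a b. \<tau>' (f a) (g b))"
  unfolding tensor_like_def
  by (simp add: tensor_likeD[OF assms(1)] star_homD[OF assms(2)] star_homD[OF assms(3)])

section \<open>Norms of elementary tensors and of their sums\<close>

locale minimal_tensor =
  fixes A :: "'a cstar" and B :: "'b cstar" and C :: "'c cstar" and \<tau> :: "'a \<Rightarrow> 'b \<Rightarrow> 'c"
  assumes min_tensor: "min_tensor A B C \<tau>"
begin

lemma cstar_A: "cstar_algebra A" and cstar_B: "cstar_algebra B" and cstar_C: "cstar_algebra C"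
  using min_tensor by (simp_all add: min_tensor_def)

lemma like: "tensor_like A B C \<tau>"
  using min_tensor by (simp add: min_tensor_def tensor_like_def)

lemmas \<tau> = tensor_likeD[OF like]

sublocale A: cstar_algebra A by (rule cstar_A)
sublocale B: cstar_algebra B by (rule cstar_B)
sublocale C: cstar_algebra C by (rule cstar_C)

lemma dense:
  assumes "x \<in> carrier C" "0 < \<epsilon>"
  obtains n :: nat and a b where "\<And>k. k < n \<Longrightarrow> a k \<in> carrier A" "\<And>k. k < n \<Longrightarrow> b k \<in> carrier B"
    "nrm C (x \<ominus>\<^bsub>C\<^esub> (tsum C \<tau> n a b)) < \<epsilon>"
proof -
  have "\<forall>x\<in>carrier C. \<forall>\<epsilon>>0. \<exists>(n::nat) a b. (\<forall>k<n. a k \<in> carrier A \<and> b k \<in> carrier B) \<and>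
      nrm C (x \<ominus>\<^bsub>C\<^esub> (tsum C \<tau> n a b)) < \<epsilon>"
    using min_tensor unfolding min_tensor_def by (elim conjE) assumption
  then show ?thesis using assms that by blast
qed

lemma obtain_reps:
  obtains \<pi> :: "'a \<Rightarrow> ('a \<Rightarrow> complex) \<Rightarrow> 'a \<Rightarrow> complex" and \<rho> :: "'b \<Rightarrow> ('b \<Rightarrow> complex) \<Rightarrow> 'b \<Rightarrow> complex"
  where "faithful_rep A \<pi>" "faithful_rep B \<rho>"
  using min_tensor unfolding min_tensor_def by (elim conjE exE) rule

text \<open>\<open>min_tensor\<close> supplies the norm formula for one pair of representations on
  fixed index types; independence of the representations extends it to every pair, on arbitrary
  index types.\<close>

lemma nrm_sum:
  assumes \<pi>: "faithful_rep A \<pi>" and \<rho>: "faithful_rep B \<rho>"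
    and a: "\<And>k. k < n \<Longrightarrow> a k \<in> carrier A" and b: "\<And>k. k < n \<Longrightarrow> b k \<in> carrier B"
  shows "nrm C (tsum C \<tau> n a b) = op_norm (spatial_op n (\<lambda>k. \<pi> (a k)) (\<lambda>k. \<rho> (b k)))"
proof -
  have "\<exists>(\<pi> :: 'a \<Rightarrow> ('a \<Rightarrow> complex) \<Rightarrow> 'a \<Rightarrow> complex) (\<rho> :: 'b \<Rightarrow> ('b \<Rightarrow> complex) \<Rightarrow> 'b \<Rightarrow> complex).
      faithful_rep A \<pi> \<and> faithful_rep B \<rho> \<and>
      (\<forall>(n::nat) a b. (\<forall>k<n. a k \<in> carrier A \<and> b k \<in> carrier B) \<longrightarrow>
        nrm C (tsum C \<tau> n a b) = op_norm (spatial_op n (\<lambda>k. \<pi> (a k)) (\<lambda>k. \<rho> (b k))))"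
    using min_tensor unfolding min_tensor_def by (elim conjE) assumption
  then obtain \<pi>' :: "'a \<Rightarrow> ('a \<Rightarrow> complex) \<Rightarrow> 'a \<Rightarrow> complex" and \<rho>' :: "'b \<Rightarrow> ('b \<Rightarrow> complex) \<Rightarrow> 'b \<Rightarrow> complex"
    where r: "faithful_rep A \<pi>'" "faithful_rep B \<rho>'"
      and eq: "\<forall>(n::nat) a b. (\<forall>k<n. a k \<in> carrier A \<and> b k \<in> carrier B) \<longrightarrow>
        nrm C (tsum C \<tau> n a b) = op_norm (spatial_op n (\<lambda>k. \<pi>' (a k)) (\<lambda>k. \<rho>' (b k)))"
    by (elim exE conjE)
  have "nrm C (tsum C \<tau> n a b) = op_norm (spatial_op n (\<lambda>k. \<pi>' (a k)) (\<lambda>k. \<rho>' (b k)))"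
    using eq a b by blast
  also have "\<dots> = op_norm (spatial_op n (\<lambda>k. \<pi> (a k)) (\<lambda>k. \<rho> (b k)))"
    by (rule op_norm_spatial_op_indep[of A _ _ B, OF _ _ _ _ a b])
      (auto intro!: cstar_rep.intro cstar_rep_axioms.intro cstar_A cstar_B r \<pi> \<rho>)
  finally show ?thesis .
qed

lemma nrm_tensor:
  assumes "faithful_rep A \<pi>" "faithful_rep B \<rho>" and a: "a \<in> carrier A" and b: "b \<in> carrier B"
  shows "nrm C (\<tau> a b) = op_norm (op_tensor (\<pi> a) (\<rho> b))"
  using nrm_sum[OF assms(1,2), of 1 "\<lambda>_. a" "\<lambda>_. b"] a b \<tau>(1) by (simp add: lessThan_Suc)

lemma nrm_tensor_le:
  assumes a: "a \<in> carrier A" and b: "b \<in> carrier B"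
  shows "nrm C (\<tau> a b) \<le> nrm A a * nrm B b"
proof -
  obtain \<pi> :: "'a \<Rightarrow> ('a \<Rightarrow> complex) \<Rightarrow> 'a \<Rightarrow> complex" and \<rho> :: "'b \<Rightarrow> ('b \<Rightarrow> complex) \<Rightarrow> 'b \<Rightarrow> complex"
    where r: "faithful_rep A \<pi>" "faithful_rep B \<rho>" by (rule obtain_reps)
  interpret \<pi>: cstar_rep A \<pi> by (unfold_locales) (rule r)
  interpret \<rho>: cstar_rep B \<rho> by (unfold_locales) (rule r)
  have "op_norm (op_tensor (\<pi> a) (\<rho> b)) \<le> nrm A a * nrm B b"
    using op_tensor_bound(2)[OF \<pi>.rep_bounded[OF a] \<rho>.rep_bounded[OF b]] a b A.nrm_nonneg B.nrm_nonneg
    by (intro op_norm_le) (simp_all add: \<pi>.op_norm_rep \<rho>.op_norm_rep)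
  then show ?thesis by (simp add: nrm_tensor[OF r a b])
qed

text \<open>On the product vector of \<open>\<xi>\<close> and \<open>\<eta>\<close> the operator
  takes the value \<open>\<rho> b \<eta> j * \<pi> a \<xi> i\<close> at the point (i, j). With
  \<open>\<xi>\<close> and \<open>i\<close> chosen so that the second factor is non-zero,
  \<open>\<rho> b\<close> must vanish. This makes tensoring with a non-zero unit injective.\<close>

lemma tensor_eq_zero:
  assumes a: "a \<in> carrier A" "a \<noteq> \<zero>\<^bsub>A\<^esub>" and b: "b \<in> carrier B" and 0: "\<tau> a b = \<zero>\<^bsub>C\<^esub>"
  shows "b = \<zero>\<^bsub>B\<^esub>"
proof -
  obtain \<pi> :: "'a \<Rightarrow> ('a \<Rightarrow> complex) \<Rightarrow> 'a \<Rightarrow> complex" and \<rho> :: "'b \<Rightarrow> ('b \<Rightarrow> complex) \<Rightarrow> 'b \<Rightarrow> complex"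
    where r: "faithful_rep A \<pi>" "faithful_rep B \<rho>" by (rule obtain_reps)
  interpret \<pi>: cstar_rep A \<pi> by (unfold_locales) (rule r)
  interpret \<rho>: cstar_rep B \<rho> by (unfold_locales) (rule r)
  note S = \<pi>.rep_bounded[OF a(1)] and R = \<rho>.rep_bounded[OF b]
  have n0: "op_norm (op_tensor (\<pi> a) (\<rho> b)) = 0" using nrm_tensor[OF r a(1) b] 0 C.nrm_zero by simp
  obtain \<xi> i where \<xi>: "\<xi> \<in> ell2" and ne: "\<pi> a \<xi> i \<noteq> 0"
    using \<pi>.rep_inj[OF a(1) A.zero_closed] a(2) \<pi>.rep_zero by fastforce
  have "\<rho> b \<eta> = \<rho> \<zero>\<^bsub>B\<^esub> \<eta>" if \<eta>: "\<eta> \<in> ell2" for \<eta>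
  proof
    fix j
    define \<zeta> where "\<zeta> = (\<lambda>(i, j). \<xi> i * \<eta> j)"
    have "(\<lambda>i. (ell2_norm (\<lambda>j. \<xi> i * \<eta> j))\<^sup>2) summable_on UNIV"
      using \<xi> summable_on_cmult_left[of "\<lambda>i. (cmod (\<xi> i))\<^sup>2" UNIV "(ell2_norm \<eta>)\<^sup>2"]
      by (simp add: ell2_scale[OF \<eta>] power_mult_distrib ell2_def)
    then have \<zeta>: "\<zeta> \<in> ell2" using ell2_of_rows[of \<zeta>] ell2_scale(1)[OF \<eta>] by (simp add: \<zeta>_def)
    have "ell2_norm (op_tensor (\<pi> a) (\<rho> b) \<zeta>) = 0"
      using op_norm_bound[OF bounded_op_tensor[OF S R] \<zeta>] n0 ell2_norm_nonneg by (metis mult_zero_left antisym)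
    then have "op_tensor (\<pi> a) (\<rho> b) \<zeta> (i, j) = 0"
      using ell2_norm_eq_0[OF op_tensor_bound(1)[OF S R \<zeta>]] by simp
    moreover have "op_tensor (\<pi> a) (\<rho> b) \<zeta> (i, j) = \<rho> b \<eta> j * \<pi> a \<xi> i"
    proof -
      have "op_tensor (\<pi> a) (\<rho> b) \<zeta> (i, j) = \<pi> a (\<lambda>i'. \<xi> i' * \<rho> b \<eta> j) i"
        by (simp add: op_tensor_def \<zeta>_def bounded_op_scale[OF R \<eta>])
      also have "(\<lambda>i'. \<xi> i' * \<rho> b \<eta> j) = (\<lambda>i'. \<rho> b \<eta> j * \<xi> i')" by (simp add: mult.commute)
      finally show ?thesis by (simp only: bounded_op_scale[OF S \<xi>])
    qed
    ultimately show "\<rho> b \<eta> j = \<rho> \<zero>\<^bsub>B\<^esub> \<eta> j" using ne \<rho>.rep_zero[OF \<eta>] by simp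
  qed
  then show ?thesis by (rule \<rho>.rep_inj[OF b B.zero_closed])
qed

end

lemma min_tensor_swap_zero:
  assumes "min_tensor A B C \<tau>" and a: "a \<in> carrier A" and b: "b \<in> carrier B" "b \<noteq> \<zero>\<^bsub>B\<^esub>" and 0: "\<tau> a b = \<zero>\<^bsub>C\<^esub>"
  shows "a = \<zero>\<^bsub>A\<^esub>"
proof -
  interpret minimal_tensor A B C \<tau> by unfold_locales fact
  show ?thesis using tensor_eq_zero[OF a _ b(1) 0] b(2) by blast
qed

text \<open>An element can be a sum of elementary tensors in many ways, so the assignment sending
  \<open>\<tau> a b\<close> to \<open>\<sigma> a b\<close> is first an additive relation. That it is
  a function comes later, from equality of norms.\<close>

inductive tensor_graph ::
    "'a cstar \<Rightarrow> 'b cstar \<Rightarrow> 'c cstar \<Rightarrow> 'd cstar \<Rightarrow> ('a \<Rightarrow> 'b \<Rightarrow> 'c) \<Rightarrow> ('a \<Rightarrow> 'b \<Rightarrow> 'd) \<Rightarrow> 'c \<Rightarrow> 'd \<Rightarrow> bool"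
  for A B C D \<tau> \<sigma> where
  zero: "tensor_graph A B C D \<tau> \<sigma> \<zero>\<^bsub>C\<^esub> \<zero>\<^bsub>D\<^esub>"
| step: "\<lbrakk>tensor_graph A B C D \<tau> \<sigma> x y; a \<in> carrier A; b \<in> carrier B\<rbrakk>
    \<Longrightarrow> tensor_graph A B C D \<tau> \<sigma> (x \<oplus>\<^bsub>C\<^esub> \<tau> a b) (y \<oplus>\<^bsub>D\<^esub> \<sigma> a b)"

locale isometric_extension = minimal_tensor A B C \<tau> + D: cstar_algebra D
  for A :: "'a cstar" and B :: "'b cstar" and C :: "'c cstar" and \<tau> and D :: "'d cstar" +
  fixes \<sigma> :: "'a \<Rightarrow> 'b \<Rightarrow> 'd"
  assumes like_\<sigma>: "tensor_like A B D \<sigma>"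
    and nrm_eq: "\<And>n a b. \<lbrakk>\<And>k. k < n \<Longrightarrow> a k \<in> carrier A; \<And>k. k < n \<Longrightarrow> b k \<in> carrier B\<rbrakk>
      \<Longrightarrow> nrm C (tsum C \<tau> n a b) = nrm D (tsum D \<sigma> n a b)"
begin

lemmas \<sigma> = tensor_likeD[OF like_\<sigma>]

abbreviation "G \<equiv> tensor_graph A B C D \<tau> \<sigma>"

lemma G_closed: "G x y \<Longrightarrow> x \<in> carrier C \<and> y \<in> carrier D"
  by (induction rule: tensor_graph.induct) (simp_all add: \<tau> \<sigma>)

lemma G_add: assumes "G x' y'" "G x y" shows "G (x \<oplus>\<^bsub>C\<^esub> x') (y \<oplus>\<^bsub>D\<^esub> y')"
  using assms
proof (induction rule: tensor_graph.induct)
  case (step x' y' a b)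
  have "G ((x \<oplus>\<^bsub>C\<^esub> x') \<oplus>\<^bsub>C\<^esub> \<tau> a b) ((y \<oplus>\<^bsub>D\<^esub> y') \<oplus>\<^bsub>D\<^esub> \<sigma> a b)"
    using step by (intro tensor_graph.step) auto
  then show ?case using step G_closed[OF step(1)] G_closed[OF step(5)] by (simp add: \<tau> \<sigma> C.a_assoc D.a_assoc)
qed (use G_closed[of x y] in simp)

lemma G_tensor: "\<lbrakk>a \<in> carrier A; b \<in> carrier B\<rbrakk> \<Longrightarrow> G (\<tau> a b) (\<sigma> a b)"
  using tensor_graph.step[OF tensor_graph.zero, of a A b B C D \<tau> \<sigma>] by (simp add: \<tau> \<sigma>)

lemma G_smult: "G x y \<Longrightarrow> G (c \<odot>\<^bsub>C\<^esub> x) (c \<odot>\<^bsub>D\<^esub> y)"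
proof (induction rule: tensor_graph.induct)
  case (step x y a b)
  have "G (c \<odot>\<^bsub>C\<^esub> x \<oplus>\<^bsub>C\<^esub> \<tau> (c \<odot>\<^bsub>A\<^esub> a) b) (c \<odot>\<^bsub>D\<^esub> y \<oplus>\<^bsub>D\<^esub> \<sigma> (c \<odot>\<^bsub>A\<^esub> a) b)"
    using step by (intro tensor_graph.step) (simp_all add: A.closed)
  then show ?case using step G_closed[OF step(1)] by (simp add: \<tau> \<sigma> C.smult_add_right D.smult_add_right)
qed (simp add: C.smult_zero_right D.smult_zero_right tensor_graph.zero)

lemma G_star: "G x y \<Longrightarrow> G (star C x) (star D y)"
proof (induction rule: tensor_graph.induct)
  case (step x y a b)
  have "G (star C x \<oplus>\<^bsub>C\<^esub> \<tau> (star A a) (star B b)) (star D y \<oplus>\<^bsub>D\<^esub> \<sigma> (star A a) (star B b))"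
    using step by (intro tensor_graph.step) (simp_all add: A.closed B.closed)
  then show ?case using step G_closed[OF step(1)] by (simp add: \<tau> \<sigma> C.star_add D.star_add)
qed (simp add: C.star_zero D.star_zero tensor_graph.zero)

lemma G_mult_tensor:
  assumes "G x y" and ab: "a \<in> carrier A" "b \<in> carrier B"
  shows "G (x \<otimes>\<^bsub>C\<^esub> \<tau> a b) (y \<otimes>\<^bsub>D\<^esub> \<sigma> a b)"
  using assms(1)
proof (induction rule: tensor_graph.induct)
  case zero
  show ?case using ab by (simp add: C.mult_zero D.mult_zero \<tau> \<sigma> tensor_graph.zero)
next
  case (step x y a' b')
  have "G (x \<otimes>\<^bsub>C\<^esub> \<tau> a b \<oplus>\<^bsub>C\<^esub> \<tau> (a' \<otimes>\<^bsub>A\<^esub> a) (b' \<otimes>\<^bsub>B\<^esub> b)) (y \<otimes>\<^bsub>D\<^esub> \<sigma> a b \<oplus>\<^bsub>D\<^esub> \<sigma> (a' \<otimes>\<^bsub>A\<^esub> a) (b' \<otimes>\<^bsub>B\<^esub> b))"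
    using step ab by (intro tensor_graph.step) (simp_all add: A.closed B.closed)
  then show ?case using step ab G_closed[OF step(1)] by (simp add: \<tau> \<sigma> C.mult_add_left D.mult_add_left)
qed

lemma G_mult: assumes "G x' y'" "G x y" shows "G (x \<otimes>\<^bsub>C\<^esub> x') (y \<otimes>\<^bsub>D\<^esub> y')"
  using assms
proof (induction rule: tensor_graph.induct)
  case zero
  then show ?case using G_closed[OF zero] by (simp add: C.mult_zero D.mult_zero tensor_graph.zero)
next
  case (step x' y' a b)
  have "G (x \<otimes>\<^bsub>C\<^esub> x' \<oplus>\<^bsub>C\<^esub> x \<otimes>\<^bsub>C\<^esub> \<tau> a b) (y \<otimes>\<^bsub>D\<^esub> y' \<oplus>\<^bsub>D\<^esub> y \<otimes>\<^bsub>D\<^esub> \<sigma> a b)"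
    using step by (intro G_add G_mult_tensor) auto
  then show ?case using step G_closed[OF step(1)] G_closed[OF step(5)] by (simp add: \<tau> \<sigma> C.mult_add_right D.mult_add_right)
qed

lemma G_diff: assumes "G x y" "G x' y'" shows "G (x \<ominus>\<^bsub>C\<^esub> x') (y \<ominus>\<^bsub>D\<^esub> y')"
  using G_add[OF G_smult[OF assms(2), of "-1"] assms(1)] G_closed[OF assms(1)] G_closed[OF assms(2)]
  by (simp add: C.minus_eq_smult D.minus_eq_smult)

text \<open>The inductive form suits the closure proofs above, the indexed form is the one in which
  \<open>nrm_eq\<close> and \<open>dense\<close> speak. A further summand is stored at index
  \<open>n\<close> by updating both families there.\<close>

lemma G_sum_iff: "G x y \<longleftrightarrow> (\<exists>(n::nat) a b. (\<forall>k<n. a k \<in> carrier A \<and> b k \<in> carrier B) \<and>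
  x = tsum C \<tau> n a b \<and> y = tsum D \<sigma> n a b)"
  (is "_ \<longleftrightarrow> ?R x y")
proof
  assume "G x y"
  then show "?R x y"
  proof (induction rule: tensor_graph.induct)
    case zero
    show ?case by (rule exI[of _ 0]) simp
  next
    case (step x y a0 b0)
    then obtain n :: nat and a b where n: "\<And>k. k < n \<Longrightarrow> a k \<in> carrier A" "\<And>k. k < n \<Longrightarrow> b k \<in> carrier B"
      and xy: "x = tsum C \<tau> n a b" "y = tsum D \<sigma> n a b" by blast
    let ?a = "a(n := a0)" and ?b = "b(n := b0)"
    have "(\<Oplus>\<^bsub>C\<^esub>k\<in>{..<Suc n}. \<tau> (?a k) (?b k)) = \<tau> a0 b0 \<oplus>\<^bsub>C\<^esub> (\<Oplus>\<^bsub>C\<^esub>k\<in>{..<n}. \<tau> (?a k) (?b k))"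
      unfolding lessThan_Suc using n step(2,3) by (subst C.finsum_insert) (auto simp: \<tau>)
    also have "(\<Oplus>\<^bsub>C\<^esub>k\<in>{..<n}. \<tau> (?a k) (?b k)) = x"
      unfolding xy using n by (intro C.finsum_cong') (auto simp: \<tau>)
    finally have "x \<oplus>\<^bsub>C\<^esub> \<tau> a0 b0 = (\<Oplus>\<^bsub>C\<^esub>k\<in>{..<Suc n}. \<tau> (?a k) (?b k))"
      using G_closed[OF step(1)] step(2,3) by (simp add: \<tau> C.a_comm)
    moreover have "(\<Oplus>\<^bsub>D\<^esub>k\<in>{..<Suc n}. \<sigma> (?a k) (?b k)) = \<sigma> a0 b0 \<oplus>\<^bsub>D\<^esub> (\<Oplus>\<^bsub>D\<^esub>k\<in>{..<n}. \<sigma> (?a k) (?b k))"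
      unfolding lessThan_Suc using n step(2,3) by (subst D.finsum_insert) (auto simp: \<sigma>)
    moreover have "(\<Oplus>\<^bsub>D\<^esub>k\<in>{..<n}. \<sigma> (?a k) (?b k)) = y"
      unfolding xy using n by (intro D.finsum_cong') (auto simp: \<sigma>)
    ultimately show ?case
      using n step(2,3) G_closed[OF step(1)]
      by (intro exI[of _ "Suc n"] exI[of _ ?a] exI[of _ ?b]) (simp add: \<sigma> D.a_comm less_Suc_eq)
  qed
next
  assume "?R x y"
  then obtain n :: nat and a b where n: "\<And>k. k < n \<Longrightarrow> a k \<in> carrier A" "\<And>k. k < n \<Longrightarrow> b k \<in> carrier B"
    and xy: "x = tsum C \<tau> n a b" "y = tsum D \<sigma> n a b" by blast
  show "G x y" unfolding xy using n
  proof (induction n)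
    case (Suc n)
    have "G ((tsum C \<tau> n a b) \<oplus>\<^bsub>C\<^esub> \<tau> (a n) (b n)) ((tsum D \<sigma> n a b) \<oplus>\<^bsub>D\<^esub> \<sigma> (a n) (b n))"
      using Suc by (intro tensor_graph.step) auto
    moreover have "(tsum C \<tau> (Suc n) a b) = \<tau> (a n) (b n) \<oplus>\<^bsub>C\<^esub> (tsum C \<tau> n a b)"
      unfolding lessThan_Suc using Suc.prems by (subst C.finsum_insert) (auto simp: \<tau>)
    moreover have "(tsum D \<sigma> (Suc n) a b) = \<sigma> (a n) (b n) \<oplus>\<^bsub>D\<^esub> (tsum D \<sigma> n a b)"
      unfolding lessThan_Suc using Suc.prems by (subst D.finsum_insert) (auto simp: \<sigma>)
    moreover have "(tsum C \<tau> n a b) \<in> carrier C" "(tsum D \<sigma> n a b) \<in> carrier D"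
      using Suc.prems by (auto intro!: C.finsum_closed D.finsum_closed simp: \<tau> \<sigma>)
    ultimately show ?case using Suc.prems by (simp add: \<tau> \<sigma> C.a_comm D.a_comm)
  qed (simp add: tensor_graph.zero)
qed

lemma G_nrm: "G x y \<Longrightarrow> nrm C x = nrm D y"
  using nrm_eq unfolding G_sum_iff by blast

text \<open>The closure of the graph: pairs of limits of pairs of sums. Working with relations up to
  this point avoids choosing a value before it is known to be unique.\<close>

definition graph_lim :: "'c \<Rightarrow> 'd \<Rightarrow> bool" where
  "graph_lim x y \<longleftrightarrow> (\<exists>X Y. (\<forall>n. G (X n) (Y n)) \<and> C.tends X x \<and> D.tends Y y)"

lemma graph_lim_nrm: assumes "graph_lim x y" shows "nrm C x = nrm D y"
proof -
  obtain X Y where XY: "\<And>n. G (X n) (Y n)" "C.tends X x" "D.tends Y y" using assms by (auto simp: graph_lim_def)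
  then show ?thesis using LIMSEQ_unique[OF C.tends_nrm[OF XY(2)]] D.tends_nrm[OF XY(3)] G_nrm[OF XY(1)] by simp
qed

lemma graph_lim_closed: "graph_lim x y \<Longrightarrow> x \<in> carrier C \<and> y \<in> carrier D"
  by (auto simp: graph_lim_def C.tends_def D.tends_def)

lemma graph_limI: "G x y \<Longrightarrow> graph_lim x y"
  unfolding graph_lim_def using G_closed[of x y]
  by (intro exI[of _ "\<lambda>_. x"] exI[of _ "\<lambda>_. y"]) (simp add: C.tends_const D.tends_const)

lemma graph_lim_add:
  assumes "graph_lim x y" "graph_lim x' y'"
  shows "graph_lim (x \<oplus>\<^bsub>C\<^esub> x') (y \<oplus>\<^bsub>D\<^esub> y')"
proof -
  obtain X Y X' Y' where "\<And>n. G (X n) (Y n)" "C.tends X x" "D.tends Y y"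
    "\<And>n. G (X' n) (Y' n)" "C.tends X' x'" "D.tends Y' y'"
    using assms by (auto simp: graph_lim_def)
  then show ?thesis unfolding graph_lim_def
    by (intro exI[of _ "\<lambda>n. X n \<oplus>\<^bsub>C\<^esub> X' n"] exI[of _ "\<lambda>n. Y n \<oplus>\<^bsub>D\<^esub> Y' n"])
      (simp add: G_add C.tends_add D.tends_add)
qed

lemma graph_lim_mult:
  assumes "graph_lim x y" "graph_lim x' y'"
  shows "graph_lim (x \<otimes>\<^bsub>C\<^esub> x') (y \<otimes>\<^bsub>D\<^esub> y')"
proof -
  obtain X Y X' Y' where "\<And>n. G (X n) (Y n)" "C.tends X x" "D.tends Y y"
    "\<And>n. G (X' n) (Y' n)" "C.tends X' x'" "D.tends Y' y'"
    using assms by (auto simp: graph_lim_def)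
  then show ?thesis unfolding graph_lim_def
    by (intro exI[of _ "\<lambda>n. X n \<otimes>\<^bsub>C\<^esub> X' n"] exI[of _ "\<lambda>n. Y n \<otimes>\<^bsub>D\<^esub> Y' n"])
      (simp add: G_mult C.tends_mult D.tends_mult)
qed

lemma graph_lim_smult:
  assumes "graph_lim x y"
  shows "graph_lim (c \<odot>\<^bsub>C\<^esub> x) (c \<odot>\<^bsub>D\<^esub> y)"
proof -
  obtain X Y where "\<And>n. G (X n) (Y n)" "C.tends X x" "D.tends Y y"
    using assms by (auto simp: graph_lim_def)
  then show ?thesis unfolding graph_lim_def
    by (intro exI[of _ "\<lambda>n. c \<odot>\<^bsub>C\<^esub> X n"] exI[of _ "\<lambda>n. c \<odot>\<^bsub>D\<^esub> Y n"])
      (simp add: G_smult C.tends_smult D.tends_smult)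
qed

lemma graph_lim_star:
  assumes "graph_lim x y"
  shows "graph_lim (star C x) (star D y)"
proof -
  obtain X Y where "\<And>n. G (X n) (Y n)" "C.tends X x" "D.tends Y y"
    using assms by (auto simp: graph_lim_def)
  then show ?thesis unfolding graph_lim_def
    by (intro exI[of _ "\<lambda>n. star C (X n)"] exI[of _ "\<lambda>n. star D (Y n)"])
      (simp add: G_star C.tends_star D.tends_star)
qed

lemma graph_lim_diff: "\<lbrakk>graph_lim x y; graph_lim x' y'\<rbrakk> \<Longrightarrow> graph_lim (x \<ominus>\<^bsub>C\<^esub> x') (y \<ominus>\<^bsub>D\<^esub> y')"
  using graph_lim_add[of x y, OF _ graph_lim_smult[of x' y' "-1"]] graph_lim_closed
  by (simp add: C.minus_eq_smult D.minus_eq_smult)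

text \<open>The difference of two pairs lies in the closed graph again, and equal norms let its
  components vanish only together. One direction is single-valuedness, the other
  injectivity.\<close>

lemma graph_lim_inj: "\<lbrakk>graph_lim x y; graph_lim x' y'\<rbrakk> \<Longrightarrow> x = x' \<longleftrightarrow> y = y'"
  using graph_lim_nrm[OF graph_lim_diff, of x y x' y'] graph_lim_closed C.nrm_diff_eq_0 D.nrm_diff_eq_0 by metis

text \<open>Density provides sums approaching \<open>x\<close>; equality of norms makes their
  partners a Cauchy sequence, and \<open>D\<close> is complete.\<close>

lemma graph_lim_total: assumes x: "x \<in> carrier C" shows "\<exists>y. graph_lim x y"
proof -
  have "\<exists>x' y'. G x' y' \<and> nrm C (x' \<ominus>\<^bsub>C\<^esub> x) < 1 / real (Suc n)" for n
  proof -
    obtain m :: nat and a b where m: "\<And>k. k < m \<Longrightarrow> a k \<in> carrier A" "\<And>k. k < m \<Longrightarrow> b k \<in> carrier B"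
      and lt: "nrm C (x \<ominus>\<^bsub>C\<^esub> (tsum C \<tau> m a b)) < 1 / real (Suc n)"
      using dense[OF x, of "1 / real (Suc n)"] by auto
    have "G (tsum C \<tau> m a b) (tsum D \<sigma> m a b)" using m unfolding G_sum_iff by blast
    then show ?thesis using lt C.nrm_diff_comm[OF x] G_closed by metis
  qed
  then obtain X Y where G: "\<And>n. G (X n) (Y n)" and lt: "\<And>n. nrm C (X n \<ominus>\<^bsub>C\<^esub> x) < 1 / real (Suc n)" by metis
  note Xc = conjunct1[OF G_closed[OF G]] and Yc = conjunct2[OF G_closed[OF G]]
  have X: "C.tends X x"
    by (rule C.tendsI[of X x "\<lambda>n. 1 / real (Suc n)"])
      (use Xc x lt LIMSEQ_inverse_real_of_nat in \<open>auto intro: less_imp_le simp: divide_inverse\<close>)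
  have "\<exists>y\<in>carrier D. (\<lambda>n. nrm D (Y n \<ominus>\<^bsub>D\<^esub> y)) \<longlonglongrightarrow> 0"
  proof (rule D.complete)
    show "\<forall>n. Y n \<in> carrier D" using Yc by blast
    show "\<forall>\<epsilon>>0. \<exists>N. \<forall>m\<ge>N. \<forall>n\<ge>N. nrm D (Y m \<ominus>\<^bsub>D\<^esub> Y n) < \<epsilon>"
    proof (intro allI impI)
      fix \<epsilon> :: real assume e: "0 < \<epsilon>"
      obtain N where N: "\<And>n. n \<ge> N \<Longrightarrow> nrm C (X n \<ominus>\<^bsub>C\<^esub> x) < \<epsilon> / 2"
        using order_tendstoD(2)[OF C.tendsD(3)[OF X], of "\<epsilon> / 2"] e by (auto simp: eventually_sequentially)
      have "nrm D (Y m \<ominus>\<^bsub>D\<^esub> Y n) < \<epsilon>" if "m \<ge> N" "n \<ge> N" for m n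
        using G_nrm[OF G_diff[OF G[of m] G[of n]]] C.nrm_diff_triangle[OF Xc[of m] x Xc[of n]]
          C.nrm_diff_comm[OF x Xc[of n]] N[OF that(1)] N[OF that(2)] by simp
      then show "\<exists>N. \<forall>m\<ge>N. \<forall>n\<ge>N. nrm D (Y m \<ominus>\<^bsub>D\<^esub> Y n) < \<epsilon>" by blast
    qed
  qed
  then obtain y where "D.tends Y y" using Yc by (auto simp: D.tends_def)
  then show ?thesis using G X unfolding graph_lim_def by blast
qed

lemma ex_extension: "\<exists>\<Phi>. star_mono C D \<Phi> \<and> (\<forall>a\<in>carrier A. \<forall>b\<in>carrier B. \<Phi> (\<tau> a b) = \<sigma> a b)"
proof -
  obtain \<Phi> where \<Phi>: "\<And>x. x \<in> carrier C \<Longrightarrow> graph_lim x (\<Phi> x)" using graph_lim_total by metis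
  have eq: "\<Phi> x = y" if "graph_lim x y" for x y
    using graph_lim_inj[OF that \<Phi>] graph_lim_closed[OF that] by blast
  have "star_hom C D \<Phi>"
    using \<Phi> graph_lim_closed
    by (intro star_homI eq graph_lim_add graph_lim_mult graph_lim_smult graph_lim_star) auto
  moreover have "inj_on \<Phi> (carrier C)" using graph_lim_inj[OF \<Phi> \<Phi>] by (auto simp: inj_on_def)
  ultimately show ?thesis using eq graph_limI G_tensor unfolding star_mono_def by blast
qed

end

text \<open>With faithful representations of \<open>A'\<close> and \<open>B'\<close> fixed and
  pulled back along \<open>f\<close> and \<open>g\<close>, a sum of elementary tensors and its image
  have literally the same spatial operator, hence the same norm.\<close>

lemma ex_tensor_map:
  fixes A' :: "'d cstar" and B' :: "'e cstar"
  assumes "min_tensor A B C \<tau>" "min_tensor A' B' C' \<tau>'" and f: "star_mono A A' f" and g: "star_mono B B' g"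
  shows "\<exists>\<Phi>. star_mono C C' \<Phi> \<and> (\<forall>a\<in>carrier A. \<forall>b\<in>carrier B. \<Phi> (\<tau> a b) = \<tau>' (f a) (g b))"
proof -
  interpret m: minimal_tensor A B C \<tau> by unfold_locales fact
  interpret m': minimal_tensor A' B' C' \<tau>' by unfold_locales fact
  note fc = star_monoD(3)[OF f] and gc = star_monoD(3)[OF g]
  interpret isometric_extension A B C \<tau> C' "\<lambda>a b. \<tau>' (f a) (g b)"
  proof unfold_locales
    show "tensor_like A B C' (\<lambda>a b. \<tau>' (f a) (g b))"
      by (rule tensor_like_comp[OF m'.like star_monoD(1)[OF f] star_monoD(1)[OF g]])
    fix n :: nat and a b
    assume ab: "\<And>k. k < n \<Longrightarrow> a k \<in> carrier A" "\<And>k. k < n \<Longrightarrow> b k \<in> carrier B"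
    obtain \<pi> :: "'d \<Rightarrow> ('d \<Rightarrow> complex) \<Rightarrow> 'd \<Rightarrow> complex" and \<rho> :: "'e \<Rightarrow> ('e \<Rightarrow> complex) \<Rightarrow> 'e \<Rightarrow> complex"
      where r: "faithful_rep A' \<pi>" "faithful_rep B' \<rho>" by (rule m'.obtain_reps)
    show "nrm C (tsum C \<tau> n a b) = nrm C' (\<Oplus>\<^bsub>C'\<^esub>k\<in>{..<n}. \<tau>' (f (a k)) (g (b k)))"
      using m.nrm_sum[OF faithful_rep_comp[OF r(1) f] faithful_rep_comp[OF r(2) g], of n a b]
        m'.nrm_sum[OF r, of n "\<lambda>k. f (a k)" "\<lambda>k. g (b k)"] ab fc gc by simp
  qed
  show ?thesis by (rule ex_extension)
qed

text \<open>This class contains the *-homomorphisms and also \<open>y \<mapsto> \<tau> a y\<close>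
  for fixed \<open>a\<close>, which is not multiplicative in general. Additivity and a norm bound
  suffice to pass from elementary tensors to all of a completed tensor product.\<close>

definition add_bounded :: "'c cstar \<Rightarrow> 'd cstar \<Rightarrow> ('c \<Rightarrow> 'd) \<Rightarrow> bool" where
  "add_bounded C E F \<longleftrightarrow> (\<forall>x\<in>carrier C. F x \<in> carrier E) \<and>
    (\<forall>x\<in>carrier C. \<forall>y\<in>carrier C. F (x \<oplus>\<^bsub>C\<^esub> y) = F x \<oplus>\<^bsub>E\<^esub> F y) \<and>
    (\<exists>K\<ge>0. \<forall>x\<in>carrier C. nrm E (F x) \<le> K * nrm C x)"

lemma star_hom_add_bounded:
  assumes "cstar_algebra A" "cstar_algebra B" "star_hom A B f"
  shows "add_bounded A B f"
  unfolding add_bounded_def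
  using star_homD[OF assms(3)] star_hom_contractive[OF assms] by (auto intro!: exI[of _ 1])

lemma add_bounded_bound:
  assumes "add_bounded C E F"
  obtains K where "0 \<le> K" "\<And>x. x \<in> carrier C \<Longrightarrow> nrm E (F x) \<le> K * nrm C x"
  using assms unfolding add_bounded_def by blast

lemma add_bounded_comp:
  assumes F: "add_bounded C D F" and H: "add_bounded D E H"
  shows "add_bounded C E (\<lambda>x. H (F x))"
proof -
  obtain K where K: "0 \<le> K" "\<And>x. x \<in> carrier C \<Longrightarrow> nrm D (F x) \<le> K * nrm C x"
    using add_bounded_bound[OF F] by blast
  obtain L where L: "0 \<le> L" "\<And>x. x \<in> carrier D \<Longrightarrow> nrm E (H x) \<le> L * nrm D x"
    using add_bounded_bound[OF H] by blast
  have "nrm E (H (F x)) \<le> L * K * nrm C x" if "x \<in> carrier C" for x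
    using L(2)[of "F x"] mult_left_mono[OF K(2)[OF that] L(1)] F that by (simp add: add_bounded_def mult.assoc)
  then show ?thesis using F H K(1) L(1) unfolding add_bounded_def by (auto intro!: exI[of _ "L * K"])
qed

context minimal_tensor
begin

lemma add_bounded_tensor_right: "a \<in> carrier A \<Longrightarrow> add_bounded B C (\<tau> a)"
  unfolding add_bounded_def
  using nrm_tensor_le A.nrm_nonneg by (auto simp: \<tau> intro!: exI[of _ "nrm A a"])

lemma add_bounded_tensor_left: "b \<in> carrier B \<Longrightarrow> add_bounded A C (\<lambda>a. \<tau> a b)"
  unfolding add_bounded_def
  using nrm_tensor_le B.nrm_nonneg by (auto simp: \<tau> mult.commute intro!: exI[of _ "nrm B b"])

lemma ext:
  assumes E: "cstar_algebra E" and F: "add_bounded C E F" and H: "add_bounded C E H"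
    and eq: "\<And>a b. \<lbrakk>a \<in> carrier A; b \<in> carrier B\<rbrakk> \<Longrightarrow> F (\<tau> a b) = H (\<tau> a b)" and x: "x \<in> carrier C"
  shows "F x = H x"
proof -
  interpret E: cstar_algebra E by fact
  have zero: "F' \<zero>\<^bsub>C\<^esub> = \<zero>\<^bsub>E\<^esub>" if "add_bounded C E F'" for F'
    using that C.l_zero[OF C.zero_closed] C.zero_closed E.add.l_cancel_one' unfolding add_bounded_def by metis
  have diff: "F' (x \<ominus>\<^bsub>C\<^esub> y) = F' x \<ominus>\<^bsub>E\<^esub> F' y" if F': "add_bounded C E F'" and xy: "x \<in> carrier C" "y \<in> carrier C" for F' x y
  proof -
    have "F' (x \<ominus>\<^bsub>C\<^esub> y) \<oplus>\<^bsub>E\<^esub> F' y = F' ((x \<ominus>\<^bsub>C\<^esub> y) \<oplus>\<^bsub>C\<^esub> y)" using F' xy by (simp add: add_bounded_def)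
    also have "\<dots> = F' x" using xy by (simp add: C.collect)
    finally have "F' x \<ominus>\<^bsub>E\<^esub> F' y = (F' (x \<ominus>\<^bsub>C\<^esub> y) \<oplus>\<^bsub>E\<^esub> F' y) \<ominus>\<^bsub>E\<^esub> F' y" by simp
    also have "\<dots> = F' (x \<ominus>\<^bsub>C\<^esub> y)" using F' xy by (simp add: add_bounded_def E.collect)
    finally show ?thesis by simp
  qed
  have sums: "F s = H s \<and> s \<in> carrier C" if "s = tsum C \<tau> n a b"
    "\<And>k. k < n \<Longrightarrow> a k \<in> carrier A" "\<And>k. k < n \<Longrightarrow> b k \<in> carrier B" for s and n :: nat and a b
    using that
  proof (induction n arbitrary: s)
    case (Suc n)
    let ?t = "\<Oplus>\<^bsub>C\<^esub>k\<in>{..<n}. \<tau> (a k) (b k)"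
    have "s = \<tau> (a n) (b n) \<oplus>\<^bsub>C\<^esub> ?t"
      unfolding Suc.prems(1) lessThan_Suc using Suc.prems(2,3) by (subst C.finsum_insert) (auto simp: \<tau>)
    moreover have "F ?t = H ?t \<and> ?t \<in> carrier C" using Suc by simp
    moreover have "\<tau> (a n) (b n) \<in> carrier C" "F (\<tau> (a n) (b n)) = H (\<tau> (a n) (b n))" using Suc.prems eq \<tau> by simp_all
    ultimately show ?case using F H by (simp add: add_bounded_def)
  qed (simp add: zero[OF F] zero[OF H])
  obtain K where K: "0 \<le> K" "\<And>x. x \<in> carrier C \<Longrightarrow> nrm E (F x) \<le> K * nrm C x"
    using add_bounded_bound[OF F] by blast
  obtain L where L: "0 \<le> L" "\<And>x. x \<in> carrier C \<Longrightarrow> nrm E (H x) \<le> L * nrm C x"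
    using add_bounded_bound[OF H] by blast
  have Fx: "F x \<in> carrier E" "H x \<in> carrier E" using F H x by (simp_all add: add_bounded_def)
  have "nrm E (F x \<ominus>\<^bsub>E\<^esub> H x) \<le> 0 + e" if e: "0 < e" for e
  proof -
    \<comment> \<open>Both maps change by at most K d and L d; the added 1 keeps the denominator
      positive.\<close>
    define d where "d = e / (K + L + 1)"
    have d: "0 < d" "(K + L) * d \<le> e" using e K(1) L(1) by (simp_all add: d_def field_simps)
    obtain n :: nat and a b where ab: "\<And>k. k < n \<Longrightarrow> a k \<in> carrier A" "\<And>k. k < n \<Longrightarrow> b k \<in> carrier B"
      and lt: "nrm C (x \<ominus>\<^bsub>C\<^esub> (tsum C \<tau> n a b)) < d"
      using dense[OF x d(1)] by blast
    define s where "s = tsum C \<tau> n a b"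
    have s: "F s = H s" "s \<in> carrier C" using sums[OF s_def ab] by auto
    have xs: "x \<ominus>\<^bsub>C\<^esub> s \<in> carrier C" using x s by simp
    have Fs: "F s \<in> carrier E" using F s(2) by (simp add: add_bounded_def)
    have "nrm E (F x \<ominus>\<^bsub>E\<^esub> H x) \<le> nrm E (F x \<ominus>\<^bsub>E\<^esub> F s) + nrm E (H x \<ominus>\<^bsub>E\<^esub> H s)"
      using E.nrm_diff_triangle[of "F x" "F s" "H x"] E.nrm_diff_comm[of "F s" "H x"] Fx Fs s(1) by simp
    also have "\<dots> = nrm E (F (x \<ominus>\<^bsub>C\<^esub> s)) + nrm E (H (x \<ominus>\<^bsub>C\<^esub> s))" by (simp add: diff F H x s)
    also have "\<dots> \<le> (K + L) * nrm C (x \<ominus>\<^bsub>C\<^esub> s)" using K(2)[OF xs] L(2)[OF xs] by (simp add: distrib_right)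
    also have "\<dots> \<le> (K + L) * d" using lt K(1) L(1) by (intro mult_left_mono) (simp_all add: s_def)
    finally show ?thesis using d(2) by simp
  qed
  then have "nrm E (F x \<ominus>\<^bsub>E\<^esub> H x) \<le> 0" by (rule field_le_epsilon)
  then show ?thesis using E.nrm_nonneg[of "F x \<ominus>\<^bsub>E\<^esub> H x"] E.nrm_diff_eq_0 Fx by simp
qed

end

text \<open>Tensoring with \<open>q\<close> is multiplicative because \<open>q\<close> is
  idempotent, respects adjoints because \<open>q\<close> is self-adjoint, and is injective because
  \<open>q\<close> is non-zero.\<close>

lemma star_mono_tensor_right:
  assumes m: "min_tensor A B C \<tau>" and q: "is_projection A q" "q \<noteq> \<zero>\<^bsub>A\<^esub>"
  shows "star_mono B C (\<tau> q)"
proof -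
  interpret minimal_tensor A B C \<tau> by unfold_locales fact
  have q': "q \<in> carrier A" "star A q = q" "q \<otimes>\<^bsub>A\<^esub> q = q" using q(1) by (simp_all add: is_projection_def)
  have hom: "star_hom B C (\<tau> q)" using q' by (intro star_homI) (simp_all add: \<tau>)
  have "x = y" if x: "x \<in> carrier B" and y: "y \<in> carrier B" and eq: "\<tau> q x = \<tau> q y" for x y
  proof -
    have "\<tau> q (x \<ominus>\<^bsub>B\<^esub> y) = \<tau> q x \<ominus>\<^bsub>C\<^esub> \<tau> q y"
      using x y q' by (simp add: B.minus_eq_smult C.minus_eq_smult \<tau> B.closed)
    then have "\<tau> q (x \<ominus>\<^bsub>B\<^esub> y) = \<zero>\<^bsub>C\<^esub>" using eq C.diff_eq_zero \<tau>(1) q' y by simp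
    then have "x \<ominus>\<^bsub>B\<^esub> y = \<zero>\<^bsub>B\<^esub>" by (rule tensor_eq_zero[OF q'(1) q(2) B.minus_closed[OF x y]])
    then show ?thesis using B.diff_eq_zero[OF x y] by simp
  qed
  then show ?thesis using hom by (simp add: star_mono_def inj_on_def)
qed

lemma star_mono_tensor_left:
  assumes m: "min_tensor A B C \<tau>" and q: "is_projection B q" "q \<noteq> \<zero>\<^bsub>B\<^esub>"
  shows "star_mono A C (\<lambda>x. \<tau> x q)"
proof -
  interpret minimal_tensor A B C \<tau> by unfold_locales fact
  have q': "q \<in> carrier B" "star B q = q" "q \<otimes>\<^bsub>B\<^esub> q = q" using q(1) by (simp_all add: is_projection_def)
  have hom: "star_hom A C (\<lambda>x. \<tau> x q)" using q' by (intro star_homI) (simp_all add: \<tau>)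
  have "x = y" if x: "x \<in> carrier A" and y: "y \<in> carrier A" and eq: "\<tau> x q = \<tau> y q" for x y
  proof -
    have "\<tau> (x \<ominus>\<^bsub>A\<^esub> y) q = \<tau> x q \<ominus>\<^bsub>C\<^esub> \<tau> y q"
      using x y q' by (simp add: A.minus_eq_smult C.minus_eq_smult \<tau> A.closed)
    then have "\<tau> (x \<ominus>\<^bsub>A\<^esub> y) q = \<zero>\<^bsub>C\<^esub>" using eq C.diff_eq_zero \<tau>(1) q' y by simp
    then have "x \<ominus>\<^bsub>A\<^esub> y = \<zero>\<^bsub>A\<^esub>" by (rule min_tensor_swap_zero[OF m A.minus_closed[OF x y] q'(1) q(2)])
    then show ?thesis using A.diff_eq_zero[OF x y] by simp
  qed
  then show ?thesis using hom by (simp add: star_mono_def inj_on_def)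
qed

lemma is_projection_tensor:
  assumes m: "min_tensor A B C \<tau>" and a: "is_projection A a" "a \<noteq> \<zero>\<^bsub>A\<^esub>" and b: "is_projection B b" "b \<noteq> \<zero>\<^bsub>B\<^esub>"
  shows "is_projection C (\<tau> a b)" "\<tau> a b \<noteq> \<zero>\<^bsub>C\<^esub>"
proof -
  interpret minimal_tensor A B C \<tau> by unfold_locales fact
  show "is_projection C (\<tau> a b)" using a(1) b(1) by (simp add: is_projection_def \<tau>)
  show "\<tau> a b \<noteq> \<zero>\<^bsub>C\<^esub>" using tensor_eq_zero[OF _ a(2), of b] a(1) b by (auto simp: is_projection_def)
qed

section \<open>Finite partitions\<close>

lemma partsD:
  assumes "I \<in> parts"
  shows "finite I" "I \<noteq> {}" "Min I \<in> I" "Max I \<in> I" "0 < Min I" "Min I < Max I"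
proof -
  show f: "finite I" and ne: "I \<noteq> {}" using assms by (auto simp: parts_def)
  show m: "Min I \<in> I" and "Max I \<in> I" using f ne by simp_all
  show "0 < Min I" using m assms by (auto simp: parts_def)
  have "\<not> I \<subseteq> {Min I}"
  proof
    assume "I \<subseteq> {Min I}"
    then have "card I \<le> card {Min I}" by (intro card_mono) auto
    then show False using assms by (simp add: parts_def)
  qed
  then obtain x where "x \<in> I" "x \<noteq> Min I" by blast
  then show "Min I < Max I" using Min_le[OF f] Max_ge[OF f] by force
qed

lemma partsI: assumes "finite I" "\<And>x. x \<in> I \<Longrightarrow> 0 < x" "a \<in> I" "b \<in> I" "a < b" shows "I \<in> parts"
proof -
  have "card {a, b} \<le> card I" using assms by (intro card_mono) auto
  then show ?thesis using assms by (auto simp: parts_def)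
qed

lemma two_parts: assumes "0 < s" "s < t" shows "{s, t} \<in> parts" "Min {s, t} = s" "Max {s, t} = t" "card {s, t} \<le> 2"
  using assms by (auto intro: partsI[of _ s t])

definition adj :: "real set \<Rightarrow> real set \<Rightarrow> bool" where
  "adj I J \<longleftrightarrow> I \<in> parts \<and> J \<in> parts \<and> Max I = Min J"

definition refines :: "real set \<Rightarrow> real set \<Rightarrow> bool" where
  "refines I J \<longleftrightarrow> I \<in> parts \<and> J \<in> parts \<and> I \<subseteq> J \<and> Min I = Min J \<and> Max I = Max J"

lemma adj_union:
  assumes "adj I J"
  shows "I \<union> J \<in> parts" "Min (I \<union> J) = Min I" "Max (I \<union> J) = Max J"
proof -
  have I: "I \<in> parts" and J: "J \<in> parts" and eq: "Max I = Min J" using assms by (auto simp: adj_def)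
  show "I \<union> J \<in> parts"
    using partsD[OF I] partsD[OF J] I J by (intro partsI[of _ "Min I" "Max I"]) (auto simp: parts_def)
  show "Min (I \<union> J) = Min I" "Max (I \<union> J) = Max J"
    using partsD[OF I] partsD[OF J] eq by (simp_all add: Min_Un Max_Un)
qed

lemma adjD: assumes "adj I J" shows "I \<in> parts" "J \<in> parts" "Max I = Min J"
  using assms by (simp_all add: adj_def)

lemma adj_two: "\<lbrakk>0 < r; r < s; s < t\<rbrakk> \<Longrightarrow> adj {r, s} {s, t}"
  by (simp add: adj_def two_parts)

lemma adj_pair_right: "\<lbrakk>I \<in> parts; Max I < m\<rbrakk> \<Longrightarrow> adj I {Max I, m}"
  using partsD[of I] by (auto simp: adj_def two_parts)

lemma adj_assoc: "\<lbrakk>adj I J; adj J K\<rbrakk> \<Longrightarrow> adj (I \<union> J) K" "\<lbrakk>adj I J; adj J K\<rbrakk> \<Longrightarrow> adj I (J \<union> K)"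
  using adj_union by (auto simp: adj_def)

lemma adj_cut:
  assumes "adj I J"
  shows "(I \<union> J) \<inter> {..Max I} = I" "(I \<union> J) \<inter> {Max I..} = J"
proof -
  note I = partsD[OF adjD(1)[OF assms]] and J = partsD[OF adjD(2)[OF assms]] and eq = adjD(3)[OF assms]
  have "x \<le> Max I" if "x \<in> I" for x using that I by simp
  moreover have "Max I \<le> x" if "x \<in> J" for x using that J eq by simp
  moreover have "x = Max I" if "x \<in> I" "Max I \<le> x" for x using that Max_ge[OF I(1) that(1)] by simp
  moreover have "x = Max I" if "x \<in> J" "x \<le> Max I" for x using that Min_le[OF J(1) that(1)] eq by simp
  ultimately show "(I \<union> J) \<inter> {..Max I} = I" "(I \<union> J) \<inter> {Max I..} = J"
    using I(4) J(3) eq by auto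
qed

lemma parts_cut:
  assumes J: "J \<in> parts" and c: "c \<in> J" "Min J < c" "c < Max J"
  shows "adj (J \<inter> {..c}) (J \<inter> {c..})" "J \<inter> {..c} \<union> J \<inter> {c..} = J"
    "Min (J \<inter> {..c}) = Min J" "Max (J \<inter> {..c}) = c" "Min (J \<inter> {c..}) = c" "Max (J \<inter> {c..}) = Max J"
proof -
  note J' = partsD[OF J]
  have pos: "\<And>x. x \<in> J \<Longrightarrow> 0 < x" using J by (auto simp: parts_def)
  have L: "J \<inter> {..c} \<in> parts" using J' c pos by (intro partsI[of _ "Min J" c]) auto
  have R: "J \<inter> {c..} \<in> parts" using J' c pos by (intro partsI[of _ c "Max J"]) auto
  show "Min (J \<inter> {..c}) = Min J" "Min (J \<inter> {c..}) = c" using J' c by (auto intro!: Min_eqI intro: J'(3))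
  show mx: "Max (J \<inter> {..c}) = c" "Max (J \<inter> {c..}) = Max J" using J' c by (auto intro!: Max_eqI intro: J'(4))
  then show "adj (J \<inter> {..c}) (J \<inter> {c..})" using L R \<open>Min (J \<inter> {c..}) = c\<close> by (simp add: adj_def)
  show "J \<inter> {..c} \<union> J \<inter> {c..} = J" by auto
qed

lemma refines_cut:
  assumes ref: "refines (I \<union> I') J" and a: "adj I I'"
  obtains J1 J2 where "J = J1 \<union> J2" "adj J1 J2" "refines I J1" "refines I' J2"
proof -
  note I = partsD[OF adjD(1)[OF a]] and I' = partsD[OF adjD(2)[OF a]] and eq = adjD(3)[OF a]
  have J: "J \<in> parts" and sub: "I \<union> I' \<subseteq> J" and mm: "Min J = Min I" "Max J = Max I'"
    using ref adj_union[OF a] by (auto simp: refines_def)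
  let ?c = "Max I"
  have c: "?c \<in> J" "Min J < ?c" "?c < Max J" using I I' sub mm eq by auto
  note cut = parts_cut[OF J c]
  have "x \<le> ?c" if "x \<in> I" for x using Max_ge[OF I(1) that] .
  moreover have "?c \<le> x" if "x \<in> I'" for x using Min_le[OF I'(1) that] eq by simp
  ultimately have "I \<subseteq> J \<inter> {..?c}" "I' \<subseteq> J \<inter> {?c..}" using sub by auto
  then show thesis
    using that[of "J \<inter> {..?c}" "J \<inter> {?c..}"] cut adjD[OF cut(1)] adjD[OF a] mm by (simp add: refines_def)
qed

text \<open>Evaluates the data used by the recursive definitions once a partition is written as a
  shorter one plus a last interval. The clause on cardinality 3 recognises the special case in
  \<open>Delta_part\<close>.\<close>

lemma init_part_pair:
  assumes "adj K {l, m}" "l < m"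
  shows "init_part (K \<union> {l, m}) = K" "last_but_one (K \<union> {l, m}) = l" "Max (K \<union> {l, m}) = m"
    "Min (K \<union> {l, m}) = Min K" "\<not> card (K \<union> {l, m}) \<le> 2" "card (K \<union> {l, m}) = 3 \<longleftrightarrow> K = {Min K, l}" "Max K = l" "0 < l"
proof -
  note K = partsD[OF adjD(1)[OF assms(1)]]
  show l: "Max K = l" using adjD(3)[OF assms(1)] assms(2) by simp
  show "0 < l" using l K by simp
  show mx: "Max (K \<union> {l, m}) = m" "Min (K \<union> {l, m}) = Min K" using adj_union[OF assms(1)] assms(2) by simp_all
  have lK: "l \<in> K" and mK: "m \<notin> K" using K l assms(2) Max_ge[OF K(1)] by (auto simp: not_le[symmetric])
  show ip: "init_part (K \<union> {l, m}) = K" unfolding init_part_def mx using lK mK by auto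
  show "last_but_one (K \<union> {l, m}) = l" unfolding last_but_one_def ip by (rule l)
  have card: "card (K \<union> {l, m}) = Suc (card K)" using lK mK K(1) by (simp add: insert_absorb)
  have two: "2 \<le> card K" using adjD(1)[OF assms(1)] by (simp add: parts_def)
  then show "\<not> card (K \<union> {l, m}) \<le> 2" using card by simp
  have sub: "{Min K, l} \<subseteq> K" "card {Min K, l} = 2" using K l by auto
  have "card K = 2 \<longleftrightarrow> K = {Min K, l}"
    using card_subset_eq[OF K(1) sub(1)] sub(2) by metis
  then show "card (K \<union> {l, m}) = 3 \<longleftrightarrow> K = {Min K, l}" using card by simp
qed

text \<open>Induction by appending an interval at the right end, the direction in which
  \<open>unit_part\<close>, \<open>Delta_part\<close> and \<open>Delta\<close> recurse.\<close>

lemma parts_induct [consumes 1, case_names pair step]: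
  assumes "I \<in> parts"
    and "\<And>s t. \<lbrakk>0 < s; s < t\<rbrakk> \<Longrightarrow> P {s, t}"
    and step: "\<And>K l m. \<lbrakk>adj K {l, m}; l < m; P K\<rbrakk> \<Longrightarrow> P (K \<union> {l, m})"
  shows "P I"
  using assms(1)
proof (induction "card I" arbitrary: I rule: less_induct)
  case less
  note I = partsD[OF less.prems]
  show ?case
  proof (cases "I = {Min I, Max I}")
    case True
    then show ?thesis using assms(2)[OF I(5,6)] by simp
  next
    case False
    then obtain c where c: "c \<in> I" "c \<noteq> Min I" "c \<noteq> Max I" using I by blast
    let ?K = "I - {Max I}"
    have c': "Min I < c" "c < Max I" using c Min_le[OF I(1) c(1)] Max_ge[OF I(1) c(1)] by auto
    have K: "?K \<in> parts"
      using I c c' less.prems by (intro partsI[of _ "Min I" c]) (auto simp: parts_def)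
    have lt: "Max ?K < Max I" using partsD(4)[OF K] Max_ge[OF I(1)] by (metis Diff_iff insertI1 less_eq_real_def)
    have "P (?K \<union> {Max ?K, Max I})"
      by (intro step adj_pair_right K lt less.hyps[OF card_Diff1_less[OF I(1,4)] K])
    moreover have "?K \<union> {Max ?K, Max I} = I" using partsD(4)[OF K] I(4) by auto
    ultimately show ?thesis by simp
  qed
qed

section \<open>Tensor systems\<close>

locale tensor_system =
  fixes A :: "real \<Rightarrow> real \<Rightarrow> 'a cstar" and T :: "'a tensor_system"
  assumes realization: "tensor_realization A T"
begin

abbreviation "TM \<equiv> tensor_map T"
abbreviation "el I \<equiv> carrier (alg T I)"
abbreviation "smono I J \<equiv> star_mono (alg T I) (alg T J)"
abbreviation "bdd I J \<equiv> add_bounded (alg T I) (alg T J)"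

lemma alg_pair: "\<lbrakk>0 < s; s < t\<rbrakk> \<Longrightarrow> alg T {s, t} = A s t"
  using realization by (simp add: tensor_realization_def)

lemma tens_min: "adj I J \<Longrightarrow> min_tensor (alg T I) (alg T J) (alg T (I \<union> J)) (tens T I J)"
  using realization by (simp add: tensor_realization_def adj_def)

lemma tens_assoc:
  "\<lbrakk>adj I J; adj J K; x \<in> el I; y \<in> el J; z \<in> el K\<rbrakk>
    \<Longrightarrow> tens T (I \<union> J) K (tens T I J x y) z = tens T I (J \<union> K) x (tens T J K y z)"
  using realization by (simp add: tensor_realization_def adj_def)

lemma tens_closed: "\<lbrakk>adj I J; x \<in> el I; y \<in> el J\<rbrakk> \<Longrightarrow> tens T I J x y \<in> el (I \<union> J)"
  using tens_min by (simp add: min_tensor_def)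

lemma ext2:
  assumes a: "adj I J" and E: "cstar_algebra E" and F: "add_bounded (alg T (I \<union> J)) E F" and G: "add_bounded (alg T (I \<union> J)) E G"
    and "\<And>x y. \<lbrakk>x \<in> el I; y \<in> el J\<rbrakk> \<Longrightarrow> F (tens T I J x y) = G (tens T I J x y)"
    and "w \<in> el (I \<union> J)"
  shows "F w = G w"
proof -
  interpret minimal_tensor "alg T I" "alg T J" "alg T (I \<union> J)" "tens T I J" by unfold_locales (rule tens_min[OF a])
  show ?thesis by (rule ext[OF E F G]) (use assms in auto)
qed

lemma tens_add_bounded:
  assumes "adj I J"
  shows "x \<in> el I \<Longrightarrow> bdd J (I \<union> J) (tens T I J x)"
    "y \<in> el J \<Longrightarrow> bdd I (I \<union> J) (\<lambda>x. tens T I J x y)"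
proof -
  interpret minimal_tensor "alg T I" "alg T J" "alg T (I \<union> J)" "tens T I J" by unfold_locales (rule tens_min[OF assms])
  show "x \<in> el I \<Longrightarrow> bdd J (I \<union> J) (tens T I J x)"
    "y \<in> el J \<Longrightarrow> bdd I (I \<union> J) (\<lambda>x. tens T I J x y)"
    by (rule add_bounded_tensor_right add_bounded_tensor_left; assumption)+
qed

text \<open>For fixed \<open>z\<close> the map
  \<open>u \<mapsto> tens T (I \<union> J) K u z\<close> is additive and bounded, so
  \<open>ext2\<close> can be applied once to the outer and once to the inner tensor product.\<close>

lemma ext3:
  assumes a: "adj I J" "adj J K" and E: "cstar_algebra E"
    and F: "add_bounded (alg T (I \<union> J \<union> K)) E F" and G: "add_bounded (alg T (I \<union> J \<union> K)) E G"
    and eq: "\<And>x y z. \<lbrakk>x \<in> el I; y \<in> el J; z \<in> el K\<rbrakk>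
      \<Longrightarrow> F (tens T (I \<union> J) K (tens T I J x y) z) = G (tens T (I \<union> J) K (tens T I J x y) z)"
    and w: "w \<in> el (I \<union> J \<union> K)"
  shows "F w = G w"
proof (rule ext2[OF adj_assoc(1)[OF a] E F G _ w])
  fix u z assume u: "u \<in> el (I \<union> J)" and z: "z \<in> el K"
  note b = tens_add_bounded(2)[OF adj_assoc(1)[OF a] z]
  show "F (tens T (I \<union> J) K u z) = G (tens T (I \<union> J) K u z)"
    by (rule ext2[OF a(1) E add_bounded_comp[OF b F] add_bounded_comp[OF b G] _ u]) (rule eq[OF _ _ z])
qed

end

section \<open>Calculus of tensor products of maps\<close>

locale subproduct_system = tensor_system +
  fixes \<Delta> :: "real \<Rightarrow> real \<Rightarrow> real \<Rightarrow> 'a \<Rightarrow> 'a"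
  assumes subproduct: "cstar_subproduct_system A T \<Delta>"
begin

lemma alg_cstar: "I \<in> parts \<Longrightarrow> cstar_algebra (alg T I)"
proof (induction rule: parts_induct)
  case (pair s t)
  then show ?case using subproduct by (simp add: alg_pair cstar_subproduct_system_def)
next
  case (step K l m)
  then show ?case using tens_min[OF step(1)] by (simp add: min_tensor_def)
qed

lemma hom_add_bounded: "\<lbrakk>I \<in> parts; J \<in> parts; smono I J f\<rbrakk> \<Longrightarrow> bdd I J f"
  using star_hom_add_bounded alg_cstar star_monoD(1) by blast

text \<open>Gives meaning to the definite description in \<open>tensor_map\<close>: existence comes
  from the isometric extension, cut down to the carrier to become extensional, and uniqueness from
  agreement on elementary tensors.\<close>

lemma TM_props:
  assumes a: "adj I J" "adj I' J'" and f: "smono I I' f" and g: "smono J J' g"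
  shows TM_mono: "smono (I \<union> J) (I' \<union> J') (TM I J I' J' f g)"
    and TM_tens: "\<lbrakk>x \<in> el I; y \<in> el J\<rbrakk>
      \<Longrightarrow> TM I J I' J' f g (tens T I J x y) = tens T I' J' (f x) (g y)"
proof -
  let ?C = "alg T (I \<union> J)" and ?D = "alg T (I' \<union> J')"
  let ?agree = "\<lambda>\<Phi>. \<forall>x\<in>el I. \<forall>y\<in>el J. \<Phi> (tens T I J x y) = tens T I' J' (f x) (g y)"
  note C = alg_cstar[OF adj_union(1)[OF a(1)]] and D = alg_cstar[OF adj_union(1)[OF a(2)]]
  obtain \<Phi> where \<Phi>: "star_mono ?C ?D \<Phi>" "?agree \<Phi>" using ex_tensor_map[OF tens_min[OF a(1)] tens_min[OF a(2)] f g] by blast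
  define \<Psi> where "\<Psi> = restrict \<Phi> (carrier ?C)"
  have \<Psi>: "star_mono ?C ?D \<Psi>" by (rule star_mono_cong[OF \<Phi>(1) _ C]) (simp add: \<Psi>_def)
  have \<Psi>': "?agree \<Psi>" using \<Phi>(2) tens_closed[OF a(1)] by (simp add: \<Psi>_def)
  have "TM I J I' J' f g = \<Psi>"
    unfolding tensor_map_def
  proof (rule the_equality)
    show "\<Psi> \<in> extensional (carrier ?C) \<and> star_hom ?C ?D \<Psi> \<and> ?agree \<Psi>"
      using \<Psi>' star_monoD(1)[OF \<Psi>] by (simp add: \<Psi>_def)
    fix \<Phi>' assume \<Phi>': "\<Phi>' \<in> extensional (carrier ?C) \<and> star_hom ?C ?D \<Phi>' \<and> ?agree \<Phi>'"
    show "\<Phi>' = \<Psi>"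
    proof (rule extensionalityI[of _ "carrier ?C"])
      fix w assume w: "w \<in> carrier ?C"
      show "\<Phi>' w = \<Psi> w"
        by (rule ext2[OF a(1) D star_hom_add_bounded[OF C D] star_hom_add_bounded[OF C D] _ w])
          (use \<Phi>' \<Psi>' star_monoD(1)[OF \<Psi>] in auto)
    qed (use \<Phi>' in \<open>simp_all add: \<Psi>_def\<close>)
  qed
  then show "star_mono ?C ?D (TM I J I' J' f g)"
    "\<lbrakk>x \<in> el I; y \<in> el J\<rbrakk> \<Longrightarrow> TM I J I' J' f g (tens T I J x y) = tens T I' J' (f x) (g y)"
    using \<Psi> \<Psi>' by simp_all
qed

lemma TM_unique:
  assumes a: "adj I J" "adj I' J'" and f: "smono I I' f" and g: "smono J J' g"
    and \<Phi>: "smono (I \<union> J) (I' \<union> J') \<Phi>"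
    and eq: "\<And>x y. \<lbrakk>x \<in> el I; y \<in> el J\<rbrakk> \<Longrightarrow> \<Phi> (tens T I J x y) = tens T I' J' (f x) (g y)"
    and w: "w \<in> el (I \<union> J)"
  shows "\<Phi> w = TM I J I' J' f g w"
proof (rule ext2[OF a(1) alg_cstar[OF adj_union(1)[OF a(2)]] _ _ _ w])
  note m = hom_add_bounded[OF adj_union(1)[OF a(1)] adj_union(1)[OF a(2)]]
  show "bdd (I \<union> J) (I' \<union> J') \<Phi>" by (rule m[OF \<Phi>])
  show "bdd (I \<union> J) (I' \<union> J') (TM I J I' J' f g)" by (rule m[OF TM_mono[OF a f g]])
qed (simp add: eq TM_tens[OF a f g])

text \<open>The composites appear as separate maps \<open>h\<close> and \<open>k\<close>, linked to
  \<open>f' (f x)\<close> and \<open>g' (g y)\<close> on the carriers only, so that a recursion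
  equation for a composite can be inserted directly.\<close>

lemma TM_comp:
  assumes a: "adj I J" "adj I' J'" "adj I'' J''"
    and f: "smono I I' f" and g: "smono J J' g"
    and f': "smono I' I'' f'" and g': "smono J' J'' g'"
    and h: "\<And>x. x \<in> el I \<Longrightarrow> f' (f x) = h x" and k: "\<And>y. y \<in> el J \<Longrightarrow> g' (g y) = k y"
    and w: "w \<in> el (I \<union> J)"
  shows "TM I' J' I'' J'' f' g' (TM I J I' J' f g w) = TM I J I'' J'' h k w"
proof (rule TM_unique[OF a(1,3) _ _ _ _ w, of h k "\<lambda>w. TM I' J' I'' J'' f' g' (TM I J I' J' f g w)"])
  show "smono I I'' h"
    by (rule star_mono_cong[OF star_mono_comp[OF f f'] _ alg_cstar[OF adjD(1)[OF a(1)]]]) (simp add: h)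
  show "smono J J'' k"
    by (rule star_mono_cong[OF star_mono_comp[OF g g'] _ alg_cstar[OF adjD(2)[OF a(1)]]]) (simp add: k)
  show "smono (I \<union> J) (I'' \<union> J'') (\<lambda>w. TM I' J' I'' J'' f' g' (TM I J I' J' f g w))"
    by (rule star_mono_comp[OF TM_mono[OF a(1,2) f g] TM_mono[OF a(2,3) f' g']])
  fix x y assume xy: "x \<in> el I" "y \<in> el J"
  then show "TM I' J' I'' J'' f' g' (TM I J I' J' f g (tens T I J x y)) = tens T I'' J'' (h x) (k y)"
    by (simp add: TM_tens[OF a(1,2) f g] TM_tens[OF a(2,3) f' g'] star_monoD(3)[OF f] star_monoD(3)[OF g] h k)
qed

lemma TM_id:
  assumes a: "adj I J" and w: "w \<in> el (I \<union> J)"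
  shows "TM I J I J (\<lambda>x. x) (\<lambda>x. x) w = w"
  by (rule TM_unique[OF a a star_mono_id star_mono_id star_mono_id _ w, symmetric]) simp

lemma TM_cong:
  assumes a: "adj I J" "adj I' J'" and f: "smono I I' f" and g: "smono J J' g"
    and f': "\<And>x. x \<in> el I \<Longrightarrow> f' x = f x" and g': "\<And>x. x \<in> el J \<Longrightarrow> g' x = g x"
    and w: "w \<in> el (I \<union> J)"
  shows "TM I J I' J' f' g' w = TM I J I' J' f g w"
  using TM_comp[OF a(1,1,2) star_mono_id star_mono_id f g f'[symmetric] g'[symmetric] w] TM_id[OF a(1) w] by simp

text \<open>Both bracketings act on the algebra of the same union of partitions, so the claim
  compares two maps on one algebra and is tested on triple elementary tensors.\<close>

lemma TM_assoc:
  assumes a: "adj I J" "adj J K" "adj I' J'" "adj J' K'"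
    and f: "smono I I' f" and g: "smono J J' g" and h: "smono K K' h"
    and w: "w \<in> el (I \<union> J \<union> K)"
  shows "TM (I \<union> J) K (I' \<union> J') K' (TM I J I' J' f g) h w = TM I (J \<union> K) I' (J' \<union> K') f (TM J K J' K' g h) w"
proof -
  note l = adj_assoc(1)[OF a(1,2)] adj_assoc(1)[OF a(3,4)] and r = adj_assoc(2)[OF a(1,2)] adj_assoc(2)[OF a(3,4)]
  note fg = TM_mono[OF a(1,3) f g] and gh = TM_mono[OF a(2,4) g h]
  note L = TM_mono[OF l fg h] and R = TM_mono[OF r f gh]
  show ?thesis
  proof (rule ext3[OF a(1,2) alg_cstar[OF adj_union(1)[OF l(2)]] _ _ _ w])
    show "bdd (I \<union> J \<union> K) (I' \<union> J' \<union> K') (TM (I \<union> J) K (I' \<union> J') K' (TM I J I' J' f g) h)"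
      by (rule hom_add_bounded[OF adj_union(1)[OF l(1)] adj_union(1)[OF l(2)] L])
    show "bdd (I \<union> J \<union> K) (I' \<union> J' \<union> K') (TM I (J \<union> K) I' (J' \<union> K') f (TM J K J' K' g h))"
      using hom_add_bounded[OF adj_union(1)[OF r(1)] adj_union(1)[OF r(2)] R] by (simp add: Un_assoc)
    fix x y z assume xyz: "x \<in> el I" "y \<in> el J" "z \<in> el K"
    note xyz' = star_monoD(3)[OF f xyz(1)] star_monoD(3)[OF g xyz(2)] star_monoD(3)[OF h xyz(3)]
    have "TM (I \<union> J) K (I' \<union> J') K' (TM I J I' J' f g) h (tens T (I \<union> J) K (tens T I J x y) z)
        = tens T (I' \<union> J') K' (tens T I' J' (f x) (g y)) (h z)"
      using xyz by (simp add: TM_tens[OF l fg h] TM_tens[OF a(1,3) f g] tens_closed[OF a(1)])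
    also have "\<dots> = tens T I' (J' \<union> K') (f x) (tens T J' K' (g y) (h z))" by (rule tens_assoc[OF a(3,4) xyz'])
    also have "\<dots> = TM I (J \<union> K) I' (J' \<union> K') f (TM J K J' K' g h) (tens T I (J \<union> K) x (tens T J K y z))"
      using xyz by (simp add: TM_tens[OF r f gh] TM_tens[OF a(2,4) g h] tens_closed[OF a(2)])
    also have "tens T I (J \<union> K) x (tens T J K y z) = tens T (I \<union> J) K (tens T I J x y) z"
      by (rule tens_assoc[OF a(1,2) xyz, symmetric])
    finally show "TM (I \<union> J) K (I' \<union> J') K' (TM I J I' J' f g) h (tens T (I \<union> J) K (tens T I J x y) z)
      = TM I (J \<union> K) I' (J' \<union> K') f (TM J K J' K' g h) (tens T (I \<union> J) K (tens T I J x y) z)" .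
  qed
qed

section \<open>The maps from one interval to a partition\<close>

lemma Delta3_mono:
  assumes "0 < r" "r < s" "s < t"
  shows "smono {r, t} ({r, s} \<union> {s, t}) (\<Delta> r s t)"
proof -
  have "{r, s} \<union> {s, t} = {r, s, t}" by auto
  then show ?thesis using subproduct assms by (simp add: cstar_subproduct_system_def alg_pair)
qed

lemma coassoc:
  assumes "0 < r" "r < s" "s < t" "t < u" "x \<in> el {r, u}"
  shows "TM {r, t} {t, u} ({r, s} \<union> {s, t}) {t, u} (\<Delta> r s t) (\<lambda>y. y) (\<Delta> r t u x)
    = TM {r, s} {s, u} {r, s} ({s, t} \<union> {t, u}) (\<lambda>y. y) (\<Delta> s t u) (\<Delta> r s u x)"
proof -
  have "{r, s} \<union> {s, t} = {r, s, t}" "{s, t} \<union> {t, u} = {s, t, u}" by auto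
  then show ?thesis using subproduct assms by (simp add: cstar_subproduct_system_def alg_pair)
qed

abbreviation "DP \<equiv> Delta_part T \<Delta>"

lemma DP_pair: "\<lbrakk>0 < s; s < t\<rbrakk> \<Longrightarrow> DP {s, t} = (\<lambda>x. x)"
  by (simp add: Delta_part.simps two_parts)

text \<open>One recursion equation for both non-trivial cases of \<open>Delta_part\<close>: with a
  single inner point, the tensor product of two identities is the identity and may be inserted after
  \<open>\<Delta>\<close>.\<close>

lemma DP_step:
  assumes a: "adj K {l, m}" "l < m" and x: "x \<in> el {Min K, m}"
  shows "DP (K \<union> {l, m}) x = TM {Min K, l} {l, m} K {l, m} (DP K) (\<lambda>y. y) (\<Delta> (Min K) l m x)"
proof (cases "K = {Min K, l}")
  case True
  have s: "0 < Min K" "Min K < l" using partsD[OF adjD(1)[OF a(1)]] init_part_pair(7)[OF a] by simp_all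
  have d: "\<Delta> (Min K) l m x \<in> el ({Min K, l} \<union> {l, m})"
    by (rule star_monoD(3)[OF Delta3_mono[OF s a(2)] x])
  have "DP (K \<union> {l, m}) x = \<Delta> (Min K) l m x"
    using init_part_pair[OF a] True by (simp add: Delta_part.simps[of T \<Delta> "K \<union> {l, m}"] del: Un_insert_right)
  also have "\<dots> = TM {Min K, l} {l, m} {Min K, l} {l, m} (\<lambda>y. y) (\<lambda>y. y) (\<Delta> (Min K) l m x)"
    by (rule TM_id[OF adj_two[OF s a(2)] d, symmetric])
  also have "\<dots> = TM {Min K, l} {l, m} K {l, m} (DP K) (\<lambda>y. y) (\<Delta> (Min K) l m x)"
    using True DP_pair[OF s] by metis
  finally show ?thesis .
next
  case False
  then show ?thesis
    using init_part_pair[OF a] by (simp add: Delta_part.simps[of T \<Delta> "K \<union> {l, m}"] del: Un_insert_right)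
qed

lemma DP_mono: "I \<in> parts \<Longrightarrow> smono {Min I, Max I} I (DP I)"
proof (induction rule: parts_induct)
  case (pair s t)
  then show ?case by (simp add: DP_pair two_parts star_mono_id)
next
  case (step K l m)
  note ip = init_part_pair[OF step(1,2)]
  have s: "0 < Min K" "Min K < l" using partsD[OF adjD(1)[OF step(1)]] ip(7) by simp_all
  have K: "smono {Min K, l} K (DP K)" using step(3) ip(7) by simp
  note mono = star_mono_comp[OF Delta3_mono[OF s step(2)] TM_mono[OF adj_two[OF s step(2)] step(1) K star_mono_id]]
  have c: "cstar_algebra (alg T {Min K, m})" using s step(2) by (intro alg_cstar two_parts) auto
  show ?case unfolding ip(3,4) by (rule star_mono_cong[OF mono DP_step[OF step(1,2)] c])
qed

text \<open>Coassociativity moves the cut from the last inner point, where the recursion makes it, to any inner point.\<close>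

lemma DP_cut:
  assumes "adj I J" "x \<in> el {Min I, Max J}"
  shows "DP (I \<union> J) x = TM {Min I, Max I} {Max I, Max J} I J (DP I) (DP J) (\<Delta> (Min I) (Max I) (Max J) x)"
  using adjD(2)[OF assms(1)] assms
proof (induction arbitrary: x rule: parts_induct)
  case (pair c t)
  have "Max I = c" using adjD(3)[OF pair(3)] pair(1,2) by (simp add: two_parts)
  then show ?case using DP_step[OF pair(3,2), of x] pair by (simp add: two_parts DP_pair)
next
  case (step K l m)
  define s where "s = Min I"
  define c where "c = Max I"
  note ip = init_part_pair[OF step(1,2)]
  have I: "I \<in> parts" by (rule adjD(1)[OF step(4)])
  have K: "K \<in> parts" by (rule adjD(1)[OF step(1)])
  have cK: "c = Min K" using adjD(3)[OF step(4)] ip(4) by (simp add: c_def)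
  have aIK: "adj I K" using I K cK by (simp add: adj_def c_def)
  have o: "0 < s" "s < c" "c < l" "l < m" "0 < c" "s < l" "c < m"
    using partsD[OF I] partsD[OF K] ip(7) step(2) cK by (simp_all add: s_def c_def)
  have x: "x \<in> el {s, m}" using step(5) ip(3) by (simp add: s_def)
  have aIKlm: "adj (I \<union> K) {l, m}" using adj_assoc(1)[OF aIK step(1)] .
  note IK = adj_union[OF aIK]
  note mI = DP_mono[OF I, folded s_def c_def]
  note mK = DP_mono[OF K, folded cK, unfolded ip(7)]
  note mKm = DP_mono[OF adj_union(1)[OF step(1)], unfolded ip(3,4), folded cK]
  note mIK = DP_mono[OF IK(1), unfolded IK(2,3) ip(7), folded s_def]
  note a1 = adj_two[OF o(1,2,3)] and a2 = adj_two[OF o(5,3,4)] and a3 = adj_two[OF o(1,6,4)] and a4 = adj_two[OF o(1,2,7)]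
  note d1 = Delta3_mono[OF o(1,2,3)] and d2 = Delta3_mono[OF o(5,3,4)] and d3 = Delta3_mono[OF o(1,6,4)] and d4 = Delta3_mono[OF o(1,2,7)]
  note tIK = TM_mono[OF a1 aIK mI mK]
  note tK = TM_mono[OF a2 step(1) mK star_mono_id]
  have IH: "DP (I \<union> K) y = TM {s, c} {c, l} I K (DP I) (DP K) (\<Delta> s c l y)" if "y \<in> el {s, l}" for y
    using step(3)[OF aIK, of y] that ip(7) by (simp add: s_def c_def)
  have "DP (I \<union> (K \<union> {l, m})) x = TM {s, l} {l, m} (I \<union> K) {l, m} (DP (I \<union> K)) (\<lambda>y. y) (\<Delta> s l m x)"
    using DP_step[OF aIKlm step(2), unfolded IK(2), folded s_def, OF x] by (simp only: Un_assoc)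
  \<comment> \<open>Here \<open>c\<close> is the desired cut, \<open>l\<close> the last inner point
    and \<open>m\<close> the end. The induction hypothesis cuts \<open>DP (I \<union> K)\<close> at
    \<open>c\<close>, and \<open>TM_comp\<close> separates that cut from the maps that follow
    it.\<close>
  also have "\<dots> = TM ({s, c} \<union> {c, l}) {l, m} (I \<union> K) {l, m} (TM {s, c} {c, l} I K (DP I) (DP K)) (\<lambda>y. y)
      (TM {s, l} {l, m} ({s, c} \<union> {c, l}) {l, m} (\<Delta> s c l) (\<lambda>y. y) (\<Delta> s l m x))"
    by (rule TM_comp[symmetric, OF a3 adj_assoc(1)[OF a1 a2] aIKlm d1 star_mono_id tIK star_mono_id _ _ star_monoD(3)[OF d3 x]])
      (simp_all add: IH)
  \<comment> \<open>Cutting at \<open>l\<close> and then at \<open>c\<close> is replaced by cutting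
    at \<open>c\<close> and then at \<open>l\<close>.\<close>
  also have "TM {s, l} {l, m} ({s, c} \<union> {c, l}) {l, m} (\<Delta> s c l) (\<lambda>y. y) (\<Delta> s l m x)
      = TM {s, c} {c, m} {s, c} ({c, l} \<union> {l, m}) (\<lambda>y. y) (\<Delta> c l m) (\<Delta> s c m x)"
    by (rule coassoc[OF o(1,2,3,4) x])
  \<comment> \<open>Rebracketing puts the maps on the two intervals right of \<open>c\<close> into
    one block, which \<open>DP_step\<close> then identifies with
    \<open>DP (K \<union> {l, m})\<close>.\<close>
  also have "TM ({s, c} \<union> {c, l}) {l, m} (I \<union> K) {l, m} (TM {s, c} {c, l} I K (DP I) (DP K)) (\<lambda>y. y)
      (TM {s, c} {c, m} {s, c} ({c, l} \<union> {l, m}) (\<lambda>y. y) (\<Delta> c l m) (\<Delta> s c m x))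
    = TM {s, c} ({c, l} \<union> {l, m}) I (K \<union> {l, m}) (DP I) (TM {c, l} {l, m} K {l, m} (DP K) (\<lambda>y. y))
      (TM {s, c} {c, m} {s, c} ({c, l} \<union> {l, m}) (\<lambda>y. y) (\<Delta> c l m) (\<Delta> s c m x))"
    by (rule TM_assoc[OF a1 a2 aIK step(1) mI mK star_mono_id],
        use star_monoD(3)[OF TM_mono[OF a4 adj_assoc(2)[OF a1 a2] star_mono_id d2] star_monoD(3)[OF d4 x]] in \<open>simp only: Un_assoc\<close>)
  also have "\<dots> = TM {s, c} {c, m} I (K \<union> {l, m}) (DP I) (DP (K \<union> {l, m})) (\<Delta> s c m x)"
    by (rule TM_comp[OF a4 adj_assoc(2)[OF a1 a2] step(4) star_mono_id d2 mI tK _ _ star_monoD(3)[OF d4 x]])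
      (use DP_step[OF step(1,2), folded cK] in simp_all)
  finally show ?case unfolding ip(3) s_def c_def .
qed

section \<open>The maps from a partition to a refinement\<close>

abbreviation "DD \<equiv> Delta T \<Delta>"

lemma DD_pair: "\<lbrakk>0 < s; s < t\<rbrakk> \<Longrightarrow> DD {s, t} J = DP J"
  by (simp add: Delta.simps two_parts)

lemma DD_step:
  assumes "adj K {l, m}" "l < m" "adj J1 J2" "Max J1 = l"
  shows "DD (K \<union> {l, m}) (J1 \<union> J2) = TM K {l, m} J1 J2 (DD K J1) (DP J2)"
  using init_part_pair[OF assms(1,2)] adj_cut[OF assms(3)] assms(4)
  by (simp add: Delta.simps[of T \<Delta> "K \<union> {l, m}"] del: Un_insert_right)

lemma refinesD: assumes "refines I J" shows "I \<in> parts" "J \<in> parts" "Min J = Min I" "Max J = Max I"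
  using assms by (simp_all add: refines_def)

lemma refines_pair:
  assumes "refines {s, t} J" "s < t" shows "DP J = DD {s, t} J" "smono {s, t} J (DP J)"
proof -
  have s: "0 < s" using partsD(5)[OF refinesD(1)[OF assms(1)]] assms(2) by simp
  show "DP J = DD {s, t} J" by (simp add: DD_pair s assms(2))
  show "smono {s, t} J (DP J)"
    using DP_mono[OF refinesD(2)[OF assms(1)]] refinesD(3,4)[OF assms(1)] two_parts[OF s assms(2)] by simp
qed

lemma DD_mono: "\<lbrakk>I \<in> parts; refines I J\<rbrakk> \<Longrightarrow> smono I J (DD I J)"
proof (induction arbitrary: J rule: parts_induct)
  case (pair s t)
  then show ?case using refines_pair[OF pair(3,2)] by simp
next
  case (step K l m)
  obtain J1 J2 where J: "J = J1 \<union> J2" "adj J1 J2" "refines K J1" "refines {l, m} J2"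
    by (rule refines_cut[OF step(4,1)])
  have "Max J1 = l" using refinesD(4)[OF J(3)] init_part_pair(7)[OF step(1,2)] by simp
  then show ?case unfolding J(1)
    using TM_mono[OF step(1) J(2) step(3)[OF J(3)] refines_pair(2)[OF J(4) step(2)]] DD_step[OF step(1,2) J(2)] by simp
qed

lemma DD_mono': "refines I J \<Longrightarrow> smono I J (DD I J)"
  using DD_mono refinesD(1) by blast

lemma refines_union: "\<lbrakk>adj I I'; refines I J; refines I' J'\<rbrakk> \<Longrightarrow> refines (I \<union> I') (J \<union> J') \<and> adj J J'"
proof -
  assume a: "adj I I'" and r: "refines I J" "refines I' J'"
  have a': "adj J J'" using a r by (simp add: adj_def refines_def)
  then show ?thesis using adj_union[OF a] adj_union[OF a'] r by (auto simp: refines_def)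
qed

text \<open>\<open>Delta\<close> splits off the last interval; induction on the right-hand partition
  moves this cut to any point of the coarse partition, with associativity of \<open>tens\<close>
  rebracketing the factors.\<close>

lemma DD_tens:
  assumes "adj I I'" "refines I J" "refines I' J'" "x \<in> el I" "y \<in> el I'"
  shows "DD (I \<union> I') (J \<union> J') (tens T I I' x y) = tens T J J' (DD I J x) (DD I' J' y)"
  using adjD(2)[OF assms(1)] assms
proof (induction arbitrary: J' y rule: parts_induct)
  case (pair c t)
  have a: "adj J J'" using refines_union[OF pair(3,4,5)] by simp
  have c: "Max J = c" using refinesD(4)[OF pair(4)] adjD(3)[OF pair(3)] pair(1,2) by (simp add: two_parts)
  note r = refines_pair[OF pair(5,2)]
  show ?case unfolding r(1)[symmetric]
    using TM_tens[OF pair(3) a DD_mono'[OF pair(4)] r(2) pair(6,7)] DD_step[OF pair(3,2) a c] by simp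
next
  case (step K l m)
  note ip = init_part_pair[OF step(1,2)]
  obtain J1 J2 where J: "J' = J1 \<union> J2" "adj J1 J2" "refines K J1" "refines {l, m} J2"
    by (rule refines_cut[OF step(6,1)])
  have aIK: "adj I K" using step(4) ip(4) adjD(1)[OF step(1)] by (simp add: adj_def)
  have aIKlm: "adj (I \<union> K) {l, m}" by (rule adj_assoc(1)[OF aIK step(1)])
  have rIK: "refines (I \<union> K) (J \<union> J1)" and aJJ1: "adj J J1" using refines_union[OF aIK step(5) J(3)] by auto
  have aJJ12: "adj (J \<union> J1) J2" by (rule adj_assoc(1)[OF aJJ1 J(2)])
  have r: "refines (I \<union> (K \<union> {l, m})) (J \<union> J')" and aJJ': "adj J J'" using refines_union[OF step(4,5,6)] by auto
  have l: "Max J1 = l" using refinesD(4)[OF J(3)] ip(7) by simp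
  have l': "Max (J \<union> J1) = l" using adj_union(3)[OF aJJ1] l by simp
  note r2 = refines_pair[OF J(4) step(2)]
  note m1 = DD_mono'[OF step(5)] and m2 = DD_mono'[OF J(3)] and m3 = DD_mono'[OF rIK] and m4 = DD_mono'[OF step(6)]
  have Dx: "DD I J x \<in> el J" by (rule star_monoD(3)[OF m1 step(7)])
  show ?case
  \<comment> \<open>With \<open>x\<close> fixed, both sides are compared as functions of
    \<open>y\<close>. They are compositions with one-sided tensor maps, hence bounded and additive
    although in general not multiplicative.\<close>
  proof (rule ext2[OF step(1) alg_cstar[OF adj_union(1)[OF aJJ']] _ _ _ step(8)])
    show "bdd (K \<union> {l, m}) (J \<union> J') (\<lambda>y. DD (I \<union> (K \<union> {l, m})) (J \<union> J') (tens T I (K \<union> {l, m}) x y))"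
      by (rule add_bounded_comp[OF tens_add_bounded(1)[OF step(4,7)] hom_add_bounded[OF refinesD(1,2)[OF r] DD_mono'[OF r]]])
    show "bdd (K \<union> {l, m}) (J \<union> J') (\<lambda>y. tens T J J' (DD I J x) (DD (K \<union> {l, m}) J' y))"
      by (rule add_bounded_comp[OF hom_add_bounded[OF refinesD(1,2)[OF step(6)] m4] tens_add_bounded(1)[OF aJJ' Dx]])
    fix u v assume u: "u \<in> el K" and v: "v \<in> el {l, m}"
    have Du: "DD K J1 u \<in> el J1" and Dv: "DP J2 v \<in> el J2"
      by (rule star_monoD(3)[OF m2 u], rule star_monoD(3)[OF r2(2) v])
    have "DD (I \<union> (K \<union> {l, m})) (J \<union> J') (tens T I (K \<union> {l, m}) x (tens T K {l, m} u v))
        = DD ((I \<union> K) \<union> {l, m}) ((J \<union> J1) \<union> J2) (tens T (I \<union> K) {l, m} (tens T I K x u) v)"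
      by (simp only: tens_assoc[OF aIK step(1,7) u v] J(1) Un_assoc)
    also have "\<dots> = tens T (J \<union> J1) J2 (DD (I \<union> K) (J \<union> J1) (tens T I K x u)) (DP J2 v)"
      unfolding DD_step[OF aIKlm step(2) aJJ12 l']
      by (rule TM_tens[OF aIKlm aJJ12 m3 r2(2) tens_closed[OF aIK step(7) u] v])
    also have "\<dots> = tens T (J \<union> J1) J2 (tens T J J1 (DD I J x) (DD K J1 u)) (DP J2 v)"
      using step(3)[OF aIK step(5) J(3) step(7) u] by simp
    also have "\<dots> = tens T J (J1 \<union> J2) (DD I J x) (tens T J1 J2 (DD K J1 u) (DP J2 v))"
      by (rule tens_assoc[OF aJJ1 J(2) Dx Du Dv])
    also have "tens T J1 J2 (DD K J1 u) (DP J2 v) = DD (K \<union> {l, m}) J' (tens T K {l, m} u v)"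
      unfolding J(1) DD_step[OF step(1,2) J(2) l] by (rule TM_tens[OF step(1) J(2) m2 r2(2) u v, symmetric])
    finally show "DD (I \<union> (K \<union> {l, m})) (J \<union> J') (tens T I (K \<union> {l, m}) x (tens T K {l, m} u v))
      = tens T J J' (DD I J x) (DD (K \<union> {l, m}) J' (tens T K {l, m} u v))" by (simp only: J(1))
  qed
qed

text \<open>Functoriality starting from a single interval. \<open>DP_cut\<close> reassembles the
  pieces at \<open>l\<close>, which need not be the last inner point of \<open>K\<close>; this is
  where coassociativity enters the composition law.\<close>

lemma DD_DP:
  assumes "J \<in> parts" "refines J K" "x \<in> el {Min J, Max J}"
  shows "DD J K (DP J x) = DP K x"
  using assms
proof (induction arbitrary: K x rule: parts_induct)
  case (pair s t)
  then show ?case by (simp add: DP_pair DD_pair)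
next
  case (step J l m)
  note ip = init_part_pair[OF step(1,2)]
  define s where "s = Min J"
  have o: "0 < s" "s < l" using partsD[OF adjD(1)[OF step(1)]] ip(7) by (simp_all add: s_def)
  obtain K1 K2 where K: "K = K1 \<union> K2" "adj K1 K2" "refines J K1" "refines {l, m} K2"
    by (rule refines_cut[OF step(4,1)])
  have l: "Max K1 = l" and s: "Min K1 = s" using refinesD(3,4)[OF K(3)] ip(7) by (simp_all add: s_def)
  have m: "Max K2 = m" using refinesD(4)[OF K(4)] step(2) by simp
  have x: "x \<in> el {s, m}" using step(5) ip(3,4) by (simp add: s_def)
  have mJ: "smono {s, l} J (DP J)" using DP_mono[OF adjD(1)[OF step(1)]] ip(7) by (simp add: s_def)
  note r2 = refines_pair[OF K(4) step(2)]
  have "DD (J \<union> {l, m}) K (DP (J \<union> {l, m}) x)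
      = TM J {l, m} K1 K2 (DD J K1) (DP K2) (TM {s, l} {l, m} J {l, m} (DP J) (\<lambda>y. y) (\<Delta> s l m x))"
    unfolding K(1) DD_step[OF step(1,2) K(2) l] using DP_step[OF step(1,2)] x by (simp add: s_def)
  also have "\<dots> = TM {s, l} {l, m} K1 K2 (DP K1) (DP K2) (\<Delta> s l m x)"
    by (rule TM_comp[OF adj_two[OF o step(2)] step(1) K(2) mJ star_mono_id DD_mono'[OF K(3)] r2(2) _ _
          star_monoD(3)[OF Delta3_mono[OF o step(2)] x]])
      (use step(3)[OF K(3)] ip(7) in \<open>simp_all add: s_def\<close>)
  also have "\<dots> = DP K x" unfolding K(1) using DP_cut[OF K(2), of x] x by (simp add: l s m)
  finally show ?case .
qed

text \<open>Cutting all three partitions at the last inner point of \<open>I\<close> leaves a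
  shorter instance on the left and the single-interval case \<open>DD_DP\<close> on the
  right.\<close>

lemma DD_DD:
  assumes "I \<in> parts" "refines I J" "refines J K" "x \<in> el I"
  shows "DD J K (DD I J x) = DD I K x"
  using assms
proof (induction arbitrary: J K x rule: parts_induct)
  case (pair s t)
  have "Min J = s" "Max J = t" using refinesD(3,4)[OF pair(3)] pair(1,2) by (simp_all add: two_parts)
  then show ?case using DD_DP[OF refinesD(1)[OF pair(4)] pair(4), of x] pair by (simp add: DD_pair)
next
  case (step I l m)
  note ip = init_part_pair[OF step(1,2)]
  obtain J1 J2 where J: "J = J1 \<union> J2" "adj J1 J2" "refines I J1" "refines {l, m} J2"
    by (rule refines_cut[OF step(4,1)])
  obtain K1 K2 where K: "K = K1 \<union> K2" "adj K1 K2" "refines J1 K1" "refines J2 K2"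
    using refines_cut[OF step(5)[unfolded J(1)] J(2)] .
  have rIK1: "refines I K1" and rlmK2: "refines {l, m} K2" using J K by (auto simp: refines_def)
  have rIK: "refines (I \<union> {l, m}) K" using step(4,5) by (auto simp: refines_def)
  have l: "Max J1 = l" "Max K1 = l" using refinesD(4)[OF J(3)] refinesD(4)[OF K(3)] ip(7) by simp_all
  note rJ = refines_pair[OF J(4) step(2)] and rK = refines_pair[OF rlmK2 step(2)]
  have lm: "Min J2 = l" "Max J2 = m" using refinesD(3,4)[OF J(4)] step(2) by simp_all
  show ?case
  proof (rule ext2[OF step(1) alg_cstar[OF refinesD(2)[OF step(5)]] _ _ _ step(6)])
    show "bdd (I \<union> {l, m}) K (\<lambda>x. DD J K (DD (I \<union> {l, m}) J x))"
      by (rule hom_add_bounded[OF refinesD(1,2)[OF rIK] star_mono_comp[OF DD_mono'[OF step(4)] DD_mono'[OF step(5)]]])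
    show "bdd (I \<union> {l, m}) K (DD (I \<union> {l, m}) K)"
      by (rule hom_add_bounded[OF refinesD(1,2)[OF rIK] DD_mono'[OF rIK]])
    fix u v assume u: "u \<in> el I" and v: "v \<in> el {l, m}"
    have Du: "DD I J1 u \<in> el J1" and Dv: "DP J2 v \<in> el J2"
      by (rule star_monoD(3)[OF DD_mono'[OF J(3)] u], rule star_monoD(3)[OF rJ(2) v])
    have "DD J K (DD (I \<union> {l, m}) J (tens T I {l, m} u v)) = DD J K (tens T J1 J2 (DD I J1 u) (DP J2 v))"
      unfolding J(1) DD_step[OF step(1,2) J(2) l(1)] by (simp only: TM_tens[OF step(1) J(2) DD_mono'[OF J(3)] rJ(2) u v])
    also have "\<dots> = tens T K1 K2 (DD J1 K1 (DD I J1 u)) (DD J2 K2 (DP J2 v))"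
      unfolding J(1) K(1) by (rule DD_tens[OF J(2) K(3,4) Du Dv])
    also have "\<dots> = tens T K1 K2 (DD I K1 u) (DP K2 v)"
      using step(3)[OF J(3) K(3) u] DD_DP[OF refinesD(1)[OF K(4)] K(4), of v] v lm by simp
    also have "\<dots> = DD (I \<union> {l, m}) K (tens T I {l, m} u v)"
      unfolding K(1) DD_step[OF step(1,2) K(2) l(2)] by (simp only: TM_tens[OF step(1) K(2) DD_mono'[OF rIK1] rK(2) u v])
    finally show "DD J K (DD (I \<union> {l, m}) J (tens T I {l, m} u v)) = DD (I \<union> {l, m}) K (tens T I {l, m} u v)" .
  qed
qed

lemma DD_id: "\<lbrakk>I \<in> parts; x \<in> el I\<rbrakk> \<Longrightarrow> DD I I x = x"
proof (induction arbitrary: x rule: parts_induct)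
  case (pair s t)
  then show ?case by (simp add: DD_pair DP_pair)
next
  case (step K l m)
  note ip = init_part_pair[OF step(1,2)]
  have "DD (K \<union> {l, m}) (K \<union> {l, m}) x = TM K {l, m} K {l, m} (DD K K) (DP {l, m}) x"
    by (simp only: DD_step[OF step(1,2,1) ip(7)])
  also have "\<dots> = TM K {l, m} K {l, m} (\<lambda>x. x) (\<lambda>x. x) x"
    by (rule TM_cong[OF step(1,1) star_mono_id star_mono_id _ _ step(4)]) (use step(2,3) ip(8) in \<open>simp_all add: DP_pair\<close>)
  also have "\<dots> = x" by (rule TM_id[OF step(1,4)])
  finally show ?case .
qed

end

section \<open>The maps \<open>\<Delta>\<^sup>\<times>\<close>\<close>

locale unital_subproduct_system = subproduct_system +
  fixes p :: "real \<Rightarrow> real \<Rightarrow> 'a"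
  assumes unital: "subproduct_unit A T \<Delta> p"
begin

abbreviation "PP \<equiv> unit_part T p"

lemma PP_pair: "\<lbrakk>0 < s; s < t\<rbrakk> \<Longrightarrow> PP {s, t} = p s t"
  by (simp add: unit_part.simps two_parts)

lemma PP_step: "\<lbrakk>adj K {l, m}; l < m\<rbrakk> \<Longrightarrow> PP (K \<union> {l, m}) = tens T K {l, m} (PP K) (PP {l, m})"
  using init_part_pair[of K l m] PP_pair[of l m]
  by (simp add: unit_part.simps[of T p "K \<union> {l, m}"] del: Un_insert_right)

lemma PP_projection: "I \<in> parts \<Longrightarrow> is_projection (alg T I) (PP I) \<and> PP I \<noteq> \<zero>\<^bsub>alg T I\<^esub>"
proof (induction rule: parts_induct)
  case (pair s t)
  then show ?case using unital by (simp add: PP_pair subproduct_unit_def alg_pair)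
next
  case (step K l m)
  have "is_projection (alg T {l, m}) (PP {l, m}) \<and> PP {l, m} \<noteq> \<zero>\<^bsub>alg T {l, m}\<^esub>"
    using unital init_part_pair(8)[OF step(1,2)] step(2) by (simp add: PP_pair subproduct_unit_def alg_pair)
  then show ?case
    using is_projection_tensor[OF tens_min[OF step(1)]] step(3) by (simp only: PP_step[OF step(1,2)]) blast
qed

lemma PP_closed: "I \<in> parts \<Longrightarrow> PP I \<in> el I"
  using PP_projection by (simp add: is_projection_def)

text \<open>\<open>unit_part\<close> is bracketed to the left, so a product over an arbitrary cut is
  reached by associativity, one interval of the right-hand partition at a time.\<close>

lemma PP_union: "adj I J \<Longrightarrow> PP (I \<union> J) = tens T I J (PP I) (PP J)"
proof -
  assume "adj I J"
  with adjD(2) have "J \<in> parts" by blast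
  then show ?thesis using \<open>adj I J\<close>
  proof (induction rule: parts_induct)
    case (pair s t)
    then show ?case by (intro PP_step)
  next
    case (step K l m)
    have a: "adj I K" using step(4) init_part_pair(4)[OF step(1,2)] adjD(1)[OF step(1)] by (simp add: adj_def)
    have lm: "{l, m} \<in> parts" using adjD(2)[OF step(1)] .
    have "PP (I \<union> (K \<union> {l, m})) = tens T (I \<union> K) {l, m} (PP (I \<union> K)) (PP {l, m})"
      using PP_step[OF adj_assoc(1)[OF a step(1)] step(2)] by (simp only: Un_assoc)
    also have "\<dots> = tens T I (K \<union> {l, m}) (PP I) (tens T K {l, m} (PP K) (PP {l, m}))"
      unfolding step(3)[OF a] by (intro tens_assoc a step(1) PP_closed adjD[OF a] lm)
    finally show ?case by (simp only: PP_step[OF step(1,2)])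
  qed
qed

text \<open>At each stage of the recursion the unit relation splits \<open>p s m\<close> at the last
  inner point, and the induction hypothesis refines the left factor.\<close>

lemma DP_PP: "I \<in> parts \<Longrightarrow> DP I (p (Min I) (Max I)) = PP I"
proof (induction rule: parts_induct)
  case (pair s t)
  then show ?case by (simp add: DP_pair PP_pair two_parts)
next
  case (step K l m)
  note ip = init_part_pair[OF step(1,2)]
  define s where "s = Min K"
  have o: "0 < s" "s < l" using partsD[OF adjD(1)[OF step(1)]] ip(7) by (simp_all add: s_def)
  have c: "p s l \<in> el {s, l}" "p l m \<in> el {l, m}" "p s m \<in> el {s, m}"
    using PP_closed[OF two_parts(1)] PP_pair o step(2) ip(8) by (metis order.strict_trans)+
  have mK: "smono {s, l} K (DP K)" using DP_mono[OF adjD(1)[OF step(1)]] ip(7) by (simp add: s_def)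
  have "DP (K \<union> {l, m}) (p s m) = TM {s, l} {l, m} K {l, m} (DP K) (\<lambda>y. y) (\<Delta> s l m (p s m))"
    using DP_step[OF step(1,2)] c(3) by (simp add: s_def)
  also have "\<Delta> s l m (p s m) = tens T {s, l} {l, m} (p s l) (p l m)"
    using unital o step(2) by (simp add: subproduct_unit_def)
  also have "TM {s, l} {l, m} K {l, m} (DP K) (\<lambda>y. y) (tens T {s, l} {l, m} (p s l) (p l m))
      = tens T K {l, m} (DP K (p s l)) (p l m)"
    by (rule TM_tens[OF adj_two[OF o step(2)] step(1) mK star_mono_id c(1,2)])
  also have "\<dots> = PP (K \<union> {l, m})"
    using step(3) ip(7) by (simp only: PP_step[OF step(1,2)] PP_pair[OF ip(8) step(2)] s_def)
  finally show ?case unfolding ip(3,4) s_def .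
qed

lemma DD_PP: "\<lbrakk>I \<in> parts; refines I J\<rbrakk> \<Longrightarrow> DD I J (PP I) = PP J"
proof (induction arbitrary: J rule: parts_induct)
  case (pair s t)
  then show ?case using DP_PP[OF refinesD(2)[OF pair(3)]] refinesD(3,4)[OF pair(3)]
    by (simp add: DD_pair PP_pair two_parts)
next
  case (step K l m)
  obtain J1 J2 where J: "J = J1 \<union> J2" "adj J1 J2" "refines K J1" "refines {l, m} J2"
    by (rule refines_cut[OF step(4,1)])
  have lm: "{l, m} \<in> parts" "0 < l" using adjD(2)[OF step(1)] init_part_pair(8)[OF step(1,2)] by auto
  have "DD {l, m} J2 (PP {l, m}) = PP J2"
    using DP_PP[OF refinesD(2)[OF J(4)]] refinesD(3,4)[OF J(4)] lm(2) step(2)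
    by (simp add: DD_pair PP_pair two_parts)
  then show ?case
    unfolding J(1) using DD_tens[OF step(1) J(3,4) PP_closed[OF adjD(1)[OF step(1)]] PP_closed[OF lm(1)]] step(3)[OF J(3)]
    by (simp only: PP_step[OF step(1,2)] PP_union[OF J(2)])
qed

text \<open>In \<open>lower P M\<close> and \<open>upper M P\<close> the set \<open>P\<close> may be a single point, which stands for an omitted tensor factor.\<close>

definition lower :: "real set \<Rightarrow> real set \<Rightarrow> bool" where
  "lower P M \<longleftrightarrow> M \<in> parts \<and> (P = {Min M} \<or> adj P M)"

definition upper :: "real set \<Rightarrow> real set \<Rightarrow> bool" where
  "upper M P \<longleftrightarrow> M \<in> parts \<and> (P = {Max M} \<or> adj M P)"

abbreviation "TL \<equiv> tens_unit_left T p"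
abbreviation "TR \<equiv> tens_unit_right T p"

lemma parts_card: "I \<in> parts \<Longrightarrow> card I \<noteq> 1"
  by (auto simp: parts_def)

lemma TL_single: "TL {a} M x = x" and TR_single: "TR M {a} x = x"
  by (simp_all add: tens_unit_left_def tens_unit_right_def)

lemma TL_adj: "adj P M \<Longrightarrow> TL P M x = tens T P M (PP P) x"
  and TR_adj: "adj M P \<Longrightarrow> TR M P x = tens T M P x (PP P)"
  using parts_card adjD by (auto simp: tens_unit_left_def tens_unit_right_def)

lemma lower_single: "M \<in> parts \<Longrightarrow> {Min M} \<union> M = M" and upper_single: "M \<in> parts \<Longrightarrow> M \<union> {Max M} = M"
  using partsD(3,4)[of M] by auto

lemma lower_union: "lower P M \<Longrightarrow> P \<union> M \<in> parts \<and> Min (P \<union> M) = Min P \<and> Max (P \<union> M) = Max M"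
  using adj_union[of P M] lower_single[of M] by (auto simp: lower_def)

lemma upper_union: "upper M P \<Longrightarrow> M \<union> P \<in> parts \<and> Min (M \<union> P) = Min M \<and> Max (M \<union> P) = Max P"
  using adj_union[of M P] upper_single[of M] by (auto simp: upper_def)

lemma TL_mono: "lower P M \<Longrightarrow> smono M (P \<union> M) (TL P M)"
proof -
  assume l: "lower P M"
  then have M: "M \<in> parts" by (simp add: lower_def)
  from l consider "P = {Min M}" | "adj P M" by (auto simp: lower_def)
  then show ?thesis
  proof cases
    case 1
    have "TL P M = (\<lambda>x. x)" by (simp add: 1 TL_single fun_eq_iff)
    then show ?thesis using lower_single[OF M] 1 star_mono_id by simp
  next
    case 2
    have "TL P M = tens T P M (PP P)" by (simp add: TL_adj[OF 2] fun_eq_iff)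
    then show ?thesis using star_mono_tensor_right[OF tens_min[OF 2]] PP_projection[OF adjD(1)[OF 2]] by simp
  qed
qed

lemma TR_mono: "upper M P \<Longrightarrow> smono M (M \<union> P) (TR M P)"
proof -
  assume l: "upper M P"
  then have M: "M \<in> parts" by (simp add: upper_def)
  from l consider "P = {Max M}" | "adj M P" by (auto simp: upper_def)
  then show ?thesis
  proof cases
    case 1
    have "TR M P = (\<lambda>x. x)" by (simp add: 1 TR_single fun_eq_iff)
    then show ?thesis using upper_single[OF M] 1 star_mono_id by simp
  next
    case 2
    have "TR M P = (\<lambda>x. tens T M P x (PP P))" by (simp add: TR_adj[OF 2] fun_eq_iff)
    then show ?thesis using star_mono_tensor_left[OF tens_min[OF 2]] PP_projection[OF adjD(2)[OF 2]] by simp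
  qed
qed

text \<open>For two genuine partitions this is associativity combined with \<open>PP_union\<close>.
  If one of the sets is a single point, its factor is absent and the union absorbs the
  point.\<close>

lemma TL_TL:
  assumes l: "lower P M" and l': "lower P' (P \<union> M)" and x: "x \<in> el M"
  shows "TL P' (P \<union> M) (TL P M x) = TL (P' \<union> P) M x \<and>
    lower (P' \<union> P) M"
proof -
  have M: "M \<in> parts" using l by (simp add: lower_def)
  show ?thesis
  proof (cases "adj P M")
    case P: True
    note mn = adj_union(2)[OF P]
    show ?thesis
    proof (cases "adj P' (P \<union> M)")
      case True
      then have a: "adj P' P" using P mn by (simp add: adj_def)
      have "TL P' (P \<union> M) (TL P M x) = tens T (P' \<union> P) M (tens T P' P (PP P') (PP P)) x"
        unfolding TL_adj[OF P] TL_adj[OF True]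
        by (rule tens_assoc[OF a P PP_closed PP_closed x, symmetric]) (use adjD[OF a] in auto)
      also have "\<dots> = TL (P' \<union> P) M x" by (simp only: PP_union[OF a] TL_adj[OF adj_assoc(1)[OF a P]])
      finally show ?thesis using adj_assoc(1)[OF a P] M by (simp add: lower_def)
    next
      case False
      then have "P' = {Min P}" using l' mn by (simp add: lower_def)
      then show ?thesis using l partsD(3)[OF adjD(1)[OF P]] by (simp add: TL_single insert_absorb)
    qed
  next
    case False
    then have P: "P = {Min M}" using l by (simp add: lower_def)
    then have PM: "P \<union> M = M" using lower_single[OF M] by simp
    have "Min M \<in> P'" using l' unfolding PM lower_def
    proof (elim conjE disjE)
      assume "adj P' M"
      then show ?thesis using partsD(4)[OF adjD(1)] adjD(3) by metis
    qed simp
    \<comment> \<open>The point \<open>Min M\<close> belongs to \<open>P'\<close> whether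
      \<open>P'\<close> is that point alone or a partition ending there.\<close>
    then have "P' \<union> P = P'" using P by auto
    then show ?thesis using l' PM P by (simp add: TL_single)
  qed
qed

lemma TR_TR:
  assumes l: "upper M P" and l': "upper (M \<union> P) P'" and x: "x \<in> el M"
  shows "TR (M \<union> P) P' (TR M P x) = TR M (P \<union> P') x \<and>
    upper M (P \<union> P')"
proof -
  have M: "M \<in> parts" using l by (simp add: upper_def)
  show ?thesis
  proof (cases "adj M P")
    case P: True
    note mx = adj_union(3)[OF P]
    show ?thesis
    proof (cases "adj (M \<union> P) P'")
      case True
      then have a: "adj P P'" using P mx by (simp add: adj_def)
      have "TR (M \<union> P) P' (TR M P x) = tens T M (P \<union> P') x (tens T P P' (PP P) (PP P'))"
        unfolding TR_adj[OF P] TR_adj[OF True]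
        by (rule tens_assoc[OF P a x PP_closed PP_closed]) (use adjD[OF a] in auto)
      also have "\<dots> = TR M (P \<union> P') x" by (simp only: PP_union[OF a] TR_adj[OF adj_assoc(2)[OF P a]])
      finally show ?thesis using adj_assoc(2)[OF P a] M by (simp add: upper_def)
    next
      case False
      then have "P' = {Max P}" using l' mx by (simp add: upper_def)
      then show ?thesis using l partsD(4)[OF adjD(2)[OF P]] by (simp add: TR_single insert_absorb)
    qed
  next
    case False
    then have P: "P = {Max M}" using l by (simp add: upper_def)
    then have PM: "M \<union> P = M" using upper_single[OF M] by simp
    have "Max M \<in> P'" using l' unfolding PM upper_def
    proof (elim conjE disjE)
      assume "adj M P'"
      then show ?thesis using partsD(3)[OF adjD(2)] adjD(3) by metis
    qed simp
    then have "P \<union> P' = P'" using P by auto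
    then show ?thesis using l' PM P by (simp add: TR_single)
  qed
qed

lemma lower_upper:
  assumes l: "lower P M" and u: "upper M Q"
  shows "lower P (M \<union> Q)" "upper (P \<union> M) Q"
  using l u lower_union[OF l] upper_union[OF u] by (auto simp: lower_def upper_def adj_def)

lemma TL_TR:
  assumes l: "lower P M" and u: "upper M Q" and x: "x \<in> el M"
  shows "TL P (M \<union> Q) (TR M Q x) = TR (P \<union> M) Q (TL P M x)"
proof -
  have M: "M \<in> parts" using l by (simp add: lower_def)
  show ?thesis
  proof (cases "adj P M")
    case P: True
    show ?thesis
    proof (cases "adj M Q")
      case Q: True
      show ?thesis
        unfolding TL_adj[OF P] TR_adj[OF Q] TL_adj[OF adj_assoc(2)[OF P Q]] TR_adj[OF adj_assoc(1)[OF P Q]]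
        by (rule tens_assoc[OF P Q PP_closed x PP_closed, symmetric]) (use adjD[OF P] adjD[OF Q] in auto)
    next
      case False
      then have "Q = {Max M}" using u by (simp add: upper_def)
      then show ?thesis using upper_single[OF M] by (simp add: TR_single del: Un_insert_right)
    qed
  next
    case False
    then have "P = {Min M}" using l by (simp add: lower_def)
    then show ?thesis using lower_single[OF M] by (simp add: TL_single del: Un_insert_left)
  qed
qed

text \<open>Extends refinement to the one-point sets that mark absent factors; between these it can
  only be equality.\<close>

definition refines1 :: "real set \<Rightarrow> real set \<Rightarrow> bool" where
  "refines1 P P' \<longleftrightarrow> refines P P' \<or> (\<exists>a. P = {a} \<and> P' = {a})"

text \<open>\<open>DD_tens\<close> distributes the map over the two factors, and
  \<open>DD_PP\<close> sends the unit of \<open>P\<close> to the unit of \<open>P'\<close>.\<close>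

lemma DD_TL:
  assumes l: "lower P M" and r: "refines M M'" and r1: "refines1 P P'" and x: "x \<in> el M"
  shows "DD (P \<union> M) (P' \<union> M') (TL P M x) = TL P' M' (DD M M' x) \<and>
    lower P' M' \<and>
    refines (P \<union> M) (P' \<union> M')"
proof -
  have M: "M \<in> parts" "M' \<in> parts" using r by (simp_all add: refines_def)
  show ?thesis
  proof (cases "adj P M")
    case True
    have rP: "refines P P'" using r1 parts_card[OF adjD(1)[OF True]] by (auto simp: refines1_def)
    note ru = refines_union[OF True rP r]
    have P: "P \<in> parts" using adjD[OF True] by simp
    show ?thesis
      unfolding TL_adj[OF True] TL_adj[OF conjunct2[OF ru]]
      using DD_tens[OF True rP r PP_closed[OF P] x] DD_PP[OF P rP] ru M by (simp add: lower_def)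
  next
    case False
    then have P: "P = {Min M}" using l by (simp add: lower_def)
    then have "P' = {Min M}" using r1 parts_card[of "{Min M}"] by (auto simp: refines1_def refines_def)
    then show ?thesis using P r lower_single[OF M(1)] lower_single[OF M(2)] refinesD[OF r] M
      by (simp add: TL_single lower_def del: Un_insert_left)
  qed
qed

lemma DD_TR:
  assumes l: "upper M P" and r: "refines M M'" and r1: "refines1 P P'" and x: "x \<in> el M"
  shows "DD (M \<union> P) (M' \<union> P') (TR M P x) = TR M' P' (DD M M' x) \<and>
    upper M' P' \<and>
    refines (M \<union> P) (M' \<union> P')"
proof -
  have M: "M \<in> parts" "M' \<in> parts" using r by (simp_all add: refines_def)
  show ?thesis
  proof (cases "adj M P")
    case True
    have rP: "refines P P'" using r1 parts_card[OF adjD(2)[OF True]] by (auto simp: refines1_def)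
    note ru = refines_union[OF True r rP]
    have P: "P \<in> parts" using adjD[OF True] by simp
    show ?thesis
      unfolding TR_adj[OF True] TR_adj[OF conjunct2[OF ru]]
      using DD_tens[OF True r rP x PP_closed[OF P]] DD_PP[OF P rP] ru M by (simp add: upper_def)
  next
    case False
    then have P: "P = {Max M}" using l by (simp add: upper_def)
    then have "P' = {Max M}" using r1 parts_card[of "{Max M}"] by (auto simp: refines1_def refines_def)
    then show ?thesis using P r upper_single[OF M(1)] upper_single[OF M(2)] refinesD[OF r] M
      by (simp add: TR_single upper_def del: Un_insert_right)
  qed
qed

section \<open>Cutting a partition at its own points\<close>

lemma interval_part:
  assumes J: "J \<in> parts" and ab: "a \<in> J" "b \<in> J" "a \<le> b"
  shows "a = b \<Longrightarrow> J \<inter> {a..b} = {a}"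
    "a < b \<Longrightarrow> J \<inter> {a..b} \<in> parts"
    "Min (J \<inter> {a..b}) = a" "Max (J \<inter> {a..b}) = b"
proof -
  note J' = partsD[OF J]
  show "a = b \<Longrightarrow> J \<inter> {a..b} = {a}" using ab by auto
  show "a < b \<Longrightarrow> J \<inter> {a..b} \<in> parts"
    using J ab by (intro partsI[of _ a b]) (auto simp: parts_def)
  show "Min (J \<inter> {a..b}) = a" "Max (J \<inter> {a..b}) = b" using J'(1) ab by (auto intro!: Min_eqI Max_eqI)
qed

lemma interval_lower:
  assumes J: "J \<in> parts" and abc: "a \<in> J" "b \<in> J" "c \<in> J" "a \<le> b" "b < c"
  shows "lower (J \<inter> {a..b}) (J \<inter> {b..c})" "J \<inter> {a..b} \<union> J \<inter> {b..c} = J \<inter> {a..c}"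
proof -
  note i = interval_part[OF J abc(1,2,4)] and i' = interval_part[OF J abc(2,3) less_imp_le[OF abc(5)]]
  show "lower (J \<inter> {a..b}) (J \<inter> {b..c})"
    using i i' abc(4,5) unfolding lower_def adj_def by (cases "a = b") auto
  show "J \<inter> {a..b} \<union> J \<inter> {b..c} = J \<inter> {a..c}" using abc by auto
qed

lemma interval_upper:
  assumes J: "J \<in> parts" and abc: "a \<in> J" "b \<in> J" "c \<in> J" "a < b" "b \<le> c"
  shows "upper (J \<inter> {a..b}) (J \<inter> {b..c})"
proof -
  note i = interval_part[OF J abc(1,2) less_imp_le[OF abc(4)]] and i' = interval_part[OF J abc(2,3,5)]
  show ?thesis using i i' abc(4,5) unfolding upper_def adj_def by (cases "b = c") auto
qed

lemma interval_refines1: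
  assumes "I \<in> parts" "J \<in> parts" "I \<subseteq> J" "a \<in> I" "b \<in> I" "a \<le> b"
  shows "refines1 (I \<inter> {a..b}) (J \<inter> {a..b})"
proof -
  have ab: "a \<in> J" "b \<in> J" using assms by auto
  note i = interval_part[OF assms(1,4,5,6)] and i' = interval_part[OF assms(2) ab assms(6)]
  show ?thesis using i i' assms(3,6) unfolding refines1_def refines_def by (cases "a = b") auto
qed

lemma parts_full: "I \<in> parts \<Longrightarrow> I \<inter> {Min I..Max I} = I"
  using partsD(1)[of I] by auto

abbreviation "DT \<equiv> Delta_times T \<Delta> p"

text \<open>If the end points of \<open>I\<close> and \<open>J\<close> agree, then \<open>L\<close>
  and \<open>U\<close> are single points, the unit maps are identities and \<open>M\<close> is
  \<open>J\<close>. The general formula therefore also covers the first case of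
  \<open>Delta_times\<close>, and the case distinction disappears.\<close>

lemma DT_eq:
  assumes I: "I \<in> parts" and J: "J \<in> parts" and sub: "I \<subseteq> J"
  defines "L \<equiv> J \<inter> {Min J..Min I}" and "M \<equiv> J \<inter> {Min I..Max I}" and "U \<equiv> J \<inter> {Max I..Max J}"
  shows "DT I J x = TR (L \<union> M) U (TL L M (DD I M x))"
proof -
  note I' = partsD[OF I] and J' = partsD[OF J]
  have mem: "Min I \<in> J" "Max I \<in> J" using I'(3,4) sub by blast+
  have parts: "lower_part I J = L" "middle_part I J = M" "upper_part I J = U"
    using J' by (auto simp: lower_part_def middle_part_def upper_part_def L_def M_def U_def)
  show ?thesis
  proof (cases "\<exists>s t. 0 < s \<and> s < t \<and> I \<in> parts_of s t \<and> J \<in> parts_of s t")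
    case True
    then have eq: "Min J = Min I" "Max J = Max I" by (auto simp: parts_of_def)
    have "M = J" unfolding M_def eq[symmetric] by (rule parts_full[OF J])
    moreover have "L = {Min I}" "U = {Max I}" using mem unfolding L_def U_def eq by auto
    moreover have "DT I J x = DD I J x" using True by (simp add: Delta_times_def)
    ultimately show ?thesis by (simp add: TL_single TR_single)
  next
    case False
    then show ?thesis unfolding parts[symmetric] by (simp only: Delta_times_def if_False)
  qed
qed

lemma DT_pieces:
  assumes I: "I \<in> parts" and J: "J \<in> parts" and sub: "I \<subseteq> J"
  defines "L \<equiv> J \<inter> {Min J..Min I}" and "M \<equiv> J \<inter> {Min I..Max I}" and "U \<equiv> J \<inter> {Max I..Max J}"
  shows "lower L M" "upper M U" "refines I M" "L \<union> M \<union> U = J"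
proof -
  note I' = partsD[OF I] and J' = partsD[OF J]
  have mem: "Min I \<in> J" "Max I \<in> J" using I'(3,4) sub by blast+
  have le: "Min J \<le> Min I" "Max I \<le> Max J" using mem J'(1) by simp_all
  show "lower L M" unfolding L_def M_def using interval_lower(1)[OF J J'(3) mem le(1) I'(6)] .
  show "upper M U" unfolding M_def U_def using interval_upper[OF J mem J'(4) I'(6) le(2)] .
  show "refines I M"
    using interval_part[OF J mem less_imp_le[OF I'(6)]] I' I sub parts_full[OF I] unfolding refines_def M_def by auto
  have "Min J \<le> x \<and> x \<le> Max J" if "x \<in> J" for x using that J'(1) by simp
  then show "L \<union> M \<union> U = J" using I'(6) unfolding L_def M_def U_def by auto
qed

lemma DT_mono:
  assumes I: "I \<in> parts" and J: "J \<in> parts" and sub: "I \<subseteq> J"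
  shows "smono I J (DT I J)"
proof -
  define L M U where "L = J \<inter> {Min J..Min I}" and "M = J \<inter> {Min I..Max I}" and "U = J \<inter> {Max I..Max J}"
  note d = DT_pieces[OF assms, folded L_def M_def U_def]
  have "smono I (L \<union> M \<union> U) (\<lambda>x. TR (L \<union> M) U (TL L M (DD I M x)))"
    by (intro star_mono_comp[OF star_mono_comp[OF DD_mono'[OF d(3)] TL_mono[OF d(1)]] TR_mono] lower_upper d)
  then show ?thesis unfolding d(4)
    by (rule star_mono_cong[OF _ _ alg_cstar[OF I]]) (simp add: DT_eq[OF assms] L_def M_def U_def)
qed

lemma DT_id:
  assumes I: "I \<in> parts" and x: "x \<in> el I"
  shows "DT I I x = x"
proof -
  have "\<exists>s t. 0 < s \<and> s < t \<and> I \<in> parts_of s t \<and> I \<in> parts_of s t"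
    using partsD[OF I] I by (intro exI[of _ "Min I"] exI[of _ "Max I"]) (simp add: parts_of_def)
  then show ?thesis using DD_id[OF I x] by (simp add: Delta_times_def)
qed

lemma DT_comp:
  assumes I: "I \<in> parts" and J: "J \<in> parts" and K: "K \<in> parts" and IJ: "I \<subseteq> J" and JK: "J \<subseteq> K"
    and x: "x \<in> el I"
  shows "DT J K (DT I J x) = DT I K x"
proof -
  note I' = partsD[OF I] and J' = partsD[OF J] and K' = partsD[OF K]
  have IK: "I \<subseteq> K" using IJ JK by auto
  \<comment> \<open>The end points of K, J and I satisfy a <= b <= c < d <= e <= f and cut
    \<open>K\<close> into \<open>L'\<close>, \<open>La\<close>, \<open>Ma\<close>,
    \<open>Ua\<close>, \<open>U'\<close>. The middle three refine the pieces \<open>L\<close>,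
    \<open>M\<close>, \<open>U\<close> of \<open>J\<close>; all but the pieces between
    \<open>c\<close> and \<open>d\<close> may be single points.\<close>
  define a b c d e f where "a = Min K" and "b = Min J" and "c = Min I" and "d = Max I" and "e = Max J" and "f = Max K"
  note defs = a_def b_def c_def d_def e_def f_def
  have memJ: "b \<in> J" "c \<in> J" "d \<in> J" "e \<in> J" using I'(3,4) J'(3,4) IJ unfolding defs by blast+
  have memK: "a \<in> K" "b \<in> K" "c \<in> K" "d \<in> K" "e \<in> K" "f \<in> K" using memJ JK K'(3,4) unfolding defs by blast+
  have o: "a \<le> b" "b \<le> c" "c < d" "d \<le> e" "e \<le> f"
    using memK memJ J'(1) K'(1) I'(6) by (simp_all add: defs)
  define L M U where "L = J \<inter> {b..c}" and "M = J \<inter> {c..d}" and "U = J \<inter> {d..e}"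
  define La Ma Ua where "La = K \<inter> {b..c}" and "Ma = K \<inter> {c..d}" and "Ua = K \<inter> {d..e}"
  define L' U' where "L' = K \<inter> {a..b}" and "U' = K \<inter> {e..f}"
  note dIJ = DT_pieces[OF I J IJ, folded defs, folded L_def M_def U_def]
  note eqIJ = DT_eq[OF I J IJ, folded defs, folded L_def M_def U_def]
  note dJK = DT_pieces[OF J K JK, folded defs]
  note eqJK = DT_eq[OF J K JK, folded defs]
  note eqIK = DT_eq[OF I K IK, folded defs, folded Ma_def]
  have mid: "K \<inter> {b..e} = La \<union> Ma \<union> Ua" using o by (auto simp: La_def Ma_def Ua_def)
  have low: "K \<inter> {a..c} = L' \<union> La" using o by (auto simp: L'_def La_def)
  have up: "K \<inter> {d..f} = Ua \<union> U'" using o by (auto simp: U'_def Ua_def)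
  have rL: "refines1 L La" unfolding L_def La_def by (rule interval_refines1[OF J K JK memJ(1,2) o(2)])
  have rU: "refines1 U Ua" unfolding U_def Ua_def by (rule interval_refines1[OF J K JK memJ(3,4) o(4)])
  have cd: "c \<le> d" using o by simp
  have rM: "refines M Ma"
    using interval_part[OF J memJ(2,3) cd] interval_part[OF K memK(3,4) cd] o(3) JK
    unfolding M_def Ma_def refines_def by auto
  define w where "w = DD I M x"
  have w: "w \<in> el M" unfolding w_def by (rule star_monoD(3)[OF DD_mono'[OF dIJ(3)] x])
  define v where "v = DD M Ma w"
  have v: "v \<in> el Ma" unfolding v_def by (rule star_monoD(3)[OF DD_mono'[OF rM] w])
  have v_eq: "v = DD I Ma x" unfolding v_def w_def by (rule DD_DD[OF I dIJ(3) rM x])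
  from DD_TL[OF dIJ(1) rM rL w]
  have tl: "DD (L \<union> M) (La \<union> Ma) (TL L M w) = TL La Ma v" "lower La Ma" "refines (L \<union> M) (La \<union> Ma)"
    by (auto simp: v_def)
  have TLw: "TL L M w \<in> el (L \<union> M)" by (rule star_monoD(3)[OF TL_mono[OF dIJ(1)] w])
  from DD_TR[OF lower_upper(2)[OF dIJ(1,2)] tl(3) rU TLw]
  have tr: "DD (L \<union> M \<union> U) (La \<union> Ma \<union> Ua) (TR (L \<union> M) U (TL L M w)) = TR (La \<union> Ma) Ua (DD (L \<union> M) (La \<union> Ma) (TL L M w))"
    "upper (La \<union> Ma) Ua" by auto
  have TLv: "TL La Ma v \<in> el (La \<union> Ma)" by (rule star_monoD(3)[OF TL_mono[OF tl(2)] v])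
  have "DD J (La \<union> Ma \<union> Ua) (DT I J x) = DD (L \<union> M \<union> U) (La \<union> Ma \<union> Ua) (TR (L \<union> M) U (TL L M w))"
    by (simp only: eqIJ w_def dIJ(4))
  also have "\<dots> = TR (La \<union> Ma) Ua (TL La Ma v)" by (simp only: tr(1) tl(1))
  finally have mid_eq: "DD J (La \<union> Ma \<union> Ua) (DT I J x) = TR (La \<union> Ma) Ua (TL La Ma v)" .
  have lL': "lower L' (La \<union> Ma \<union> Ua)" using dJK(1) by (simp only: mid L'_def)
  have uU': "upper (La \<union> Ma \<union> Ua) U'" using dJK(2) by (simp only: mid U'_def)
  have lL'': "lower L' (La \<union> Ma)"
    unfolding L'_def La_def Ma_def
    using interval_lower[OF K memK(2,3,4) o(2,3)] interval_lower[OF K memK(1,2,4) o(1)] o by simp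
  note ll = TL_TL[OF tl(2) lL'' v, THEN conjunct1]
  have uMa: "upper (L' \<union> (La \<union> Ma)) Ua" by (rule lower_upper(2)[OF lL'' tr(2)])
  have uU'': "upper (L' \<union> (La \<union> Ma) \<union> Ua) U'" using lower_upper(2)[OF lL' uU'] by (simp only: Un_assoc)
  have TLL: "TL L' (La \<union> Ma) (TL La Ma v) \<in> el (L' \<union> (La \<union> Ma))"
    by (rule star_monoD(3)[OF TL_mono[OF lL''] TLv])
  \<comment> \<open>The left unit on \<open>L'\<close> is moved inside the right unit on
    \<open>Ua\<close>; after that, \<open>L'\<close> meets \<open>La\<close> and \<open>Ua\<close>
    meets \<open>U'\<close>, so the units merge into those of \<open>DT I K\<close>.\<close>
  have "DT J K (DT I J x) = TR (L' \<union> (La \<union> Ma \<union> Ua)) U' (TL L' (La \<union> Ma \<union> Ua) (TR (La \<union> Ma) Ua (TL La Ma v)))"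
    using eqJK[of "DT I J x"] by (simp only: mid mid_eq L'_def U'_def)
  also have "TL L' (La \<union> Ma \<union> Ua) (TR (La \<union> Ma) Ua (TL La Ma v))
      = TR (L' \<union> (La \<union> Ma)) Ua (TL L' (La \<union> Ma) (TL La Ma v))"
    by (rule TL_TR[OF lL'' tr(2) TLv])
  also have "TR (L' \<union> (La \<union> Ma \<union> Ua)) U' (TR (L' \<union> (La \<union> Ma)) Ua (TL L' (La \<union> Ma) (TL La Ma v)))
      = TR (L' \<union> (La \<union> Ma)) (Ua \<union> U') (TL L' (La \<union> Ma) (TL La Ma v))"
    using TR_TR[OF uMa uU'' TLL] by (simp only: Un_assoc)
  also have "\<dots> = TR ((L' \<union> La) \<union> Ma) (Ua \<union> U') (TL (L' \<union> La) Ma v)" by (simp only: ll Un_assoc)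
  also have "\<dots> = DT I K x" by (simp only: eqIK low up v_eq)
  finally show ?thesis .
qed

end

theorem proposition4p1:
  fixes A :: "real \<Rightarrow> real \<Rightarrow> 'a cstar"
    and T :: "'a tensor_system"
    and \<Delta> :: "real \<Rightarrow> real \<Rightarrow> real \<Rightarrow> 'a \<Rightarrow> 'a"
    and p :: "real \<Rightarrow> real \<Rightarrow> 'a"
  assumes "tensor_realization A T"
    and "cstar_subproduct_system A T \<Delta>"
    and "subproduct_unit A T \<Delta> p"
  shows "(\<forall>I\<in>parts. \<forall>J\<in>parts. I \<subseteq> J \<longrightarrow>
            star_mono (alg T I) (alg T J) (Delta_times T \<Delta> p I J)) \<and>
         inductive_system parts {(I, J). I \<in> parts \<and> J \<in> parts \<and> I \<subseteq> J}
            (alg T) (Delta_times T \<Delta> p)"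
proof -
  interpret unital_subproduct_system A T \<Delta> p by unfold_locales fact+
  have "partial_order_on parts {(I, J). I \<in> parts \<and> J \<in> parts \<and> I \<subseteq> J}"
    by (auto simp: partial_order_on_def preorder_on_def refl_on_def trans_def antisym_def)
  moreover have "parts \<noteq> {}" using two_parts(1)[of 1 2] by auto
  moreover have "\<exists>K\<in>parts. (I, K) \<in> {(I, J). I \<in> parts \<and> J \<in> parts \<and> I \<subseteq> J} \<and>
      (J, K) \<in> {(I, J). I \<in> parts \<and> J \<in> parts \<and> I \<subseteq> J}" if "I \<in> parts" "J \<in> parts" for I J
  proof -
    have "I \<union> J \<in> parts" using that partsD[OF that(1)] by (intro partsI[of _ "Min I" "Max I"]) (auto simp: parts_def)
    then show ?thesis using that by auto
  qed
  ultimately show ?thesis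
    unfolding inductive_system_def using DT_mono star_monoD(1)[OF DT_mono] DT_id DT_comp alg_cstar by simp
qed

end
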